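(* Let $3\le n<m$, and let $\alpha:(S^*\times\mathcal Z)/\!/\mathbb C^*\to Q$ be the morphism induced by $(\lambda,f)\mapsto\bar\lambda^{\,m-n}f$. Then $\alpha$ is a finite morphism with image precisely equal to $\overline{R\cdot\mathsf p}$. Moreover, $\alpha^{-1}(R\cdot\mathsf p)=\bigl((S^*\setminus S_1^* )\times\mathcal Z^o\bigr)/\!/\mathbb C^*$ and the map $\alpha_o$ obtained from the restriction of $\alpha$ to $\bigl((S^*\setminus S_1^* )\times\mathcal Z^o\bigr)/\!/\mathbb C^*$ is a biregular isomorphism $$\alpha_o:\bigl((S^*\setminus S_1^* )\times\mathcal Z^o\bigr)/\!/\mathbb C^*\xrightarrow{\ \sim\ }R\cdot\mathsf p.$$ In particular, $\alpha$ is a proper and birational morphism onto $\overline{R\cdot\mathsf p}$.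
   Context: All varieties are over $\mathbb C$. Let $\mathfrak v$ be a complex vector space of dimension $m$ with basis $e_1,\dots,e_m$, $E=\operatorname{End}\mathfrak v$ (identified with $m\times m$ matrices $X=(x_{i,j})$), with basis of matrix units $e_{i,j}=e_i\otimes e_j^*$; $G=\operatorname{GL}(E)$, acting on each $S^k(E^* )$ (homogeneous polynomials of degree $k$ on $E$) by $(g\cdot q)(X)=q(g^{-1}X)$; $Q=S^m(E^* )$. Define $\mathsf p\in Q$ by $\mathsf p(X)=x_{1,1}^{m-n}\operatorname{perm}(X^o)$, where $X^o=(x_{i,j})_{m-n+1\le i,j\le m}$ and $\operatorname{perm}$ is the permanent. Let $S_1$ be the span of all $e_{i,j}$ with $m-n+1\le i,j\le m$, $S=\mathbb Ce_{1,1}\oplus S_1$, and $S^\perp$ the span of the remaining $e_{i,j}$, so $E=S^\perp\oplus\mathbb Ce_{1,1}\oplus S_1$. $L_P^2=\operatorname{GL}(S)\subset G$ (acting as the identity on $S^\perp$), $R\subset L_P^2$ is the subgroup stabilizing the line $\mathbb Ce_{1,1}$, and $\operatorname{GL}(S_1)\subset G$ acts as the identity on $S^\perp\oplus\mathbb Ce_{1,1}$. Closures are Zariski closures with reduced structure; $\overline{R\cdot\mathsf p}$ is taken in $Q$. View $\operatorname{perm}\in S^n(E^* )$ via $X\mapsto\operatorname{perm}(X^o)$; $\mathcal Z^o=\operatorname{GL}(S_1)\cdot\operatorname{perm}\subset S^n(E^* )$ and $\mathcal Z=\overline{\mathcal Z^o}$ in $S^n(E^* )$. For $\lambda\in S^*$,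 $\bar\lambda\in E^*$ is its composition with the projection $E\to S$ along $S^\perp$. $S_1^*$ is regarded as a subspace of $S^*$ via the projection $S=\mathbb Ce_{1,1}\oplus S_1\to S_1$, i.e. as the functionals vanishing on $e_{1,1}$. $\mathbb C^*$ acts on $S^*\times\mathcal Z$ by $z(\lambda,f)=(z\lambda,z^{n-m}f)$, and $/\!/$ denotes the (affine) GIT quotient; the $\mathbb C^*$-orbits in $(S^*\setminus S_1^* )\times\mathcal Z^o$ are closed in $S^*\times\mathcal Z$ and $\bigl((S^*\setminus S_1^* )\times\mathcal Z^o\bigr)/\!/\mathbb C^*$ is the orbit space, viewed as an open subset of $(S^*\times\mathcal Z)/\!/\mathbb C^*$. *)

theory Defs
  imports "HOL-Analysis.Analysis" "HOL-Combinatorics.Permutations"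
begin

text \<open>
  Everything is in the language of classical (reduced) affine varieties over the complex numbers.
  A vector space is a linear subspace of some function space \<open>'i \<Rightarrow> complex\<close>. A function with
  domain \<open>X\<close> is represented by its extension by zero outside \<open>X\<close>, so that
  functions with the same domain that agree on it are equal.
\<close>

definition ext0 :: "'a set \<Rightarrow> ('a \<Rightarrow> complex) \<Rightarrow> 'a \<Rightarrow> complex" where
  "ext0 X f = (\<lambda>x. if x \<in> X then f x else 0)"

section \<open>Vector spaces and polynomial functions\<close>

text \<open>The span of the standard basis vectors indexed by \<open>I\<close>, for finite \<open>I\<close>.\<close>

definition coord_space :: "'i set \<Rightarrow> ('i \<Rightarrow> complex) set" where
  "coord_space I = {v. \<forall>i. i \<notin> I \<longrightarrow> v i = 0}"

definition unit_vec :: "'i \<Rightarrow> 'i \<Rightarrow> complex" where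
  "unit_vec i = (\<lambda>j. if j = i then 1 else 0)"

definition dual :: "('i \<Rightarrow> complex) set \<Rightarrow> (('i \<Rightarrow> complex) \<Rightarrow> complex) set" where
  "dual V = {l. (\<forall>v. v \<notin> V \<longrightarrow> l v = 0) \<and>
                (\<forall>v\<in>V. \<forall>w\<in>V. l (\<lambda>i. v i + w i) = l v + l w) \<and>
                (\<forall>c. \<forall>v\<in>V. l (\<lambda>i. c * v i) = c * l v)}"

text \<open>The \<open>\<complex>\<close>-algebra of functions on \<open>X\<close> generated by the restrictions to \<open>X\<close> of the
  functions in \<open>F\<close>.\<close>

inductive_set fun_alg :: "'a set \<Rightarrow> ('a \<Rightarrow> complex) set \<Rightarrow> ('a \<Rightarrow> complex) set"
  for X F where
  const: "ext0 X (\<lambda>_. c) \<in> fun_alg X F"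
| gen: "f \<in> F \<Longrightarrow> ext0 X f \<in> fun_alg X F"
| add: "f \<in> fun_alg X F \<Longrightarrow> g \<in> fun_alg X F \<Longrightarrow> (\<lambda>x. f x + g x) \<in> fun_alg X F"
| mult: "f \<in> fun_alg X F \<Longrightarrow> g \<in> fun_alg X F \<Longrightarrow> (\<lambda>x. f x * g x) \<in> fun_alg X F"

text \<open>\<open>S\<^sup>k(V\<^sup>*)\<close>, the homogeneous polynomials of degree \<open>k\<close> on \<open>V\<close>.\<close>

definition sym_power_dual :: "nat \<Rightarrow> ('i \<Rightarrow> complex) set \<Rightarrow> (('i \<Rightarrow> complex) \<Rightarrow> complex) set" where
  "sym_power_dual k V =
     {q \<in> fun_alg V (dual V). \<forall>c. \<forall>v\<in>V. q (\<lambda>i. c * v i) = c ^ k * q v}"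

section \<open>Affine varieties and morphisms\<close>

text \<open>An affine variety is given by its set of points and its ring of regular functions.\<close>

record 'p affine_variety =
  pts :: "'p set"
  fns :: "('p \<Rightarrow> complex) set"

text \<open>A Zariski closed subset \<open>X\<close> of the vector space \<open>V\<close> with its reduced structure.\<close>

definition closed_subvariety ::
    "('i \<Rightarrow> complex) set \<Rightarrow> ('i \<Rightarrow> complex) set \<Rightarrow> ('i \<Rightarrow> complex) affine_variety" where
  "closed_subvariety V X = \<lparr>pts = X, fns = fun_alg X (dual V)\<rparr>"

abbreviation affine_space :: "('i \<Rightarrow> complex) set \<Rightarrow> ('i \<Rightarrow> complex) affine_variety" where
  "affine_space V \<equiv> closed_subvariety V V"

definition prod_variety ::
    "'p affine_variety \<Rightarrow> 'q affine_variety \<Rightarrow> ('p \<times> 'q) affine_variety" where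
  "prod_variety A B =
     \<lparr>pts = pts A \<times> pts B,
      fns = fun_alg (pts A \<times> pts B) ((\<lambda>f. f \<circ> fst) ` fns A \<union> (\<lambda>g. g \<circ> snd) ` fns B)\<rparr>"

definition zariski :: "'p affine_variety \<Rightarrow> 'p topology" where
  "zariski A = topology_generated_by {{x \<in> pts A. f x \<noteq> 0} | f. f \<in> fns A}"

text \<open>Regular functions on a locally closed subset \<open>U\<close>: locally quotients of elements of the
  coordinate ring.\<close>

definition regular_on :: "'p affine_variety \<Rightarrow> 'p set \<Rightarrow> ('p \<Rightarrow> complex) \<Rightarrow> bool" where
  "regular_on A U f \<longleftrightarrow>
     (\<forall>x\<in>U. \<exists>W. openin (subtopology (zariski A) U) W \<and> x \<in> W \<and>
        (\<exists>g\<in>fns A. \<exists>h\<in>fns A. \<forall>y\<in>W. h y \<noteq> 0 \<and> f y = g y / h y))"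

text \<open>Morphisms between locally closed subsets \<open>U\<close> of \<open>A\<close> and \<open>W\<close> of \<open>B\<close>.\<close>

definition morphism_on ::
    "'p affine_variety \<Rightarrow> 'p set \<Rightarrow> 'q affine_variety \<Rightarrow> 'q set \<Rightarrow> ('p \<Rightarrow> 'q) \<Rightarrow> bool" where
  "morphism_on A U B W \<phi> \<longleftrightarrow>
     continuous_map (subtopology (zariski A) U) (subtopology (zariski B) W) \<phi> \<and>
     (\<forall>V f. openin (subtopology (zariski B) W) V \<and> regular_on B V f \<longrightarrow>
        regular_on A {x \<in> U. \<phi> x \<in> V} (\<lambda>x. f (\<phi> x)))"

abbreviation morphism :: "'p affine_variety \<Rightarrow> 'q affine_variety \<Rightarrow> ('p \<Rightarrow> 'q) \<Rightarrow> bool" where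
  "morphism A B \<equiv> morphism_on A (pts A) B (pts B)"

definition biregular_on ::
    "'p affine_variety \<Rightarrow> 'p set \<Rightarrow> 'q affine_variety \<Rightarrow> 'q set \<Rightarrow> ('p \<Rightarrow> 'q) \<Rightarrow> bool" where
  "biregular_on A U B W \<phi> \<longleftrightarrow>
     bij_betw \<phi> U W \<and> morphism_on A U B W \<phi> \<and> morphism_on B W A U (inv_into U \<phi>)"

text \<open>The coordinate ring of \<open>A\<close> is a finitely generated module over that of \<open>B\<close>;
  dominance is not required.\<close>

definition finite_morphism ::
    "'p affine_variety \<Rightarrow> 'q affine_variety \<Rightarrow> ('p \<Rightarrow> 'q) \<Rightarrow> bool" where
  "finite_morphism A B \<phi> \<longleftrightarrow>
     morphism A B \<phi> \<and>
     (\<exists>M. finite M \<and> M \<subseteq> fns A \<and>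
        (\<forall>a\<in>fns A. \<exists>c. (\<forall>b\<in>M. c b \<in> fns B) \<and>
           (\<forall>x\<in>pts A. a x = (\<Sum>b\<in>M. c b (\<phi> x) * b x))))"

text \<open>Separatedness and finite type being automatic for affine varieties, properness is universal
  closedness. As this is local on the target, it suffices to consider base changes to affine
  varieties, that is, up to isomorphism, to closed subvarieties of some \<open>\<complex>\<^sup>k\<close>.\<close>

definition proper_morphism ::
    "'p affine_variety \<Rightarrow> 'q affine_variety \<Rightarrow> ('p \<Rightarrow> 'q) \<Rightarrow> bool" where
  "proper_morphism A B \<phi> \<longleftrightarrow>
     morphism A B \<phi> \<and>
     (\<forall>(k::nat) W \<psi>. closedin (zariski (affine_space (coord_space {..<k}))) W \<longrightarrow>
        (let C = closed_subvariety (coord_space {..<k}) W in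
         morphism C B \<psi> \<longrightarrow>
         closed_map
           (subtopology (zariski (prod_variety A C)) {(x, w). x \<in> pts A \<and> w \<in> W \<and> \<phi> x = \<psi> w})
           (zariski C) snd))"

definition dense_open :: "'p affine_variety \<Rightarrow> 'p set \<Rightarrow> bool" where
  "dense_open A U \<longleftrightarrow> openin (zariski A) U \<and> zariski A closure_of U = pts A"

definition birational_morphism ::
    "'p affine_variety \<Rightarrow> 'q affine_variety \<Rightarrow> ('p \<Rightarrow> 'q) \<Rightarrow> bool" where
  "birational_morphism A B \<phi> \<longleftrightarrow>
     morphism A B \<phi> \<and>
     (\<exists>U W. dense_open A U \<and> dense_open B W \<and> biregular_on A U B W \<phi>)"

section \<open>Affine GIT quotients\<close>

text \<open>A group \<open>\<Gamma>\<close> acts on the points of \<open>A\<close> through \<open>\<sigma>\<close>.\<close>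

definition invariants ::
    "'p affine_variety \<Rightarrow> 'g set \<Rightarrow> ('g \<Rightarrow> 'p \<Rightarrow> 'p) \<Rightarrow> ('p \<Rightarrow> complex) set" where
  "invariants A \<Gamma> \<sigma> = {a \<in> fns A. \<forall>z\<in>\<Gamma>. \<forall>x\<in>pts A. a (\<sigma> z x) = a x}"

text \<open>The closed points of the spectrum of a ring \<open>R\<close> of functions on \<open>X\<close>, as
  \<open>\<complex>\<close>-algebra homomorphisms from \<open>R\<close> to \<open>\<complex>\<close>.\<close>

definition max_spec :: "'a set \<Rightarrow> ('a \<Rightarrow> complex) set \<Rightarrow> (('a \<Rightarrow> complex) \<Rightarrow> complex) set" where
  "max_spec X R = {\<xi>. (\<forall>a. a \<notin> R \<longrightarrow> \<xi> a = 0) \<and>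
     (\<forall>c. \<xi> (ext0 X (\<lambda>_. c)) = c) \<and>
     (\<forall>a\<in>R. \<forall>b\<in>R. \<xi> (\<lambda>x. a x + b x) = \<xi> a + \<xi> b \<and> \<xi> (\<lambda>x. a x * b x) = \<xi> a * \<xi> b)}"

text \<open>The spectrum of the ring of invariants.\<close>

definition git_quotient ::
    "'p affine_variety \<Rightarrow> 'g set \<Rightarrow> ('g \<Rightarrow> 'p \<Rightarrow> 'p) \<Rightarrow> (('p \<Rightarrow> complex) \<Rightarrow> complex) affine_variety" where
  "git_quotient A \<Gamma> \<sigma> =
     (let I = invariants A \<Gamma> \<sigma>; P = max_spec (pts A) I
      in \<lparr>pts = P, fns = (\<lambda>a. ext0 P (\<lambda>\<xi>. \<xi> a)) ` I\<rparr>)"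

definition git_proj ::
    "'p affine_variety \<Rightarrow> 'g set \<Rightarrow> ('g \<Rightarrow> 'p \<Rightarrow> 'p) \<Rightarrow> 'p \<Rightarrow> ('p \<Rightarrow> complex) \<Rightarrow> complex" where
  "git_proj A \<Gamma> \<sigma> x = ext0 (invariants A \<Gamma> \<sigma>) (\<lambda>a. a x)"

text \<open>The morphism from the quotient to \<open>B\<close> induced by an invariant morphism \<open>\<phi>\<close> from \<open>A\<close> to
  \<open>B\<close>, i.e. the one dual to the pull-back of functions along \<open>\<phi>\<close>.\<close>

definition git_induced ::
    "'p affine_variety \<Rightarrow> 'q affine_variety \<Rightarrow> ('p \<Rightarrow> 'q) \<Rightarrow> (('p \<Rightarrow> complex) \<Rightarrow> complex) \<Rightarrow> 'q" where
  "git_induced A B \<phi> \<xi> =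
     (THE y. y \<in> pts B \<and> (\<forall>b\<in>fns B. b y = \<xi> (ext0 (pts A) (\<lambda>x. b (\<phi> x)))))"

section \<open>General linear groups acting on polynomials\<close>

definition GL :: "('i \<Rightarrow> complex) set \<Rightarrow> (('i \<Rightarrow> complex) \<Rightarrow> ('i \<Rightarrow> complex)) set" where
  "GL V = {g. g \<in> extensional V \<and> bij_betw g V V \<and>
              (\<forall>v\<in>V. \<forall>w\<in>V. g (\<lambda>i. v i + w i) = (\<lambda>i. g v i + g w i)) \<and>
              (\<forall>c. \<forall>v\<in>V. g (\<lambda>i. c * v i) = (\<lambda>i. c * g v i))}"

text \<open>\<open>GL(V)\<close> as a subgroup of \<open>GL(E)\<close>, where \<open>E\<close> is the direct sum of \<open>V\<close> and \<open>W\<close>, acting as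
  the identity on \<open>W\<close>.\<close>

definition GL_summand ::
    "('i \<Rightarrow> complex) set \<Rightarrow> ('i \<Rightarrow> complex) set \<Rightarrow> ('i \<Rightarrow> complex) set \<Rightarrow>
     (('i \<Rightarrow> complex) \<Rightarrow> ('i \<Rightarrow> complex)) set" where
  "GL_summand E V W = {g \<in> GL E. g ` V = V \<and> (\<forall>w\<in>W. g w = w)}"

definition act_poly ::
    "('i \<Rightarrow> complex) set \<Rightarrow> (('i \<Rightarrow> complex) \<Rightarrow> ('i \<Rightarrow> complex)) \<Rightarrow>
     (('i \<Rightarrow> complex) \<Rightarrow> complex) \<Rightarrow> ('i \<Rightarrow> complex) \<Rightarrow> complex" where
  "act_poly E g q = ext0 E (\<lambda>X. q (inv_into E g X))"

section \<open>The spaces attached to the permanent\<close>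

text \<open>A matrix is a function on pairs of indices, with rows and columns numbered from \<open>1\<close>.\<close>

type_synonym cmat = "nat \<times> nat \<Rightarrow> complex"
type_synonym poly_fun = "cmat \<Rightarrow> complex"

definition permanent :: "nat set \<Rightarrow> cmat \<Rightarrow> complex" where
  "permanent I X = (\<Sum>\<pi> | \<pi> permutes I. \<Prod>i\<in>I. X (i, \<pi> i))"

definition idxE :: "nat \<Rightarrow> (nat \<times> nat) set" where
  "idxE m = {1..m} \<times> {1..m}"

definition idxS1 :: "nat \<Rightarrow> nat \<Rightarrow> (nat \<times> nat) set" where
  "idxS1 m n = {m - n + 1..m} \<times> {m - n + 1..m}"

definition idxS :: "nat \<Rightarrow> nat \<Rightarrow> (nat \<times> nat) set" where
  "idxS m n = insert (1, 1) (idxS1 m n)"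

definition spaceE :: "nat \<Rightarrow> cmat set" where
  "spaceE m = coord_space (idxE m)"

definition spaceS1 :: "nat \<Rightarrow> nat \<Rightarrow> cmat set" where
  "spaceS1 m n = coord_space (idxS1 m n)"

definition line11 :: "cmat set" where
  "line11 = coord_space {(1, 1)}"

definition spaceS :: "nat \<Rightarrow> nat \<Rightarrow> cmat set" where
  "spaceS m n = coord_space (idxS m n)"

definition spaceSperp :: "nat \<Rightarrow> nat \<Rightarrow> cmat set" where
  "spaceSperp m n = coord_space (idxE m - idxS m n)"

definition varQ :: "nat \<Rightarrow> poly_fun affine_variety" where
  "varQ m = affine_space (sym_power_dual m (spaceE m))"

definition perm_form :: "nat \<Rightarrow> nat \<Rightarrow> poly_fun" where
  "perm_form m n = ext0 (spaceE m) (permanent {m - n + 1..m})"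

definition padded_perm :: "nat \<Rightarrow> nat \<Rightarrow> poly_fun" where
  "padded_perm m n =
     ext0 (spaceE m) (\<lambda>X. X (1, 1) ^ (m - n) * permanent {m - n + 1..m} X)"

definition LP2 :: "nat \<Rightarrow> nat \<Rightarrow> (cmat \<Rightarrow> cmat) set" where
  "LP2 m n = GL_summand (spaceE m) (spaceS m n) (spaceSperp m n)"

definition groupR :: "nat \<Rightarrow> nat \<Rightarrow> (cmat \<Rightarrow> cmat) set" where
  "groupR m n = {g \<in> LP2 m n. g ` line11 = line11}"

definition GLS1 :: "nat \<Rightarrow> nat \<Rightarrow> (cmat \<Rightarrow> cmat) set" where
  "GLS1 m n = GL_summand (spaceE m) (spaceS1 m n) (coord_space (idxE m - idxS1 m n))"

definition orbitRp :: "nat \<Rightarrow> nat \<Rightarrow> poly_fun set" where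
  "orbitRp m n = (\<lambda>g. act_poly (spaceE m) g (padded_perm m n)) ` groupR m n"

definition closureRp :: "nat \<Rightarrow> nat \<Rightarrow> poly_fun set" where
  "closureRp m n = zariski (varQ m) closure_of orbitRp m n"

definition Zo :: "nat \<Rightarrow> nat \<Rightarrow> poly_fun set" where
  "Zo m n = (\<lambda>g. act_poly (spaceE m) g (perm_form m n)) ` GLS1 m n"

definition Z :: "nat \<Rightarrow> nat \<Rightarrow> poly_fun set" where
  "Z m n = zariski (affine_space (sym_power_dual n (spaceE m))) closure_of Zo m n"

definition dualS1 :: "nat \<Rightarrow> nat \<Rightarrow> poly_fun set" where
  "dualS1 m n = {l \<in> dual (spaceS m n). l (unit_vec (1, 1)) = 0}"

text \<open>\<open>ext0 (idxS m n)\<close> is the projection of \<open>E\<close> onto \<open>S\<close> along \<open>S\<^sup>\<bottom>\<close>.\<close>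

definition bar :: "nat \<Rightarrow> nat \<Rightarrow> poly_fun \<Rightarrow> poly_fun" where
  "bar m n l = ext0 (spaceE m) (\<lambda>X. l (ext0 (idxS m n) X))"

section \<open>The quotient and the map to the space of polynomials\<close>

definition varSZ :: "nat \<Rightarrow> nat \<Rightarrow> (poly_fun \<times> poly_fun) affine_variety" where
  "varSZ m n = prod_variety (affine_space (dual (spaceS m n)))
                 (closed_subvariety (sym_power_dual n (spaceE m)) (Z m n))"

definition torus_act ::
    "nat \<Rightarrow> nat \<Rightarrow> complex \<Rightarrow> poly_fun \<times> poly_fun \<Rightarrow> poly_fun \<times> poly_fun" where
  "torus_act m n z = (\<lambda>(l, f). (\<lambda>X. z * l X, \<lambda>X. z powi (int n - int m) * f X))"

definition quotSZ :: "nat \<Rightarrow> nat \<Rightarrow> ((poly_fun \<times> poly_fun \<Rightarrow> complex) \<Rightarrow> complex) affine_variety" where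
  "quotSZ m n = git_quotient (varSZ m n) (UNIV - {0}) (torus_act m n)"

definition projSZ :: "nat \<Rightarrow> nat \<Rightarrow> poly_fun \<times> poly_fun \<Rightarrow> (poly_fun \<times> poly_fun \<Rightarrow> complex) \<Rightarrow> complex" where
  "projSZ m n = git_proj (varSZ m n) (UNIV - {0}) (torus_act m n)"

text \<open>The open subset of the quotient that is the orbit space of
  \<open>(S\<^sup>* - S\<^sub>1\<^sup>*) \<times> Z\<^sup>o\<close>: its image under the quotient map.\<close>

definition quot_open :: "nat \<Rightarrow> nat \<Rightarrow> ((poly_fun \<times> poly_fun \<Rightarrow> complex) \<Rightarrow> complex) set" where
  "quot_open m n = projSZ m n ` ((dual (spaceS m n) - dualS1 m n) \<times> Zo m n)"

definition mult_map :: "nat \<Rightarrow> nat \<Rightarrow> poly_fun \<times> poly_fun \<Rightarrow> poly_fun" where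
  "mult_map m n = (\<lambda>(l, f) X. bar m n l X ^ (m - n) * f X)"

definition alpha :: "nat \<Rightarrow> nat \<Rightarrow> ((poly_fun \<times> poly_fun \<Rightarrow> complex) \<Rightarrow> complex) \<Rightarrow> poly_fun" where
  "alpha m n = git_induced (varSZ m n) (varQ m) (mult_map m n)"

end

theory Submission
  imports Defs "HOL-Computational_Algebra.Fundamental_Theorem_Algebra"
begin

text \<open>
  Write \<open>d = m - n\<close>. The invariants of the torus on \<open>S\<^sup>* \<times> Z\<close> are spanned by the products of
  \<open>dk\<close> values of \<open>\<lambda>\<close> with \<open>k\<close> values of \<open>f\<close>. By the Dedekind-Mertens identity, a high power of a
  coordinate of \<open>\<lambda>\<close> times a value of \<open>f\<close> is a combination of values of \<open>\<lambda>\<^sup>d f\<close> with coefficients in \<open>\<lambda>\<close>.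
  Since among many factors some coordinate of \<open>\<lambda>\<close> repeats often, the products with bounded \<open>k\<close>
  generate the invariants as a module over the polynomials in \<open>\<lambda>\<^sup>d f\<close>: the morphism is finite.

  Points of the quotient are characters of the ring of invariants, so lying over for finite extensions
  shows that the image is closed and that the morphism is universally closed. No Nullstellensatz is
  needed, since a character is the evaluation at an explicit pair \<open>(\<lambda>, f)\<close>,
  found by normalising one value of \<open>\<lambda>\<close>.

  If \<open>\<lambda>\<close> does not vanish at \<open>e\<^sub>1\<^sub>1\<close>, the torus allows to normalise \<open>\<lambda> = x\<^sub>1\<^sub>1 + \<mu>\<close>, where \<open>\<mu>\<close> and \<open>f\<close>
  do not involve \<open>x\<^sub>1\<^sub>1\<close>. The coefficients of \<open>x\<^sub>1\<^sub>1\<close> to the powers \<open>d\<close> and \<open>d - 1\<close> in \<open>\<lambda>\<^sup>d f\<close> are \<open>f\<close> and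
  \<open>d \<mu> f\<close>, so \<open>f\<close> and \<open>\<mu>\<close> are rational functions of the product: this is the inverse morphism.
\<close>

text \<open>The Dedekind-Mertens identity is applied on a line y + t u: \<lambda> becomes b + a t
  with a = \<lambda>(u), f becomes a polynomial G of degree at most n, and a^(n + d) G(0) is a
  combination of coefficients of (b + a t)^d G, that is, of values of the product at t = 0, ..., n +
  d. As n + d = m, a coordinate must occur m times, which fixes the bound on k.

  A point of a closure need not be reachable through an explicit family of points. Closedness is
  therefore phrased for a set T mapped to the quotient: evaluation at a point in the closure of the
  image of T is a character of an algebra of functions on T; it extends along a finite extension of
  algebras on the same T, and the extension is read as a point of the quotient. T is the quotient
  itself for the image, and a closed subset of a fibre product for properness.

  Recovering \<mu> as a quotient needs f to be nonzero. At a basis vector where f vanishes, \<mu> is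
  obtained by linearity from two points where it does not.\<close>

lemma ext0_in [simp]: "x \<in> X \<Longrightarrow> ext0 X f x = f x"
  and ext0_notin [simp]: "x \<notin> X \<Longrightarrow> ext0 X f x = 0"
  by (simp_all add: ext0_def)

lemma ext0_cong: "(\<And>x. x \<in> X \<Longrightarrow> f x = g x) \<Longrightarrow> ext0 X f = ext0 X g"
  by (rule ext) (simp add: ext0_def)

lemma ext0_ext0: "Y \<subseteq> X \<Longrightarrow> ext0 Y (ext0 X f) = ext0 Y f"
  by (rule ext0_cong) auto

section \<open>Algebras of functions and their characters\<close>

definition fun_subalg :: "'a set \<Rightarrow> ('a \<Rightarrow> complex) set \<Rightarrow> bool" where
  "fun_subalg X D \<longleftrightarrow> (\<forall>f\<in>D. \<forall>x. x \<notin> X \<longrightarrow> f x = 0) \<and> (\<forall>c. ext0 X (\<lambda>_. c) \<in> D) \<and>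
     (\<forall>f\<in>D. \<forall>g\<in>D. (\<lambda>x. f x + g x) \<in> D \<and> (\<lambda>x. f x * g x) \<in> D)"

text \<open>Values outside \<open>D\<close> are left free, in contrast to \<open>max_spec\<close>,
  where they are 0: the composite of a character with a pull-back is then a character without being
  cut off first.\<close>

definition alg_hom :: "'a set \<Rightarrow> ('a \<Rightarrow> complex) set \<Rightarrow> (('a \<Rightarrow> complex) \<Rightarrow> complex) \<Rightarrow> bool" where
  "alg_hom X D \<eta> \<longleftrightarrow> (\<forall>c. \<eta> (ext0 X (\<lambda>_. c)) = c) \<and>
     (\<forall>f\<in>D. \<forall>g\<in>D. \<eta> (\<lambda>x. f x + g x) = \<eta> f + \<eta> g \<and> \<eta> (\<lambda>x. f x * g x) = \<eta> f * \<eta> g)"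

lemma max_spec_iff: "\<xi> \<in> max_spec X R \<longleftrightarrow> (\<forall>a. a \<notin> R \<longrightarrow> \<xi> a = 0) \<and> alg_hom X R \<xi>"
  by (auto simp: max_spec_def alg_hom_def)

lemma fun_alg_outside: "f \<in> fun_alg X F \<Longrightarrow> x \<notin> X \<Longrightarrow> f x = 0"
  by (induction rule: fun_alg.induct) auto

lemma fun_subalg_fun_alg: "fun_subalg X (fun_alg X F)"
  unfolding fun_subalg_def by (auto intro: fun_alg.intros dest: fun_alg_outside)

context
  fixes X :: "'a set" and D
  assumes D: "fun_subalg X D"
begin

lemma fun_subalg_outside: "f \<in> D \<Longrightarrow> x \<notin> X \<Longrightarrow> f x = 0"
  using D unfolding fun_subalg_def by blast

lemma fun_subalg_const: "ext0 X (\<lambda>_. c) \<in> D"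
  using D unfolding fun_subalg_def by blast

lemma fun_subalg_add: "f \<in> D \<Longrightarrow> g \<in> D \<Longrightarrow> (\<lambda>x. f x + g x) \<in> D"
  using D unfolding fun_subalg_def by blast

lemma fun_subalg_mult: "f \<in> D \<Longrightarrow> g \<in> D \<Longrightarrow> (\<lambda>x. f x * g x) \<in> D"
  using D unfolding fun_subalg_def by blast

lemma fun_subalg_zero: "(\<lambda>_. 0) \<in> D"
proof -
  have "ext0 X (\<lambda>_. 0) = (\<lambda>_. 0)" by (auto simp: ext0_def)
  then show ?thesis using fun_subalg_const[of 0] by simp
qed

lemma fun_subalg_scale: 
  assumes "f \<in> D" shows "(\<lambda>x. c * f x) \<in> D"
proof -
  have "(\<lambda>x. ext0 X (\<lambda>_. c) x * f x) = (\<lambda>x. c * f x)"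
    using fun_subalg_outside[OF assms] by (auto simp: ext0_def)
  then show ?thesis using fun_subalg_mult[OF fun_subalg_const[of c] assms] by simp
qed

lemma fun_subalg_diff: "f \<in> D \<Longrightarrow> g \<in> D \<Longrightarrow> (\<lambda>x. f x - g x) \<in> D"
  using fun_subalg_add[OF _ fun_subalg_scale[of g "-1"], of f] by simp

lemma fun_subalg_sum: "(\<And>i. i \<in> I \<Longrightarrow> f i \<in> D) \<Longrightarrow> (\<lambda>x. \<Sum>i\<in>I. f i x) \<in> D"
  by (induction I rule: infinite_finite_induct) (auto intro: fun_subalg_zero fun_subalg_add)

lemma fun_subalg_ext0: "f \<in> D \<Longrightarrow> ext0 X f = f"
  using fun_subalg_outside by (auto simp: ext0_def)

lemma fun_subalg_prod_list:
  "(\<And>p. p \<in> set ps \<Longrightarrow> ext0 X (g p) \<in> D) \<Longrightarrow> ext0 X (\<lambda>x. prod_list (map (\<lambda>p. g p x) ps)) \<in> D"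
proof (induction ps)
  case Nil
  then show ?case using fun_subalg_const by simp
next
  case (Cons p ps)
  have "ext0 X (\<lambda>x. prod_list (map (\<lambda>p. g p x) (p # ps))) =
      (\<lambda>x. ext0 X (g p) x * ext0 X (\<lambda>x. prod_list (map (\<lambda>p. g p x) ps)) x)"
    by (auto simp: ext0_def)
  then show ?case using Cons fun_subalg_mult by simp
qed

lemma fun_subalg_poly:
  assumes "f \<in> D" shows "ext0 X (\<lambda>x. poly P (f x)) \<in> D"
proof (induction P)
  case 0
  then show ?case using fun_subalg_const[of 0] by simp
next
  case (pCons a P)
  have "ext0 X (\<lambda>x. poly (pCons a P) (f x)) = (\<lambda>x. ext0 X (\<lambda>_. a) x + f x * ext0 X (\<lambda>x. poly P (f x)) x)"
    by (auto simp: ext0_def)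
  then show ?case using pCons fun_subalg_add[OF fun_subalg_const fun_subalg_mult[OF assms]] by simp
qed

end

context
  fixes X :: "'a set" and D \<eta>
  assumes D: "fun_subalg X D" and \<eta>: "alg_hom X D \<eta>"
begin

lemma alg_hom_const: "\<eta> (ext0 X (\<lambda>_. c)) = c"
  using \<eta> unfolding alg_hom_def by blast

lemma alg_hom_add: "f \<in> D \<Longrightarrow> g \<in> D \<Longrightarrow> \<eta> (\<lambda>x. f x + g x) = \<eta> f + \<eta> g"
  using \<eta> unfolding alg_hom_def by blast

lemma alg_hom_mult: "f \<in> D \<Longrightarrow> g \<in> D \<Longrightarrow> \<eta> (\<lambda>x. f x * g x) = \<eta> f * \<eta> g"
  using \<eta> unfolding alg_hom_def by blast

lemma alg_hom_zero: "\<eta> (\<lambda>_. 0) = 0"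
proof -
  have "ext0 X (\<lambda>_. 0) = (\<lambda>_. 0)" by (auto simp: ext0_def)
  then show ?thesis using alg_hom_const[of 0] by simp
qed

lemma alg_hom_scale: 
  assumes "f \<in> D" shows "\<eta> (\<lambda>x. c * f x) = c * \<eta> f"
proof -
  have "(\<lambda>x. ext0 X (\<lambda>_. c) x * f x) = (\<lambda>x. c * f x)"
    using fun_subalg_outside[OF D assms] by (auto simp: ext0_def)
  then show ?thesis
    using alg_hom_mult[OF fun_subalg_const[OF D, of c] assms] alg_hom_const by simp
qed

lemma alg_hom_diff: 
  assumes "f \<in> D" "g \<in> D" shows "\<eta> (\<lambda>x. f x - g x) = \<eta> f - \<eta> g"
  using alg_hom_add[OF assms(1) fun_subalg_scale[OF D assms(2), of "-1"]] alg_hom_scale[OF assms(2), of "-1"]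
  by simp

lemma alg_hom_sum: "finite I \<Longrightarrow> (\<And>i. i \<in> I \<Longrightarrow> f i \<in> D) \<Longrightarrow> \<eta> (\<lambda>x. \<Sum>i\<in>I. f i x) = (\<Sum>i\<in>I. \<eta> (f i))"
proof (induction I rule: finite_induct)
  case empty
  then show ?case by (simp add: alg_hom_zero)
next
  case (insert i I)
  have "\<eta> (\<lambda>x. \<Sum>i\<in>insert i I. f i x) = \<eta> (\<lambda>x. f i x + (\<Sum>i\<in>I. f i x))"
    using insert by simp
  also have "\<dots> = \<eta> (f i) + \<eta> (\<lambda>x. \<Sum>i\<in>I. f i x)"
    using insert by (intro alg_hom_add fun_subalg_sum[OF D]) auto
  finally show ?case using insert by simp
qed

lemma alg_hom_poly:
  assumes "f \<in> D" shows "\<eta> (ext0 X (\<lambda>x. poly P (f x))) = poly P (\<eta> f)"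
proof (induction P)
  case 0
  then show ?case using alg_hom_const[of 0] by simp
next
  case (pCons a P)
  have "ext0 X (\<lambda>x. poly (pCons a P) (f x)) = (\<lambda>x. ext0 X (\<lambda>_. a) x + f x * ext0 X (\<lambda>x. poly P (f x)) x)"
    by (auto simp: ext0_def)
  moreover have "\<eta> \<dots> = a + \<eta> f * poly P (\<eta> f)"
    using pCons assms fun_subalg_poly[OF D assms]
    by (simp add: alg_hom_add alg_hom_mult alg_hom_const fun_subalg_const[OF D] fun_subalg_mult[OF D])
  ultimately show ?case by simp
qed

lemma alg_hom_prod_list:
  "(\<And>p. p \<in> set ps \<Longrightarrow> ext0 X (g p) \<in> D) \<Longrightarrow>
    \<eta> (ext0 X (\<lambda>x. prod_list (map (\<lambda>p. g p x) ps))) = prod_list (map (\<lambda>p. \<eta> (ext0 X (g p))) ps)"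
proof (induction ps)
  case Nil
  then show ?case using alg_hom_const by simp
next
  case (Cons p ps)
  have "ext0 X (\<lambda>x. prod_list (map (\<lambda>p. g p x) (p # ps))) =
      (\<lambda>x. ext0 X (g p) x * ext0 X (\<lambda>x. prod_list (map (\<lambda>p. g p x) ps)) x)"
    by (auto simp: ext0_def)
  then show ?case using Cons alg_hom_mult fun_subalg_prod_list[OF D, of ps g] by simp
qed

end

section \<open>Lying over\<close>

text \<open>A homogeneous linear system with more unknowns than equations has a nontrivial solution:
  an equation with a nonzero coefficient eliminates one unknown. In \<open>lying_over\<close> this
  provides a polynomial relation for an element of a finite extension.\<close>

lemma linear_dependence:
  fixes A :: "'i \<Rightarrow> 'b \<Rightarrow> complex"
  assumes "finite M" "finite I" "card M < card I"
  shows "\<exists>p. (\<exists>i\<in>I. p i \<noteq> 0) \<and> (\<forall>b\<in>M. (\<Sum>i\<in>I. p i * A i b) = 0)"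
  using assms
proof (induction M arbitrary: I A rule: finite_induct)
  case empty
  then obtain i where "i \<in> I" by fastforce
  then show ?case by (intro exI[of _ "\<lambda>_. 1"]) auto
next
  case (insert b M)
  show ?case
  proof (cases "\<forall>i\<in>I. A i b = 0")
    case True
    obtain p where "\<exists>i\<in>I. p i \<noteq> 0" "\<forall>b\<in>M. (\<Sum>i\<in>I. p i * A i b) = 0"
      using insert.IH[OF insert.prems(1), of A] insert.prems insert.hyps by auto
    then show ?thesis using True by (intro exI[of _ p]) auto
  next
    case False
    then obtain k where k: "k \<in> I" "A k b \<noteq> 0" by auto
    define J where "J = I - {k}"
    have J: "finite J" "card M < card J" "k \<notin> J" "I = insert k J"
      using insert k unfolding J_def by auto
    obtain p where p: "\<exists>i\<in>J. p i \<noteq> 0" "\<forall>c\<in>M. (\<Sum>i\<in>J. p i * (A i c - A i b / A k b * A k c)) = 0"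
      using insert.IH[OF J(1,2), of "\<lambda>i c. A i c - A i b / A k b * A k c"] by auto
    \<comment> \<open>The value at the pivot \<open>k\<close> is the one that solves equation
      \<open>b\<close>.\<close>
    define q where "q = p(k := - (\<Sum>i\<in>J. p i * A i b) / A k b)"
    have q: "(\<Sum>i\<in>I. q i * A i c) = (\<Sum>i\<in>J. p i * (A i c - A i b / A k b * A k c))" for c
    proof -
      have "(\<Sum>i\<in>I. q i * A i c) = q k * A k c + (\<Sum>i\<in>J. p i * A i c)"
      proof -
        have "(\<Sum>i\<in>J. q i * A i c) = (\<Sum>i\<in>J. p i * A i c)"
          using J(3) by (intro sum.cong) (auto simp: q_def)
        then show ?thesis unfolding J(4) using J(1,3) by simp
      qed
      then show ?thesis
        by (simp add: q_def algebra_simps sum_subtractf sum_distrib_left sum_divide_distrib)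
    qed
    have "\<exists>i\<in>I. q i \<noteq> 0" using p(1) J by (auto simp: q_def)
    moreover have "(\<Sum>i\<in>I. q i * A i c) = 0" if "c \<in> insert b M" for c
      using that p(2) k by (auto simp: q)
    ultimately show ?thesis by blast
  qed
qed

text \<open>The determinant of diag(s) - N kills every generator, and \<open>\<eta>\<close> sends it
  to the product of the \<open>\<eta> (s i)\<close>, which is nonzero. Elimination of one generator
  at a time replaces the determinant; general diagonal entries \<open>s i\<close> instead of 1 make
  the statement stable under elimination. The generators themselves serve as indices.\<close>

lemma nakayama_elimination:
  assumes B: "fun_subalg X B" and \<eta>: "alg_hom X B \<eta>" and "finite M"
    and "\<forall>i\<in>M. s i \<in> B \<and> \<eta> (s i) \<noteq> 0" "\<forall>i\<in>M. \<forall>j\<in>M. N i j \<in> B \<and> \<eta> (N i j) = 0"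
    and "\<forall>i\<in>M. \<forall>x. s i x * i x = (\<Sum>j\<in>M. N i j x * j x)"
  shows "\<exists>t\<in>B. \<eta> t \<noteq> 0 \<and> (\<forall>i\<in>M. \<forall>x. t x * i x = 0)"
  using assms(3-)
proof (induction M arbitrary: s N rule: finite_induct)
  case empty
  show ?case using fun_subalg_const[OF B, of 1] alg_hom_const[OF B \<eta>, of 1]
    by (intro bexI[of _ "ext0 X (\<lambda>_. 1)"]) auto
next
  case (insert k M)
  \<comment> \<open>The pivot; \<open>\<eta>\<close> does not kill it because it kills
    \<open>N k k\<close> but not \<open>s k\<close>.\<close>
  define t where "t = (\<lambda>x. s k x - N k k x)"
  have t: "t \<in> B" "\<eta> t \<noteq> 0"
    using insert.prems fun_subalg_diff[OF B] alg_hom_diff[OF B \<eta>] unfolding t_def by auto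
  have tk: "t x * k x = (\<Sum>j\<in>M. N k j x * j x)" for x
    using insert.prems(3) insert.hyps unfolding t_def by (auto simp: left_diff_distrib)
  define s' where "s' = (\<lambda>i x. t x * s i x)"
  define N' where "N' = (\<lambda>i j x. t x * N i j x + N i k x * N k j x)"
  have "\<forall>i\<in>M. s' i \<in> B \<and> \<eta> (s' i) \<noteq> 0"
    using insert.prems t unfolding s'_def by (auto simp: fun_subalg_mult[OF B] alg_hom_mult[OF B \<eta>])
  moreover have "\<forall>i\<in>M. \<forall>j\<in>M. N' i j \<in> B \<and> \<eta> (N' i j) = 0"
    using insert.prems t unfolding N'_def
    by (auto simp: fun_subalg_mult[OF B] fun_subalg_add[OF B] alg_hom_mult[OF B \<eta>] alg_hom_add[OF B \<eta>])
  moreover have "\<forall>i\<in>M. \<forall>x. s' i x * i x = (\<Sum>j\<in>M. N' i j x * j x)"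
  proof (intro ballI allI)
    fix i x assume i: "i \<in> M"
    have "s' i x * i x = t x * (s i x * i x)" by (simp add: s'_def)
    also have "\<dots> = t x * (N i k x * k x + (\<Sum>j\<in>M. N i j x * j x))"
      using insert.prems(3) insert.hyps i by auto
    also have "\<dots> = N i k x * (t x * k x) + (\<Sum>j\<in>M. t x * N i j x * j x)"
      by (simp add: algebra_simps sum_distrib_left)
    also have "\<dots> = (\<Sum>j\<in>M. N' i j x * j x)"
      unfolding tk N'_def by (simp add: algebra_simps sum_distrib_left sum.distrib)
    finally show "s' i x * i x = (\<Sum>j\<in>M. N' i j x * j x)" .
  qed
  ultimately obtain u where u: "u \<in> B" "\<eta> u \<noteq> 0" "\<forall>i\<in>M. \<forall>x. u x * i x = 0"
    using insert.IH[of s' N'] by blast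
  \<comment> \<open>\<open>u\<close> kills the other generators and \<open>t\<close> times
    \<open>k\<close> is a combination of those, so the product of \<open>u\<close> and
    \<open>t\<close> kills \<open>k\<close> as well.\<close>
  have "u x * t x * k x = 0" for x
  proof -
    have "u x * t x * k x = (\<Sum>j\<in>M. N k j x * (u x * j x))"
      unfolding mult.assoc tk sum_distrib_left by (intro sum.cong refl) simp
    moreover have "\<dots> = 0" using u(3) by (intro sum.neutral) simp
    ultimately show ?thesis by simp
  qed
  moreover have "u x * t x * i x = 0" if "i \<in> M" for i x
  proof -
    have "u x * t x * i x = t x * (u x * i x)" by simp
    then show ?thesis using u that by (metis mult_zero_right)
  qed
  ultimately show ?case
    using u t by (intro bexI[of _ "\<lambda>x. u x * t x"]) (auto simp: fun_subalg_mult[OF B] alg_hom_mult[OF B \<eta>])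
qed

section \<open>Ideals of an algebra of functions\<close>

definition fun_ideal :: "('a \<Rightarrow> complex) set \<Rightarrow> ('a \<Rightarrow> complex) set \<Rightarrow> bool" where
  "fun_ideal D J \<longleftrightarrow> J \<subseteq> D \<and> (\<lambda>_. 0) \<in> J \<and> (\<forall>f\<in>J. \<forall>g\<in>J. (\<lambda>x. f x + g x) \<in> J) \<and>
     (\<forall>d\<in>D. \<forall>f\<in>J. (\<lambda>x. d x * f x) \<in> J)"

text \<open>Zorn's lemma for the ideals that contain \<open>J0\<close> and avoid \<open>u\<close>;
  with the constant 1 as \<open>u\<close> these are the proper ideals.\<close>

lemma maximal_fun_ideal:
  assumes "fun_ideal D J0" "u \<notin> J0"
  shows "\<exists>J. fun_ideal D J \<and> J0 \<subseteq> J \<and> u \<notin> J \<and>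
    (\<forall>J'. fun_ideal D J' \<and> J \<subseteq> J' \<and> u \<notin> J' \<longrightarrow> J' = J)"
proof -
  define A where "A = {J. fun_ideal D J \<and> J0 \<subseteq> J \<and> u \<notin> J}"
  have "\<exists>J\<in>A. \<forall>X\<in>A. J \<subseteq> X \<longrightarrow> X = J"
  proof (rule subset_Zorn_nonempty)
    show "A \<noteq> {}" using assms by (auto simp: A_def)
  next
    fix C assume C: "C \<noteq> {}" "subset.chain A C"
    then have CA: "C \<subseteq> A" by (auto simp: subset.chain_def)
    have tot: "P \<subseteq> Q \<or> Q \<subseteq> P" if "P \<in> C" "Q \<in> C" for P Q
      using C(2) that by (auto simp: subset.chain_def)
    have ideal: "fun_ideal D R" if "R \<in> C" for R using CA that by (auto simp: A_def)
    have "fun_ideal D (\<Union>C)"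
      unfolding fun_ideal_def
    proof (intro conjI ballI)
      show "\<Union>C \<subseteq> D" using ideal unfolding fun_ideal_def by (meson Union_least)
      obtain R where "R \<in> C" using C(1) by blast
      then show "(\<lambda>_. 0) \<in> \<Union>C" using ideal unfolding fun_ideal_def by (meson UnionI)
    next
      fix f g assume "f \<in> \<Union>C" "g \<in> \<Union>C"
      then obtain P Q where PQ: "P \<in> C" "Q \<in> C" "f \<in> P" "g \<in> Q" by blast
      then obtain R where R: "R \<in> C" "f \<in> R" "g \<in> R" using tot[OF PQ(1,2)] by blast
      then have "(\<lambda>x. f x + g x) \<in> R" using ideal[OF R(1)] unfolding fun_ideal_def by simp
      with R(1) show "(\<lambda>x. f x + g x) \<in> \<Union>C" by (rule UnionI)
    next
      fix d f assume d: "d \<in> D" and "f \<in> \<Union>C"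
      then obtain R where R: "R \<in> C" "f \<in> R" by blast
      then have "(\<lambda>x. d x * f x) \<in> R" using ideal[OF R(1)] d unfolding fun_ideal_def by simp
      with R(1) show "(\<lambda>x. d x * f x) \<in> \<Union>C" by (rule UnionI)
    qed
    moreover have "J0 \<subseteq> \<Union>C" "u \<notin> \<Union>C" using CA C(1) by (auto simp: A_def)
    ultimately show "\<Union>C \<in> A" by (simp add: A_def)
  qed
  then obtain J where J: "J \<in> A" "\<And>K. K \<in> A \<Longrightarrow> J \<subseteq> K \<Longrightarrow> K = J" by blast
  have "fun_ideal D J" "J0 \<subseteq> J" "u \<notin> J" using J(1) by (auto simp: A_def)
  moreover have "J' = J" if "fun_ideal D J'" "J \<subseteq> J'" "u \<notin> J'" for J'
    using J(2)[of J'] that \<open>J0 \<subseteq> J\<close> by (auto simp: A_def)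
  ultimately show ?thesis by blast
qed

text \<open>The kernel of \<open>\<eta>\<close> generates a proper ideal of \<open>D\<close> by the
  Nakayama argument. A maximal ideal \<open>J\<close> above it has residue field \<complex>, because
  every element of \<open>D\<close> satisfies a polynomial over \<complex> modulo \<open>J\<close>,
  and \<open>\<eta>'\<close> is the residue modulo \<open>J\<close>. No quotient ring is formed: all
  congruences are memberships in \<open>J\<close>.\<close>

lemma lying_over:
  assumes B: "fun_subalg X B" and D: "fun_subalg X D" and BD: "B \<subseteq> D"
    and M: "finite M" "M \<subseteq> D"
    and gen: "\<forall>d\<in>D. \<exists>c. (\<forall>b\<in>M. c b \<in> B) \<and> d = (\<lambda>x. \<Sum>b\<in>M. c b x * b x)"
    and \<eta>: "alg_hom X B \<eta>"
  shows "\<exists>\<eta>'. alg_hom X D \<eta>' \<and> (\<forall>b\<in>B. \<eta>' b = \<eta> b)"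
proof -
  let ?one = "ext0 X (\<lambda>_. 1)"
  \<comment> \<open>The ideal of \<open>D\<close> generated by the kernel of \<open>\<eta>\<close>:
    since \<open>M\<close> spans \<open>D\<close> over \<open>B\<close>, it is enough to let the
    coefficients of the generators run through the kernel.\<close>
  define J0 where "J0 = {(\<lambda>x. \<Sum>b\<in>M. c b x * b x) | c. \<forall>b\<in>M. c b \<in> B \<and> \<eta> (c b) = 0}"
  note subD = fun_subalg_mult[OF D] fun_subalg_add[OF D] fun_subalg_sum[OF D]
  have J0D: "J0 \<subseteq> D" using M BD by (auto simp: J0_def intro!: subD)
  have J0mult: "(\<lambda>x. d x * f x) \<in> J0" if d: "d \<in> D" and f: "f \<in> J0" for d f
  proof -
    obtain c where c: "\<forall>b\<in>M. c b \<in> B \<and> \<eta> (c b) = 0" "f = (\<lambda>x. \<Sum>b\<in>M. c b x * b x)"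
      using f unfolding J0_def by blast
    have "\<forall>b\<in>M. \<exists>e. (\<forall>b'\<in>M. e b' \<in> B) \<and> (\<lambda>x. d x * b x) = (\<lambda>x. \<Sum>b'\<in>M. e b' x * b' x)"
      using gen d M subD(1) by blast
    from bchoice[OF this] obtain e where e: "\<And>b b'. b \<in> M \<Longrightarrow> b' \<in> M \<Longrightarrow> e b b' \<in> B"
        "\<And>b. b \<in> M \<Longrightarrow> (\<lambda>x. d x * b x) = (\<lambda>x. \<Sum>b'\<in>M. e b b' x * b' x)"
      by blast
    define c' where "c' = (\<lambda>b' x. \<Sum>b\<in>M. c b x * e b b' x)"
    have "d x * f x = (\<Sum>b'\<in>M. c' b' x * b' x)" for x
    proof -
      have "d x * f x = (\<Sum>b\<in>M. c b x * (d x * b x))"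
        by (simp add: c(2) sum_distrib_left algebra_simps)
      also have "\<dots> = (\<Sum>b\<in>M. c b x * (\<Sum>b'\<in>M. e b b' x * b' x))"
        by (intro sum.cong refl) (simp add: fun_cong[OF e(2)])
      also have "\<dots> = (\<Sum>b\<in>M. \<Sum>b'\<in>M. c b x * e b b' x * b' x)"
        by (simp add: sum_distrib_left mult.assoc)
      also have "\<dots> = (\<Sum>b'\<in>M. c' b' x * b' x)"
        unfolding c'_def by (subst sum.swap) (simp add: sum_distrib_right)
      finally show ?thesis .
    qed
    moreover have "\<forall>b'\<in>M. c' b' \<in> B \<and> \<eta> (c' b') = 0"
      using c(1) e(1) M(1) unfolding c'_def
      by (auto simp: alg_hom_sum[OF B \<eta>] alg_hom_mult[OF B \<eta>] fun_subalg_mult[OF B] intro!: fun_subalg_sum[OF B])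
    ultimately show ?thesis unfolding J0_def by blast
  qed
  have J0ideal: "fun_ideal D J0"
    unfolding fun_ideal_def
  proof (intro conjI ballI J0D J0mult)
    show "(\<lambda>_. 0) \<in> J0" unfolding J0_def
      using fun_subalg_zero[OF B] alg_hom_zero[OF B \<eta>] by (intro CollectI exI[of _ "\<lambda>_ _. 0"]) auto
  next
    fix f g assume "f \<in> J0" "g \<in> J0"
    then obtain c c' where *: "\<forall>b\<in>M. c b \<in> B \<and> \<eta> (c b) = 0" "f = (\<lambda>x. \<Sum>b\<in>M. c b x * b x)"
      "\<forall>b\<in>M. c' b \<in> B \<and> \<eta> (c' b) = 0" "g = (\<lambda>x. \<Sum>b\<in>M. c' b x * b x)"
      unfolding J0_def by blast
    have "(\<lambda>x. f x + g x) = (\<lambda>x. \<Sum>b\<in>M. (c b x + c' b x) * b x)"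
      by (simp add: * sum.distrib distrib_right)
    then show "(\<lambda>x. f x + g x) \<in> J0" unfolding J0_def
      using * by (intro CollectI exI[of _ "\<lambda>b x. c b x + c' b x"])
        (auto simp: fun_subalg_add[OF B] alg_hom_add[OF B \<eta>])
  qed
  have J0mem: "(\<lambda>x. n x * d x) \<in> J0" if n: "n \<in> B" "\<eta> n = 0" and d: "d \<in> D" for n d
  proof -
    obtain c where c: "\<forall>b\<in>M. c b \<in> B" "d = (\<lambda>x. \<Sum>b\<in>M. c b x * b x)" using gen d by blast
    have "(\<lambda>x. n x * d x) = (\<lambda>x. \<Sum>b\<in>M. (n x * c b x) * b x)"
      by (simp add: c sum_distrib_left mult.assoc)
    then show ?thesis unfolding J0_def
      using c n by (intro CollectI exI[of _ "\<lambda>b x. n x * c b x"])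
        (auto simp: fun_subalg_mult[OF B] alg_hom_mult[OF B \<eta>])
  qed
  have one_notin: "?one \<notin> J0"
  proof
    \<comment> \<open>Every generator would then be a combination of the generators with
      coefficients in the kernel. The \<open>t\<close> obtained from the elimination would kill all
      of \<open>D\<close>, hence 1, and so be 0, against \<open>\<eta> t \<noteq> 0\<close>.\<close>
    assume one: "?one \<in> J0"
    have "\<forall>b\<in>M. b \<in> J0"
    proof
      fix b assume b: "b \<in> M"
      then have "(\<lambda>x. b x * ?one x) \<in> J0" using J0mult one M by blast
      moreover have "(\<lambda>x. b x * ?one x) = b"
      proof
        fix x
        have "b \<in> D" using b M by blast
        then show "b x * ?one x = b x" using fun_subalg_outside[OF D, of b x] by (cases "x \<in> X") auto
      qed
      ultimately show "b \<in> J0" by simp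
    qed
    then have "\<forall>b\<in>M. \<exists>c. (\<forall>b'\<in>M. c b' \<in> B \<and> \<eta> (c b') = 0) \<and> b = (\<lambda>x. \<Sum>b'\<in>M. c b' x * b' x)"
      unfolding J0_def by blast
    from bchoice[OF this] obtain N where N: "\<forall>i\<in>M. \<forall>j\<in>M. N i j \<in> B \<and> \<eta> (N i j) = 0"
      "\<And>i. i \<in> M \<Longrightarrow> i = (\<lambda>x. \<Sum>j\<in>M. N i j x * j x)"
      by blast
    have "\<forall>i\<in>M. \<forall>x. ?one x * i x = (\<Sum>j\<in>M. N i j x * j x)"
    proof (intro ballI allI)
      fix i x assume i: "i \<in> M"
      have "i \<in> D" using i M by blast
      then have "?one x * i x = i x" using fun_subalg_outside[OF D, of i x] by (cases "x \<in> X") auto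
      also have "\<dots> = (\<Sum>j\<in>M. N i j x * j x)" by (rule fun_cong[OF N(2)[OF i]])
      finally show "?one x * i x = (\<Sum>j\<in>M. N i j x * j x)" .
    qed
    then obtain t where t: "t \<in> B" "\<eta> t \<noteq> 0" "\<forall>i\<in>M. \<forall>x. t x * i x = 0"
      using nakayama_elimination[OF B \<eta> M(1), of "\<lambda>_. ?one" N] N(1)
        fun_subalg_const[OF B, of 1] alg_hom_const[OF B \<eta>, of 1] by auto
    obtain c where c: "\<forall>b\<in>M. c b \<in> B" "?one = (\<lambda>x. \<Sum>b\<in>M. c b x * b x)"
      using gen fun_subalg_const[OF D, of 1] by blast
    have "t x = 0" for x
    proof (cases "x \<in> X")
      case True
      then have "t x = t x * ?one x" by simp
      also have "\<dots> = (\<Sum>b\<in>M. c b x * (t x * b x))"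
        by (subst c(2)) (simp add: sum_distrib_left algebra_simps)
      also have "\<dots> = 0" using t(3) by (intro sum.neutral) simp
      finally show ?thesis .
    qed (use fun_subalg_outside[OF B t(1)] in auto)
    then have "t = (\<lambda>_. 0)" by auto
    then show False using t(2) alg_hom_zero[OF B \<eta>] by simp
  qed
  obtain J where J: "fun_ideal D J" "J0 \<subseteq> J" "?one \<notin> J"
    "\<And>J'. fun_ideal D J' \<Longrightarrow> J \<subseteq> J' \<Longrightarrow> ?one \<notin> J' \<Longrightarrow> J' = J"
    using maximal_fun_ideal[OF J0ideal one_notin] by auto
  have Jadd: "(\<lambda>x. f x + g x) \<in> J" if "f \<in> J" "g \<in> J" for f g
    using J(1) that unfolding fun_ideal_def by blast
  have Jmult: "(\<lambda>x. d x * f x) \<in> J" if "d \<in> D" "f \<in> J" for d f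
    using J(1) that unfolding fun_ideal_def by blast
  have JD: "J \<subseteq> D" and J0: "(\<lambda>_. 0) \<in> J" using J(1) unfolding fun_ideal_def by auto
  have Jscale: "(\<lambda>x. c * f x) \<in> J" if "f \<in> J" for f c
  proof -
    have "f \<in> D" using that JD by blast
    then have "(\<lambda>x. ext0 X (\<lambda>_. c) x * f x) = (\<lambda>x. c * f x)"
      using fun_subalg_outside[OF D] by (auto simp: ext0_def)
    then show ?thesis using Jmult[OF fun_subalg_const[OF D, of c] that] by simp
  qed
  have Jprime: "g \<in> J" if fg: "(\<lambda>x. f x * g x) \<in> J" "f \<in> D" "g \<in> D" "f \<notin> J" for f g
  proof -
    \<comment> \<open>Maximality is applied to \<open>J + D f\<close>: it contains 1 = j + e f, and
      multiplication by \<open>g\<close> puts \<open>g\<close> into \<open>J\<close>.\<close>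
    define J' where "J' = {(\<lambda>x. j x + e x * f x) | j e. j \<in> J \<and> e \<in> D}"
    have "fun_ideal D J'"
      unfolding fun_ideal_def
    proof (intro conjI ballI)
      show "J' \<subseteq> D" using JD fg by (auto simp: J'_def intro!: subD)
      show "(\<lambda>_. 0) \<in> J'" unfolding J'_def
        using J0 fun_subalg_zero[OF D] by (intro CollectI exI[of _ "\<lambda>_. 0"]) auto
    next
      fix a b assume "a \<in> J'" "b \<in> J'"
      then obtain j e j' e' where *: "a = (\<lambda>x. j x + e x * f x)" "b = (\<lambda>x. j' x + e' x * f x)"
        "j \<in> J" "e \<in> D" "j' \<in> J" "e' \<in> D" unfolding J'_def by blast
      have "(\<lambda>x. a x + b x) = (\<lambda>x. (j x + j' x) + (e x + e' x) * f x)"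
        by (simp add: * algebra_simps)
      then show "(\<lambda>x. a x + b x) \<in> J'" unfolding J'_def
        using * subD Jadd by (intro CollectI exI[of _ "\<lambda>x. j x + j' x"] exI[of _ "\<lambda>x. e x + e' x"]) auto
    next
      fix d a assume "d \<in> D" "a \<in> J'"
      then obtain j e where *: "a = (\<lambda>x. j x + e x * f x)" "j \<in> J" "e \<in> D" unfolding J'_def by blast
      have "(\<lambda>x. d x * a x) = (\<lambda>x. (d x * j x) + (d x * e x) * f x)"
        by (simp add: * algebra_simps)
      then show "(\<lambda>x. d x * a x) \<in> J'" unfolding J'_def
        using * subD Jmult \<open>d \<in> D\<close>
        by (intro CollectI exI[of _ "\<lambda>x. d x * j x"] exI[of _ "\<lambda>x. d x * e x"]) auto
    qed
    moreover have "J \<subseteq> J'"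
    proof
      fix j assume "j \<in> J"
      then show "j \<in> J'" unfolding J'_def
        using fun_subalg_zero[OF D] by (intro CollectI exI[of _ j] exI[of _ "\<lambda>_. 0"]) auto
    qed
    moreover have "f \<in> J'"
    proof -
      have "f = (\<lambda>x. 0 + ?one x * f x)"
        using fun_subalg_outside[OF D fg(2)] by (auto simp: ext0_def)
      then show ?thesis unfolding J'_def
        using J0 fun_subalg_const[OF D, of 1] by (intro CollectI exI[of _ "\<lambda>_. 0"] exI[of _ ?one]) auto
    qed
    ultimately have "?one \<in> J'" using J(4)[of J'] fg(4) by auto
    then obtain j e where je: "?one = (\<lambda>x. j x + e x * f x)" "j \<in> J" "e \<in> D" unfolding J'_def by blast
    have "g = (\<lambda>x. g x * j x + e x * (f x * g x))"
    proof
      fix x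
      have "g x = g x * ?one x" using fun_subalg_outside[OF D fg(3)] by (auto simp: ext0_def)
      also have "\<dots> = g x * j x + e x * (f x * g x)" by (subst je(1)) (simp add: algebra_simps)
      finally show "g x = g x * j x + e x * (f x * g x)" .
    qed
    moreover have "\<dots> \<in> J" using Jadd Jmult je fg by blast
    ultimately show ?thesis by simp
  qed
  \<comment> \<open>Over \<complex> the polynomial \<open>P\<close> has a linear factor; by
    primeness either this factor or the cofactor takes \<open>d\<close> into
    \<open>J\<close>.\<close>
  have root: "\<exists>c. (\<lambda>x. d x - ext0 X (\<lambda>_. c) x) \<in> J"
    if d: "d \<in> D" and "P \<noteq> 0" "ext0 X (\<lambda>x. poly P (d x)) \<in> J" for d P
    using that(2,3)
  proof (induction "degree P" arbitrary: P)
    case 0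
    then obtain a where a: "P = [:a:]" "a \<noteq> 0" by (metis degree_eq_zeroE pCons_0_0)
    have "(\<lambda>x. inverse a * ext0 X (\<lambda>x. poly P (d x)) x) = ?one"
      using a by (auto simp: ext0_def)
    then have "?one \<in> J" using Jscale[OF 0(3), of "inverse a"] by simp
    then show ?case using J(3) by simp
  next
    case (Suc k)
    then have "\<not> constant (poly P)" using constant_degree[of P] by simp
    then obtain r where "poly P r = 0" using fundamental_theorem_of_algebra by blast
    then obtain P' where P': "P = [:- r, 1:] * P'" by (auto simp: poly_eq_0_iff_dvd)
    have "P' \<noteq> 0" using Suc.prems(1) unfolding P' by auto
    then have "k = degree P'" using Suc.hyps(2) unfolding P' by (subst (asm) degree_mult_eq) auto
    show ?case
    proof (cases "(\<lambda>x. d x - ext0 X (\<lambda>_. r) x) \<in> J")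
      case False
      have "(\<lambda>x. (d x - ext0 X (\<lambda>_. r) x) * ext0 X (\<lambda>x. poly P' (d x)) x) = ext0 X (\<lambda>x. poly P (d x))"
        by (auto simp: ext0_def P' algebra_simps)
      then have "ext0 X (\<lambda>x. poly P' (d x)) \<in> J"
        using Jprime[OF _ _ _ False, of "ext0 X (\<lambda>x. poly P' (d x))"] Suc.prems(2)
          fun_subalg_diff[OF D d fun_subalg_const[OF D]] fun_subalg_poly[OF D d] by simp
      then show ?thesis using Suc.hyps(1)[OF \<open>k = degree P'\<close> \<open>P' \<noteq> 0\<close>] by blast
    qed blast
  qed
  have residue: "\<exists>c. (\<lambda>x. d x - ext0 X (\<lambda>_. c) x) \<in> J" if d: "d \<in> D" for d
  proof -
    \<comment> \<open>The powers of \<open>d\<close> with exponents up to \<open>card M\<close> have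
      coefficient vectors \<open>e i\<close> over \<open>B\<close>. Under \<open>\<eta>\<close>
      these become \<open>card M + 1\<close> vectors in a space of dimension \<open>card M\<close>;
      a linear relation among them is a polynomial that takes \<open>d\<close> into
      \<open>J0\<close>.\<close>
    have "\<forall>i::nat. \<exists>e. (\<forall>b\<in>M. e b \<in> B) \<and> ext0 X (\<lambda>x. d x ^ i) = (\<lambda>x. \<Sum>b\<in>M. e b x * b x)"
      using gen fun_subalg_poly[OF D d, of "monom 1 i" for i] by (simp add: poly_monom)
    from choice[OF this] obtain e where e: "\<And>i b. b \<in> M \<Longrightarrow> e i b \<in> B"
      "\<And>i::nat. ext0 X (\<lambda>x. d x ^ i) = (\<lambda>x. \<Sum>b\<in>M. e i b x * b x)" by blast
    obtain p where p: "\<exists>i\<in>{..card M}. p i \<noteq> 0" "\<forall>b\<in>M. (\<Sum>i\<le>card M. p i * \<eta> (e i b)) = 0"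
      using linear_dependence[OF M(1), of "{..card M}" "\<lambda>i b. \<eta> (e i b)"] by auto
    define P where "P = (\<Sum>i\<le>card M. monom (p i) i)"
    have cP: "coeff P i = p i" if "i \<le> card M" for i
      using that unfolding P_def by (simp add: coeff_sum)
    then have "P \<noteq> 0" using p(1) by auto
    moreover have "ext0 X (\<lambda>x. poly P (d x)) \<in> J"
    proof -
      define c where "c = (\<lambda>b x. \<Sum>i\<le>card M. p i * e i b x)"
      have c: "c b \<in> B" "\<eta> (c b) = 0" if "b \<in> M" for b
        using e(1)[OF that] p(2) that unfolding c_def
        by (auto simp: alg_hom_sum[OF B \<eta>] alg_hom_scale[OF B \<eta>] fun_subalg_scale[OF B] intro!: fun_subalg_sum[OF B])
      have "ext0 X (\<lambda>x. poly P (d x)) = (\<lambda>x. \<Sum>b\<in>M. c b x * b x)"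
      proof
        fix x
        have "ext0 X (\<lambda>x. poly P (d x)) x = (\<Sum>i\<le>card M. p i * ext0 X (\<lambda>x. d x ^ i) x)"
          by (simp add: P_def ext0_def poly_sum poly_monom)
        also have "\<dots> = (\<Sum>i\<le>card M. \<Sum>b\<in>M. p i * e i b x * b x)"
          unfolding e(2) by (simp add: sum_distrib_left mult.assoc)
        also have "\<dots> = (\<Sum>b\<in>M. c b x * b x)"
          unfolding c_def by (subst sum.swap) (simp add: sum_distrib_right)
        finally show "ext0 X (\<lambda>x. poly P (d x)) x = (\<Sum>b\<in>M. c b x * b x)" .
      qed
      then have "ext0 X (\<lambda>x. poly P (d x)) \<in> J0" unfolding J0_def using c by blast
      then show ?thesis using J(2) by blast
    qed
    ultimately show ?thesis using root[OF d] by blast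
  qed
  have unique: "c = c'" if cc: "(\<lambda>x. d x - ext0 X (\<lambda>_. c) x) \<in> J" "(\<lambda>x. d x - ext0 X (\<lambda>_. c') x) \<in> J" for d c c'
  proof (rule ccontr)
    assume "c \<noteq> c'"
    have "(\<lambda>x. inverse (c' - c) * ((d x - ext0 X (\<lambda>_. c) x) + (-1) * (d x - ext0 X (\<lambda>_. c') x))) \<in> J"
      using Jscale[OF Jadd[OF cc(1) Jscale[OF cc(2), of "-1"]], of "inverse (c' - c)"] by simp
    moreover have "(\<lambda>x. inverse (c' - c) * ((d x - ext0 X (\<lambda>_. c) x) + (-1) * (d x - ext0 X (\<lambda>_. c') x))) = ?one"
      using \<open>c \<noteq> c'\<close> by (auto simp: ext0_def)
    ultimately show False using J(3) by simp
  qed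
  define \<eta>' where "\<eta>' = (\<lambda>d. SOME c. (\<lambda>x. d x - ext0 X (\<lambda>_. c) x) \<in> J)"
  have \<eta>': "(\<lambda>x. d x - ext0 X (\<lambda>_. \<eta>' d) x) \<in> J" if "d \<in> D" for d
    unfolding \<eta>'_def using someI_ex[OF residue[OF that]] .
  have \<eta>'_eq: "\<eta>' d = c" if "(\<lambda>x. d x - ext0 X (\<lambda>_. c) x) \<in> J" "d \<in> D" for c d
    using unique \<eta>' that by blast
  have "alg_hom X D \<eta>'"
    unfolding alg_hom_def
  proof (intro conjI allI ballI)
    fix c show "\<eta>' (ext0 X (\<lambda>_. c)) = c"
      using J0 fun_subalg_const[OF D] by (intro \<eta>'_eq) auto
  next
    fix f g assume fg: "f \<in> D" "g \<in> D"
    have "(\<lambda>x. (f x + g x) - ext0 X (\<lambda>_. \<eta>' f + \<eta>' g) x) =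
      (\<lambda>x. (f x - ext0 X (\<lambda>_. \<eta>' f) x) + (g x - ext0 X (\<lambda>_. \<eta>' g) x))"
      by (auto simp: ext0_def)
    then show "\<eta>' (\<lambda>x. f x + g x) = \<eta>' f + \<eta>' g"
      using fg subD Jadd[OF \<eta>' \<eta>'] by (intro \<eta>'_eq) auto
    have "(\<lambda>x. (f x * g x) - ext0 X (\<lambda>_. \<eta>' f * \<eta>' g) x) =
      (\<lambda>x. g x * (f x - ext0 X (\<lambda>_. \<eta>' f) x) + \<eta>' f * (g x - ext0 X (\<lambda>_. \<eta>' g) x))"
      using fun_subalg_outside[OF D fg(2)] by (auto simp: ext0_def algebra_simps)
    then show "\<eta>' (\<lambda>x. f x * g x) = \<eta>' f * \<eta>' g"
      using fg subD Jadd[OF Jmult[OF fg(2) \<eta>'] Jscale[OF \<eta>']] by (intro \<eta>'_eq) auto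
  qed
  \<comment> \<open>An element of \<open>B\<close> differs from its value under
    \<open>\<eta>\<close> by an element of the kernel, which lies in \<open>J0\<close>.\<close>
  moreover have "\<eta>' b = \<eta> b" if b: "b \<in> B" for b
  proof (rule \<eta>'_eq)
    define n where "n = (\<lambda>x. b x - ext0 X (\<lambda>_. \<eta> b) x)"
    have n: "n \<in> B" "\<eta> n = 0"
      unfolding n_def using b
      by (simp_all add: fun_subalg_diff[OF B] fun_subalg_const[OF B] alg_hom_diff[OF B \<eta>] alg_hom_const[OF B \<eta>])
    have "(\<lambda>x. n x * ?one x) = n" using fun_subalg_outside[OF B n(1)] by (auto simp: ext0_def)
    then have "n \<in> J" using J0mem[OF n fun_subalg_const[OF D, of 1]] J(2) by auto
    then show "(\<lambda>x. b x - ext0 X (\<lambda>_. \<eta> b) x) \<in> J" by (simp add: n_def)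
    show "b \<in> D" using b BD by blast
  qed
  ultimately show ?thesis by blast
qed

section \<open>Zariski topology and regular functions\<close>

definition fun_variety :: "'p affine_variety \<Rightarrow> bool" where
  "fun_variety A \<longleftrightarrow> fun_subalg (pts A) (fns A)"

lemma fun_variety_closed_subvariety: "fun_variety (closed_subvariety V X)"
  by (simp add: fun_variety_def closed_subvariety_def fun_subalg_fun_alg)

lemma fun_variety_prod_variety: "fun_variety (prod_variety A B)"
  by (simp add: fun_variety_def prod_variety_def fun_subalg_fun_alg)

lemma closed_subvariety_simps [simp]:
  "pts (closed_subvariety V X) = X" "fns (closed_subvariety V X) = fun_alg X (dual V)"
  by (simp_all add: closed_subvariety_def)

text \<open>Products of functions make the nonvanishing sets closed under intersection, so the
  generating family is already a base.\<close>

lemma openin_zariski: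
  assumes A: "fun_variety A"
  shows "openin (zariski A) U \<longleftrightarrow>
    U \<subseteq> pts A \<and> (\<forall>x\<in>U. \<exists>f\<in>fns A. f x \<noteq> 0 \<and> (\<forall>y\<in>pts A. f y \<noteq> 0 \<longrightarrow> y \<in> U))" (is "_ \<longleftrightarrow> ?R U")
proof
  have sub: "fun_subalg (pts A) (fns A)" using A by (simp add: fun_variety_def)
  define S where "S = {{x \<in> pts A. f x \<noteq> 0} | f. f \<in> fns A}"
  have eq: "openin (zariski A) = generate_topology_on S"
    unfolding zariski_def S_def by (rule ext, rule openin_topology_generated_by_iff)
  show "?R U" if "openin (zariski A) U"
    using that unfolding eq
  proof (induction rule: generate_topology_on.induct)
    case (Int a b)
    show ?case
    proof (intro conjI ballI)
      fix x assume x: "x \<in> a \<inter> b"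
      obtain f where f: "f \<in> fns A" "f x \<noteq> 0" "\<forall>y\<in>pts A. f y \<noteq> 0 \<longrightarrow> y \<in> a" using Int.IH(1) x by blast
      obtain g where g: "g \<in> fns A" "g x \<noteq> 0" "\<forall>y\<in>pts A. g y \<noteq> 0 \<longrightarrow> y \<in> b" using Int.IH(2) x by blast
      from f g show "\<exists>f\<in>fns A. f x \<noteq> 0 \<and> (\<forall>y\<in>pts A. f y \<noteq> 0 \<longrightarrow> y \<in> a \<inter> b)"
        using fun_subalg_mult[OF sub f(1) g(1)] by (intro bexI[of _ "\<lambda>x. f x * g x"]) auto
    qed (use Int in auto)
  next
    case (UN K)
    show ?case
    proof (intro conjI ballI)
      show "\<Union>K \<subseteq> pts A" using UN.IH by blast
      fix x assume "x \<in> \<Union>K"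
      then obtain k where k: "k \<in> K" "x \<in> k" by blast
      then obtain f where "f \<in> fns A" "f x \<noteq> 0" "\<forall>y\<in>pts A. f y \<noteq> 0 \<longrightarrow> y \<in> k" using UN.IH[OF k(1)] by blast
      then show "\<exists>f\<in>fns A. f x \<noteq> 0 \<and> (\<forall>y\<in>pts A. f y \<noteq> 0 \<longrightarrow> y \<in> \<Union>K)" using k(1) by blast
    qed
  next
    case (Basis s)
    then show ?case unfolding S_def by blast
  qed auto
  show "openin (zariski A) U" if U: "?R U"
  proof -
    have "U = \<Union>{s \<in> S. s \<subseteq> U}"
    proof (intro equalityI subsetI)
      fix x assume x: "x \<in> U"
      then obtain f where f: "f \<in> fns A" "f x \<noteq> 0" "\<forall>y\<in>pts A. f y \<noteq> 0 \<longrightarrow> y \<in> U" using U by blast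
      then have "{x \<in> pts A. f x \<noteq> 0} \<in> {s \<in> S. s \<subseteq> U}" unfolding S_def by blast
      then show "x \<in> \<Union>{s \<in> S. s \<subseteq> U}" using f x U by blast
    qed auto
    moreover have "generate_topology_on S (\<Union>{s \<in> S. s \<subseteq> U})"
      by (intro generate_topology_on.UN) (auto intro: generate_topology_on.Basis)
    ultimately show ?thesis unfolding eq by simp
  qed
qed

lemma topspace_zariski:
  assumes "fun_variety A" shows "topspace (zariski A) = pts A"
proof -
  have "ext0 (pts A) (\<lambda>_. 1) \<in> fns A"
    using assms fun_subalg_const unfolding fun_variety_def by blast
  then have "openin (zariski A) (pts A)"
    unfolding openin_zariski[OF assms] by (auto intro!: bexI[of _ "ext0 (pts A) (\<lambda>_. 1)"])
  then show ?thesis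
    unfolding topspace_def using openin_zariski[OF assms] by blast
qed

lemma zariski_closure_of:
  assumes A: "fun_variety A" and S: "S \<subseteq> pts A"
  shows "zariski A closure_of S = {y \<in> pts A. \<forall>f\<in>fns A. (\<forall>x\<in>S. f x = 0) \<longrightarrow> f y = 0}"
proof (intro equalityI subsetI)
  fix y assume y: "y \<in> zariski A closure_of S"
  then have yp: "y \<in> pts A" using topspace_zariski[OF A] by (simp add: in_closure_of)
  moreover have "f y = 0" if f: "f \<in> fns A" "\<forall>x\<in>S. f x = 0" for f
  proof (rule ccontr)
    assume "f y \<noteq> 0"
    have "openin (zariski A) {x \<in> pts A. f x \<noteq> 0}"
      unfolding openin_zariski[OF A] using f(1) by auto
    moreover have "y \<in> {x \<in> pts A. f x \<noteq> 0}" using yp \<open>f y \<noteq> 0\<close> by simp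
    ultimately obtain x where "x \<in> S" "x \<in> {x \<in> pts A. f x \<noteq> 0}"
      using y unfolding in_closure_of by meson
    then show False using f(2) by simp
  qed
  ultimately show "y \<in> {y \<in> pts A. \<forall>f\<in>fns A. (\<forall>x\<in>S. f x = 0) \<longrightarrow> f y = 0}" by blast
next
  fix y assume y: "y \<in> {y \<in> pts A. \<forall>f\<in>fns A. (\<forall>x\<in>S. f x = 0) \<longrightarrow> f y = 0}"
  show "y \<in> zariski A closure_of S"
    unfolding in_closure_of
  proof (intro conjI allI impI)
    show "y \<in> topspace (zariski A)" using y topspace_zariski[OF A] by simp
    fix T assume "y \<in> T \<and> openin (zariski A) T"
    then obtain f where "f \<in> fns A" "f y \<noteq> 0" "\<forall>x\<in>pts A. f x \<noteq> 0 \<longrightarrow> x \<in> T"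
      using openin_zariski[OF A] by blast
    then show "\<exists>x. x \<in> S \<and> x \<in> T" using y S by blast
  qed
qed

lemma openin_zariski_nonvanishing:
  assumes A: "fun_variety A" and f: "f \<in> fns A"
  shows "openin (zariski A) {x \<in> pts A. f x \<noteq> 0}"
  unfolding openin_zariski[OF A] using f by auto

lemma closedin_zariski_separate:
  assumes A: "fun_variety A" and T: "closedin (subtopology (zariski A) F) T"
    and x: "x \<in> pts A" "x \<in> F" "x \<notin> T"
  obtains f where "f \<in> fns A" "f x \<noteq> 0" "\<forall>y\<in>T. f y = 0"
proof -
  obtain C where C: "closedin (zariski A) C" "T = C \<inter> F"
    using T unfolding closedin_subtopology by blast
  then have "openin (zariski A) (pts A - C)" using topspace_zariski[OF A] by (metis closedin_def)
  moreover have "x \<in> pts A - C" using C x by blast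
  ultimately obtain f where f: "f \<in> fns A" "f x \<noteq> 0" "\<forall>y\<in>pts A. f y \<noteq> 0 \<longrightarrow> y \<in> pts A - C"
    using openin_zariski[OF A] by blast
  moreover have "C \<subseteq> pts A" using C(1) closedin_subset topspace_zariski[OF A] by blast
  ultimately show ?thesis using C(2) by (intro that[of f]) auto
qed

text \<open>The neighbourhood in the definition can be shrunk to the nonvanishing set of some
  \<open>k\<close>. Multiplying numerator and denominator by \<open>k\<close> lets the denominator
  itself cut out the neighbourhood, so that no open sets remain in the criterion.\<close>

lemma regular_on_iff:
  assumes A: "fun_variety A" and U: "U \<subseteq> pts A"
  shows "regular_on A U f \<longleftrightarrow>
    (\<forall>x\<in>U. \<exists>g\<in>fns A. \<exists>h\<in>fns A. h x \<noteq> 0 \<and> (\<forall>y\<in>U. h y \<noteq> 0 \<longrightarrow> f y = g y / h y))" (is "_ \<longleftrightarrow> ?R")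
proof
  have sub: "fun_subalg (pts A) (fns A)" using A by (simp add: fun_variety_def)
  assume reg: "regular_on A U f"
  show ?R
  proof
    fix x assume x: "x \<in> U"
    then obtain W g h where W: "openin (subtopology (zariski A) U) W" "x \<in> W" "g \<in> fns A" "h \<in> fns A"
      "\<forall>y\<in>W. h y \<noteq> 0 \<and> f y = g y / h y"
      using reg unfolding regular_on_def by blast
    obtain V where V: "openin (zariski A) V" "W = V \<inter> U"
      using W(1) unfolding openin_subtopology by blast
    obtain k where k: "k \<in> fns A" "k x \<noteq> 0" "\<forall>y\<in>pts A. k y \<noteq> 0 \<longrightarrow> y \<in> V"
      using V W(2) openin_zariski[OF A] by blast
    show "\<exists>g\<in>fns A. \<exists>h\<in>fns A. h x \<noteq> 0 \<and> (\<forall>y\<in>U. h y \<noteq> 0 \<longrightarrow> f y = g y / h y)"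
    proof (rule bexI[of _ "\<lambda>x. g x * k x"], rule bexI[of _ "\<lambda>x. h x * k x"], intro conjI ballI impI)
      show "(\<lambda>x. g x * k x) \<in> fns A" "(\<lambda>x. h x * k x) \<in> fns A"
        using fun_subalg_mult[OF sub] W k by auto
      show "h x * k x \<noteq> 0" using W k by auto
      fix y assume "y \<in> U" "h y * k y \<noteq> 0"
      then show "f y = g y * k y / (h y * k y)" using W(5) V k U by auto
    qed
  qed
next
  assume R: ?R
  show "regular_on A U f"
    unfolding regular_on_def
  proof
    fix x assume x: "x \<in> U"
    then obtain g h where gh: "g \<in> fns A" "h \<in> fns A" "h x \<noteq> 0" "\<forall>y\<in>U. h y \<noteq> 0 \<longrightarrow> f y = g y / h y"
      using R by blast
    have "openin (subtopology (zariski A) U) ({y \<in> pts A. h y \<noteq> 0} \<inter> U)"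
      using openin_zariski_nonvanishing[OF A gh(2)] by (auto simp: openin_subtopology)
    then show "\<exists>W. openin (subtopology (zariski A) U) W \<and> x \<in> W \<and>
        (\<exists>g\<in>fns A. \<exists>h\<in>fns A. \<forall>y\<in>W. h y \<noteq> 0 \<and> f y = g y / h y)"
      using gh x U by (intro exI[of _ "{y \<in> pts A. h y \<noteq> 0} \<inter> U"]) blast
  qed
qed

context
  fixes A :: "'p affine_variety" and U
  assumes A: "fun_variety A" and U: "U \<subseteq> pts A"
begin

lemma regular_onI:
  assumes "\<And>x. x \<in> U \<Longrightarrow> \<exists>g\<in>fns A. \<exists>h\<in>fns A. h x \<noteq> 0 \<and> (\<forall>y\<in>U. h y \<noteq> 0 \<longrightarrow> f y = g y / h y)"
  shows "regular_on A U f"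
  using assms regular_on_iff[OF A U] by blast

lemma regular_onE:
  assumes "regular_on A U f" "x \<in> U"
  obtains g h where "g \<in> fns A" "h \<in> fns A" "h x \<noteq> 0" "\<And>y. y \<in> U \<Longrightarrow> h y \<noteq> 0 \<Longrightarrow> f y = g y / h y"
  using assms regular_on_iff[OF A U] by blast

lemma regular_on_cong:
  assumes "\<And>x. x \<in> U \<Longrightarrow> f x = g x" "regular_on A U f"
  shows "regular_on A U g"
  using assms unfolding regular_on_iff[OF A U] by simp

lemma regular_on_fns:
  assumes "f \<in> fns A" shows "regular_on A U f"
proof (rule regular_onI)
  fix x assume "x \<in> U"
  then show "\<exists>g\<in>fns A. \<exists>h\<in>fns A. h x \<noteq> 0 \<and> (\<forall>y\<in>U. h y \<noteq> 0 \<longrightarrow> f y = g y / h y)"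
    using assms U A fun_subalg_const[of "pts A" "fns A" 1] unfolding fun_variety_def
    by (intro bexI[of _ f] bexI[of _ "ext0 (pts A) (\<lambda>_. 1)"]) auto
qed

lemma regular_on_const: "regular_on A U (\<lambda>_. c)"
proof (rule regular_on_cong)
  show "regular_on A U (ext0 (pts A) (\<lambda>_. c))"
    using A fun_subalg_const unfolding fun_variety_def by (intro regular_on_fns) blast
qed (use U in auto)

text \<open>Sums and products share the common denominator \<open>h * h'\<close>; the operation
  \<open>c\<close> covers both.\<close>

lemma regular_on_binary:
  assumes f: "regular_on A U f" and f': "regular_on A U f'"
    and comb: "\<And>g h g' h'. \<lbrakk>g \<in> fns A; h \<in> fns A; g' \<in> fns A; h' \<in> fns A\<rbrakk> \<Longrightarrow>
      \<exists>k\<in>fns A. \<forall>y. h y \<noteq> 0 \<longrightarrow> h' y \<noteq> 0 \<longrightarrow> c (g y / h y) (g' y / h' y) = k y / (h y * h' y)"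
  shows "regular_on A U (\<lambda>x. c (f x) (f' x))"
proof (rule regular_onI)
  fix x assume x: "x \<in> U"
  obtain g h where g: "g \<in> fns A" "h \<in> fns A" "h x \<noteq> 0" "\<And>y. y \<in> U \<Longrightarrow> h y \<noteq> 0 \<Longrightarrow> f y = g y / h y"
    using regular_onE[OF f x] by blast
  obtain g' h' where g': "g' \<in> fns A" "h' \<in> fns A" "h' x \<noteq> 0" "\<And>y. y \<in> U \<Longrightarrow> h' y \<noteq> 0 \<Longrightarrow> f' y = g' y / h' y"
    using regular_onE[OF f' x] by blast
  obtain k where k: "k \<in> fns A"
    "\<And>y. h y \<noteq> 0 \<Longrightarrow> h' y \<noteq> 0 \<Longrightarrow> c (g y / h y) (g' y / h' y) = k y / (h y * h' y)"
    using comb[OF g(1,2) g'(1,2)] by blast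
  have "(\<lambda>x. h x * h' x) \<in> fns A"
    using A g g' fun_subalg_mult unfolding fun_variety_def by blast
  then show "\<exists>g\<in>fns A. \<exists>h\<in>fns A. h x \<noteq> 0 \<and> (\<forall>y\<in>U. h y \<noteq> 0 \<longrightarrow> c (f y) (f' y) = g y / h y)"
    using k g g' by (intro bexI[of _ k] bexI[of _ "\<lambda>x. h x * h' x"]) auto
qed

lemma regular_on_add:
  assumes "regular_on A U f" "regular_on A U f'"
  shows "regular_on A U (\<lambda>x. f x + f' x)"
proof (rule regular_on_binary[OF assms])
  fix g h g' h' assume *: "g \<in> fns A" "h \<in> fns A" "g' \<in> fns A" "h' \<in> fns A"
  have "(\<lambda>x. g x * h' x + g' x * h x) \<in> fns A"
    using A * fun_subalg_mult fun_subalg_add unfolding fun_variety_def by blast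
  then show "\<exists>k\<in>fns A. \<forall>y. h y \<noteq> 0 \<longrightarrow> h' y \<noteq> 0 \<longrightarrow> g y / h y + g' y / h' y = k y / (h y * h' y)"
    by (intro bexI[of _ "\<lambda>x. g x * h' x + g' x * h x"]) (auto simp: field_simps)
qed

lemma regular_on_mult:
  assumes "regular_on A U f" "regular_on A U f'"
  shows "regular_on A U (\<lambda>x. f x * f' x)"
proof (rule regular_on_binary[OF assms])
  fix g h g' h' assume *: "g \<in> fns A" "h \<in> fns A" "g' \<in> fns A" "h' \<in> fns A"
  have "(\<lambda>x. g x * g' x) \<in> fns A"
    using A * fun_subalg_mult unfolding fun_variety_def by blast
  then show "\<exists>k\<in>fns A. \<forall>y. h y \<noteq> 0 \<longrightarrow> h' y \<noteq> 0 \<longrightarrow> g y / h y * (g' y / h' y) = k y / (h y * h' y)"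
    by (intro bexI[of _ "\<lambda>x. g x * g' x"]) auto
qed

end

text \<open>Pull-backs of the coordinate ring control everything. Where \<open>b\<close> pulls back
  to \<open>g / h\<close>, the set on which \<open>g * h\<close> is nonzero is mapped into the
  nonvanishing set of \<open>b\<close>, which gives continuity; quotients of functions pull back to
  quotients of their pull-backs.\<close>

lemma morphism_onI:
  assumes A: "fun_variety A" and B: "fun_variety B" and U: "U \<subseteq> pts A" and W: "W \<subseteq> pts B"
    and maps: "\<And>x. x \<in> U \<Longrightarrow> \<phi> x \<in> W"
    and reg: "\<And>b. b \<in> fns B \<Longrightarrow> regular_on A U (\<lambda>x. b (\<phi> x))"
  shows "morphism_on A U B W \<phi>"
  unfolding morphism_on_def
proof (intro conjI allI impI)
  have subA: "fun_subalg (pts A) (fns A)" using A by (simp add: fun_variety_def)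
  have topU: "topspace (subtopology (zariski A) U) = U"
    using topspace_zariski[OF A] U by auto
  have topW: "topspace (subtopology (zariski B) W) = W"
    using topspace_zariski[OF B] W by auto
  show "continuous_map (subtopology (zariski A) U) (subtopology (zariski B) W) \<phi>"
    unfolding continuous_map_def topU topW
  proof (intro conjI allI impI)
    show "\<phi> \<in> U \<rightarrow> W" using maps by auto
    fix V assume "openin (subtopology (zariski B) W) V"
    then obtain V' where V': "openin (zariski B) V'" "V = V' \<inter> W" unfolding openin_subtopology by blast
    define T where "T = \<Union>{T'. openin (zariski A) T' \<and> T' \<inter> U \<subseteq> {x \<in> U. \<phi> x \<in> V}}"
    have "openin (zariski A) T" unfolding T_def by (intro openin_Union) blast
    moreover have "{x \<in> U. \<phi> x \<in> V} = T \<inter> U"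
    proof (intro equalityI subsetI)
      fix x assume "x \<in> {x \<in> U. \<phi> x \<in> V}"
      then have x: "x \<in> U" "\<phi> x \<in> V'" using V' by auto
      obtain b where b: "b \<in> fns B" "b (\<phi> x) \<noteq> 0" "\<forall>y\<in>pts B. b y \<noteq> 0 \<longrightarrow> y \<in> V'"
        using V'(1) x(2) openin_zariski[OF B] by blast
      obtain g h where g: "g \<in> fns A" "h \<in> fns A" "h x \<noteq> 0" "\<And>y. y \<in> U \<Longrightarrow> h y \<noteq> 0 \<Longrightarrow> b (\<phi> y) = g y / h y"
        using regular_onE[OF A U reg[OF b(1)] x(1)] by blast
      have "openin (zariski A) {y \<in> pts A. g y * h y \<noteq> 0}"
        using openin_zariski_nonvanishing[OF A fun_subalg_mult[OF subA g(1,2)]] .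
      moreover have "{y \<in> pts A. g y * h y \<noteq> 0} \<inter> U \<subseteq> {x \<in> U. \<phi> x \<in> V}"
        using g(4) b(3) maps V' W by fastforce
      moreover have "x \<in> {y \<in> pts A. g y * h y \<noteq> 0}" using g(3) g(4)[OF x(1)] b(2) x U by auto
      ultimately show "x \<in> T \<inter> U" unfolding T_def using x by blast
    qed (auto simp: T_def)
    ultimately show "openin (subtopology (zariski A) U) {x \<in> U. \<phi> x \<in> V}"
      unfolding openin_subtopology by blast
  qed
  fix V f assume V: "openin (subtopology (zariski B) W) V \<and> regular_on B V f"
  then have "V \<subseteq> topspace (subtopology (zariski B) W)" by (intro openin_subset) blast
  then have VB: "V \<subseteq> pts B" "V \<subseteq> W" using W unfolding topW by auto
  let ?U = "{x \<in> U. \<phi> x \<in> V}"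
  have UA: "?U \<subseteq> pts A" using U by auto
  show "regular_on A ?U (\<lambda>x. f (\<phi> x))"
  proof (rule regular_onI[OF A UA])
    fix x assume "x \<in> ?U"
    then have x: "x \<in> U" "\<phi> x \<in> V" by auto
    obtain g h where g: "g \<in> fns B" "h \<in> fns B" "h (\<phi> x) \<noteq> 0" "\<And>y. y \<in> V \<Longrightarrow> h y \<noteq> 0 \<Longrightarrow> f y = g y / h y"
      using regular_onE[OF B VB(1) _ x(2)] V by blast
    obtain g1 g2 where g1: "g1 \<in> fns A" "g2 \<in> fns A" "g2 x \<noteq> 0" "\<And>y. y \<in> U \<Longrightarrow> g2 y \<noteq> 0 \<Longrightarrow> g (\<phi> y) = g1 y / g2 y"
      using regular_onE[OF A U reg[OF g(1)] x(1)] by blast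
    obtain h1 h2 where h1: "h1 \<in> fns A" "h2 \<in> fns A" "h2 x \<noteq> 0" "\<And>y. y \<in> U \<Longrightarrow> h2 y \<noteq> 0 \<Longrightarrow> h (\<phi> y) = h1 y / h2 y"
      using regular_onE[OF A U reg[OF g(2)] x(1)] by blast
    have "h1 x \<noteq> 0" using h1(3) h1(4)[OF x(1)] g(3) by auto
    show "\<exists>g\<in>fns A. \<exists>h\<in>fns A. h x \<noteq> 0 \<and> (\<forall>y\<in>?U. h y \<noteq> 0 \<longrightarrow> f (\<phi> y) = g y / h y)"
    proof (rule bexI[of _ "\<lambda>x. (g1 x * h2 x) * h2 x"], rule bexI[of _ "\<lambda>x. (g2 x * h1 x) * h2 x"],
        intro conjI ballI impI)
      show "(\<lambda>x. (g1 x * h2 x) * h2 x) \<in> fns A" "(\<lambda>x. (g2 x * h1 x) * h2 x) \<in> fns A"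
        using g1 h1 fun_subalg_mult[OF subA] by auto
      show "g2 x * h1 x * h2 x \<noteq> 0" using g1 h1 \<open>h1 x \<noteq> 0\<close> by auto
      fix y assume y: "y \<in> ?U" "g2 y * h1 y * h2 y \<noteq> 0"
      then have "f (\<phi> y) = g (\<phi> y) / h (\<phi> y)" using g(4)[of "\<phi> y"] h1(4)[of y] by auto
      then show "f (\<phi> y) = (g1 y * h2 y) * h2 y / (g2 y * h1 y * h2 y)"
        using y g1(4)[of y] h1(4)[of y] by simp
    qed
  qed
qed

lemma morphism_on_maps:
  assumes A: "fun_variety A" and B: "fun_variety B" and "U \<subseteq> pts A" "W \<subseteq> pts B"
    and "morphism_on A U B W \<phi>" "x \<in> U"
  shows "\<phi> x \<in> W"
proof -
  have "\<phi> \<in> topspace (subtopology (zariski A) U) \<rightarrow> topspace (subtopology (zariski B) W)"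
    using assms(5) unfolding morphism_on_def continuous_map_def by blast
  then show ?thesis using assms(3,4,6) topspace_zariski[OF A] topspace_zariski[OF B] by auto
qed

lemma morphism_on_regular:
  assumes A: "fun_variety A" and B: "fun_variety B" and "U \<subseteq> pts A" "W \<subseteq> pts B"
    and m: "morphism_on A U B W \<phi>" and b: "b \<in> fns B"
  shows "regular_on A U (\<lambda>x. b (\<phi> x))"
proof -
  have "openin (subtopology (zariski B) W) W"
    using topspace_zariski[OF B] assms(4) by (metis inf.absorb_iff2 openin_topspace topspace_subtopology)
  moreover have "regular_on B W b" using regular_on_fns[OF B assms(4) b] .
  ultimately have "regular_on A {x \<in> U. \<phi> x \<in> W} (\<lambda>x. b (\<phi> x))"
    using m unfolding morphism_on_def by blast
  moreover have "{x \<in> U. \<phi> x \<in> W} = U" using morphism_on_maps[OF assms(1-5)] by auto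
  ultimately show ?thesis by simp
qed

text \<open>Near \<open>y\<close> the function is \<open>g / h\<close>; the product
  \<open>g * h\<close> belongs to the coordinate ring and vanishes on all of \<open>S\<close>, also
  at the zeros of \<open>h\<close>.\<close>

lemma regular_on_vanish_closure:
  assumes A: "fun_variety A" and S: "S \<subseteq> pts A" and f: "regular_on A (pts A) f"
    and 0: "\<And>x. x \<in> S \<Longrightarrow> f x = 0" and y: "y \<in> zariski A closure_of S"
  shows "f y = 0"
proof -
  have sub: "fun_subalg (pts A) (fns A)" using A by (simp add: fun_variety_def)
  have yp: "y \<in> pts A" and yv: "\<And>f. f \<in> fns A \<Longrightarrow> (\<forall>x\<in>S. f x = 0) \<Longrightarrow> f y = 0"
    using y unfolding zariski_closure_of[OF A S] by auto
  obtain g h where g: "g \<in> fns A" "h \<in> fns A" "h y \<noteq> 0" "\<And>x. x \<in> pts A \<Longrightarrow> h x \<noteq> 0 \<Longrightarrow> f x = g x / h x"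
    using regular_onE[OF A order_refl f yp] by blast
  have "g x * h x = 0" if "x \<in> S" for x using g(4)[of x] 0[OF that] S that by auto
  then have "g y * h y = 0" using yv[OF fun_subalg_mult[OF sub g(1,2)]] by auto
  then show ?thesis using g(3) g(4)[OF yp] by auto
qed

section \<open>Finite morphisms are universally closed\<close>

text \<open>The construction behind \<open>git_quotient\<close> for an arbitrary algebra of
  functions, so that the closedness arguments do not involve a group.\<close>

definition spec_variety :: "'a set \<Rightarrow> ('a \<Rightarrow> complex) set \<Rightarrow> (('a \<Rightarrow> complex) \<Rightarrow> complex) affine_variety" where
  "spec_variety X I = \<lparr>pts = max_spec X I, fns = (\<lambda>a. ext0 (max_spec X I) (\<lambda>\<xi>. \<xi> a)) ` I\<rparr>"

lemma spec_variety_simps [simp]: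
  "pts (spec_variety X I) = max_spec X I"
  "fns (spec_variety X I) = (\<lambda>a. ext0 (max_spec X I) (\<lambda>\<xi>. \<xi> a)) ` I"
  by (simp_all add: spec_variety_def)

lemma git_quotient_spec_variety:
  "git_quotient A \<Gamma> \<sigma> = spec_variety (pts A) (invariants A \<Gamma> \<sigma>)"
  by (simp add: git_quotient_def spec_variety_def Let_def)

lemma fun_variety_spec_variety:
  assumes I: "fun_subalg X I" shows "fun_variety (spec_variety X I)"
  unfolding fun_variety_def fun_subalg_def
proof (intro conjI ballI allI impI)
  let ?P = "max_spec X I"
  have hom: "alg_hom X I \<xi>" if "\<xi> \<in> ?P" for \<xi> using that by (simp add: max_spec_iff)
  fix c
  have "ext0 ?P (\<lambda>_. c) = ext0 ?P (\<lambda>\<xi>. \<xi> (ext0 X (\<lambda>_. c)))"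
  proof
    fix \<xi> show "ext0 ?P (\<lambda>_. c) \<xi> = ext0 ?P (\<lambda>\<xi>. \<xi> (ext0 X (\<lambda>_. c))) \<xi>"
      using alg_hom_const[OF I hom[of \<xi>]] by (cases "\<xi> \<in> ?P") auto
  qed
  then show "ext0 (pts (spec_variety X I)) (\<lambda>_. c) \<in> fns (spec_variety X I)"
    using fun_subalg_const[OF I] by auto
next
  let ?P = "max_spec X I"
  have hom: "alg_hom X I \<xi>" if "\<xi> \<in> ?P" for \<xi> using that by (simp add: max_spec_iff)
  fix f g assume "f \<in> fns (spec_variety X I)" "g \<in> fns (spec_variety X I)"
  then obtain a b where ab: "a \<in> I" "b \<in> I" "f = ext0 ?P (\<lambda>\<xi>. \<xi> a)" "g = ext0 ?P (\<lambda>\<xi>. \<xi> b)" by auto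
  have "(\<lambda>x. f x + g x) = ext0 ?P (\<lambda>\<xi>. \<xi> (\<lambda>x. a x + b x))"
    using alg_hom_add[OF I hom] ab by (auto simp: ext0_def)
  then show "(\<lambda>x. f x + g x) \<in> fns (spec_variety X I)"
    using fun_subalg_add[OF I ab(1,2)] by auto
  have "(\<lambda>x. f x * g x) = ext0 ?P (\<lambda>\<xi>. \<xi> (\<lambda>x. a x * b x))"
    using alg_hom_mult[OF I hom] ab by (auto simp: ext0_def)
  then show "(\<lambda>x. f x * g x) \<in> fns (spec_variety X I)"
    using fun_subalg_mult[OF I ab(1,2)] by auto
qed auto

text \<open>The pull-backs of \<open>M\<close> to \<open>T\<close> span a module \<open>D\<close>
  over \<open>B'\<close>. It is an algebra, because a product of two generators is again a function
  on \<open>A\<close> and so a combination of generators with coefficients from \<open>B\<close>.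
  Thus \<open>D\<close> is finite over \<open>B'\<close>, \<open>\<eta>\<close> extends to it by
  \<open>lying_over\<close>, and composing the extension with the pull-back gives a character of
  \<open>I\<close>, that is, a point of \<open>A\<close>.\<close>

lemma finite_lift:
  assumes I: "fun_subalg X I" and A: "A = spec_variety X I"
    and M: "finite M" "M \<subseteq> fns A"
    and gen: "\<forall>a\<in>fns A. \<exists>c. (\<forall>b\<in>M. c b \<in> fns B) \<and> (\<forall>x\<in>pts A. a x = (\<Sum>b\<in>M. c b (\<phi> x) * b x))"
    and p': "\<forall>t\<in>T. p t \<in> pts A"
    and B': "fun_subalg T B'" and pull: "\<forall>b\<in>fns B. ext0 T (\<lambda>t. b (\<phi> (p t))) \<in> B'"
    and \<eta>: "alg_hom T B' \<eta>"
  shows "\<exists>D \<eta>' \<xi>. fun_subalg T D \<and> B' \<subseteq> D \<and> (\<forall>a\<in>fns A. ext0 T (\<lambda>t. a (p t)) \<in> D) \<and>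
    alg_hom T D \<eta>' \<and> (\<forall>b\<in>B'. \<eta>' b = \<eta> b) \<and> \<xi> \<in> pts A \<and>
    (\<forall>a\<in>fns A. a \<xi> = \<eta>' (ext0 T (\<lambda>t. a (p t))))"
proof -
  have subA: "fun_subalg (pts A) (fns A)"
    using fun_variety_spec_variety[OF I] by (simp add: A fun_variety_def)
  have p: "p t \<in> pts A" if "t \<in> T" for t using p' that by blast
  let ?pb = "\<lambda>a. ext0 T (\<lambda>t. a (p t))"
  define D where "D = {(\<lambda>t. \<Sum>b\<in>M. c b t * ?pb b t) | c. \<forall>b\<in>M. c b \<in> B'}"
  have pbD: "?pb a \<in> D" if a: "a \<in> fns A" for a
  proof -
    obtain c where c: "\<forall>b\<in>M. c b \<in> fns B" "\<forall>x\<in>pts A. a x = (\<Sum>b\<in>M. c b (\<phi> x) * b x)"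
      using gen a by blast
    have "?pb a = (\<lambda>t. \<Sum>b\<in>M. ext0 T (\<lambda>t. c b (\<phi> (p t))) t * ?pb b t)"
      using c(2) p by (auto simp: ext0_def)
    then show ?thesis unfolding D_def using c pull by (intro CollectI exI[of _ "\<lambda>b. ext0 T (\<lambda>t. c b (\<phi> (p t)))"]) auto
  qed
  have Dadd: "(\<lambda>t. f t + g t) \<in> D" if "f \<in> D" "g \<in> D" for f g
  proof -
    from that(1) obtain c where c: "\<forall>b\<in>M. c b \<in> B'" "f = (\<lambda>t. \<Sum>b\<in>M. c b t * ?pb b t)"
      unfolding D_def by blast
    from that(2) obtain c' where c': "\<forall>b\<in>M. c' b \<in> B'" "g = (\<lambda>t. \<Sum>b\<in>M. c' b t * ?pb b t)"
      unfolding D_def by blast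
    note * = c c'
    have "(\<lambda>t. f t + g t) = (\<lambda>t. \<Sum>b\<in>M. (c b t + c' b t) * ?pb b t)"
      by (simp add: * sum.distrib distrib_right)
    then show ?thesis unfolding D_def
      using * fun_subalg_add[OF B'] by (intro CollectI exI[of _ "\<lambda>b t. c b t + c' b t"]) auto
  qed
  have DB: "(\<lambda>t. f t * g t) \<in> D" if "f \<in> B'" "g \<in> D" for f g
  proof -
    obtain c where *: "\<forall>b\<in>M. c b \<in> B'" "g = (\<lambda>t. \<Sum>b\<in>M. c b t * ?pb b t)" using \<open>g \<in> D\<close> unfolding D_def by blast
    have "(\<lambda>t. f t * g t) = (\<lambda>t. \<Sum>b\<in>M. (f t * c b t) * ?pb b t)"
      by (simp add: * sum_distrib_left mult.assoc)
    then show ?thesis unfolding D_def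
      using * \<open>f \<in> B'\<close> fun_subalg_mult[OF B'] by (intro CollectI exI[of _ "\<lambda>b t. f t * c b t"]) auto
  qed
  have D0: "(\<lambda>_. 0) \<in> D" unfolding D_def using fun_subalg_zero[OF B'] by (intro CollectI exI[of _ "\<lambda>_ _. 0"]) auto
  have Dsum: "(\<lambda>t. \<Sum>b\<in>S. f b t) \<in> D" if "\<And>b. b \<in> S \<Longrightarrow> f b \<in> D" for f and S :: "((('a \<Rightarrow> complex) \<Rightarrow> complex) \<Rightarrow> complex) set"
    using that by (induction S rule: infinite_finite_induct) (auto intro: D0 Dadd)
  have B'D: "B' \<subseteq> D"
  proof
    fix b assume b: "b \<in> B'"
    have "(\<lambda>t. b t * ?pb (ext0 (pts A) (\<lambda>_. 1)) t) = b"
      using fun_subalg_outside[OF B' b] p by (auto simp: ext0_def)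
    then show "b \<in> D" using DB[OF b pbD[OF fun_subalg_const[OF subA, of 1]]] by simp
  qed
  have D: "fun_subalg T D"
    unfolding fun_subalg_def
  proof (intro conjI ballI allI impI)
    fix c show "ext0 T (\<lambda>_. c) \<in> D" using B'D fun_subalg_const[OF B'] by blast
  next
    fix f g assume fg: "f \<in> D" "g \<in> D"
    then show "(\<lambda>x. f x + g x) \<in> D" using Dadd by blast
    from fg(1) obtain c where c: "\<forall>b\<in>M. c b \<in> B'" "f = (\<lambda>t. \<Sum>b\<in>M. c b t * ?pb b t)"
      unfolding D_def by blast
    from fg(2) obtain c' where c': "\<forall>b\<in>M. c' b \<in> B'" "g = (\<lambda>t. \<Sum>b\<in>M. c' b t * ?pb b t)"
      unfolding D_def by blast
    note * = c c'
    have "(\<lambda>t. f t * g t) = (\<lambda>t. \<Sum>b\<in>M. \<Sum>b'\<in>M. (c b t * c' b' t) * ?pb (\<lambda>x. b x * b' x) t)"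
      by (auto simp: * sum_product ext0_def intro!: ext sum.cong)
    moreover have "\<dots> \<in> D"
      by (intro Dsum DB pbD fun_subalg_mult[OF B'] fun_subalg_mult[OF subA]) (use * M(2) in auto)
    ultimately show "(\<lambda>x. f x * g x) \<in> D" by simp
  next
    fix f x assume "f \<in> D" "x \<notin> T"
    then show "f x = 0" unfolding D_def by auto
  qed
  have "\<forall>d\<in>D. \<exists>c. (\<forall>b\<in>?pb ` M. c b \<in> B') \<and> d = (\<lambda>x. \<Sum>b\<in>?pb ` M. c b x * b x)"
  proof
    fix d assume "d \<in> D"
    then obtain c where c: "\<forall>b\<in>M. c b \<in> B'" "d = (\<lambda>t. \<Sum>b\<in>M. c b t * ?pb b t)" unfolding D_def by blast
    \<comment> \<open>Different members of \<open>M\<close> may become equal on \<open>T\<close>, so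
      their coefficients are added up.\<close>
    let ?c = "\<lambda>b' t. \<Sum>b\<in>{b\<in>M. ?pb b = b'}. c b t"
    have "(\<Sum>b\<in>M. c b t * ?pb b t) = (\<Sum>b'\<in>?pb ` M. ?c b' t * b' t)" for t
    proof -
      have "(\<Sum>b\<in>M. c b t * ?pb b t) = (\<Sum>b'\<in>?pb ` M. \<Sum>b\<in>{b\<in>M. ?pb b = b'}. c b t * ?pb b t)"
        using M(1) by (rule sum.image_gen)
      also have "\<dots> = (\<Sum>b'\<in>?pb ` M. ?c b' t * b' t)"
        by (auto simp: sum_distrib_right intro!: sum.cong)
      finally show ?thesis .
    qed
    then show "\<exists>c. (\<forall>b\<in>?pb ` M. c b \<in> B') \<and> d = (\<lambda>x. \<Sum>b\<in>?pb ` M. c b x * b x)"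
      using c by (intro exI[of _ ?c] conjI ballI fun_subalg_sum[OF B']) auto
  qed
  then obtain \<eta>' where \<eta>': "alg_hom T D \<eta>'" "\<forall>b\<in>B'. \<eta>' b = \<eta> b"
    using lying_over[OF B' D B'D, of "?pb ` M", OF _ _ _ \<eta>] M pbD by blast
  let ?ev = "\<lambda>a. ext0 (pts A) (\<lambda>\<xi>. \<xi> a)"
  have fnsA: "?ev a \<in> fns A" if "a \<in> I" for a using that by (simp add: A)
  \<comment> \<open>The character pulled back to \<open>I\<close>, cut off outside \<open>I\<close>
    as \<open>max_spec\<close> requires.\<close>
  define \<xi> where "\<xi> = ext0 I (\<lambda>a. \<eta>' (?pb (?ev a)))"
  have "alg_hom X I \<xi>"
    unfolding alg_hom_def
  proof (intro conjI allI ballI)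
    fix c
    have "?pb (?ev (ext0 X (\<lambda>_. c))) = ext0 T (\<lambda>_. c)"
      using p by (auto simp: ext0_def A max_spec_iff alg_hom_def)
    then show "\<xi> (ext0 X (\<lambda>_. c)) = c"
      using fun_subalg_const[OF I] alg_hom_const[OF D \<eta>'(1)] by (simp add: \<xi>_def)
  next
    fix f g assume fg: "f \<in> I" "g \<in> I"
    have hom: "alg_hom X I (p t)" if "t \<in> T" for t using p[OF that] by (simp add: A max_spec_iff)
    have "?pb (?ev (\<lambda>x. f x + g x)) = (\<lambda>t. ?pb (?ev f) t + ?pb (?ev g) t)"
      using p alg_hom_add[OF I hom fg] by (auto simp: ext0_def)
    then show "\<xi> (\<lambda>x. f x + g x) = \<xi> f + \<xi> g"
      using fg fun_subalg_add[OF I fg] alg_hom_add[OF D \<eta>'(1)] pbD fnsA by (simp add: \<xi>_def)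
    have "?pb (?ev (\<lambda>x. f x * g x)) = (\<lambda>t. ?pb (?ev f) t * ?pb (?ev g) t)"
      using p alg_hom_mult[OF I hom fg] by (auto simp: ext0_def)
    then show "\<xi> (\<lambda>x. f x * g x) = \<xi> f * \<xi> g"
      using fg fun_subalg_mult[OF I fg] alg_hom_mult[OF D \<eta>'(1)] pbD fnsA by (simp add: \<xi>_def)
  qed
  then have "\<xi> \<in> pts A" by (simp add: A max_spec_iff \<xi>_def)
  moreover have "a \<xi> = \<eta>' (?pb a)" if a: "a \<in> fns A" for a
  proof -
    obtain a0 where a0: "a0 \<in> I" "a = ?ev a0" using a by (auto simp: A)
    have "a \<xi> = \<xi> a0" using \<open>\<xi> \<in> pts A\<close> a0(2) by simp
    then show ?thesis using a0 by (simp add: \<xi>_def)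
  qed
  ultimately show ?thesis using D B'D pbD \<eta>' by (intro exI[of _ D] exI[of _ \<eta>'] exI[of _ \<xi>]) simp
qed

text \<open>A point \<open>w\<close> in the closure of the image of \<open>T\<close> defines a
  character of the functions restricted to \<open>T\<close>: by \<open>welldef\<close> the value at
  \<open>w\<close> depends on the restriction only. Constants are required only up to agreement at
  \<open>w\<close> and on the image, so that \<open>R\<close> may consist of functions extended by
  zero as well as of regular functions with arbitrary values elsewhere.\<close>

lemma pullback_character:
  assumes const: "\<forall>c. \<exists>\<beta>\<in>R. \<beta> w = c \<and> (\<forall>t\<in>T. \<beta> (\<tau> t) = c)"
    and closed: "\<forall>\<beta>\<in>R. \<forall>\<beta>'\<in>R. (\<lambda>x. \<beta> x + \<beta>' x) \<in> R \<and> (\<lambda>x. \<beta> x * \<beta>' x) \<in> R"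
    and welldef: "\<forall>\<beta>\<in>R. \<forall>\<beta>'\<in>R. (\<forall>t\<in>T. \<beta> (\<tau> t) = \<beta>' (\<tau> t)) \<longrightarrow> \<beta> w = \<beta>' w"
  shows "\<exists>\<eta>. fun_subalg T ((\<lambda>\<beta>. ext0 T (\<lambda>t. \<beta> (\<tau> t))) ` R) \<and>
    alg_hom T ((\<lambda>\<beta>. ext0 T (\<lambda>t. \<beta> (\<tau> t))) ` R) \<eta> \<and> (\<forall>\<beta>\<in>R. \<eta> (ext0 T (\<lambda>t. \<beta> (\<tau> t))) = \<beta> w)"
proof -
  let ?pb = "\<lambda>\<beta>. ext0 T (\<lambda>t. \<beta> (\<tau> t))"
  define \<eta> where "\<eta> = (\<lambda>f. THE c. \<exists>\<beta>\<in>R. f = ?pb \<beta> \<and> c = \<beta> w)"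
  have \<eta>: "\<eta> (?pb \<beta>) = \<beta> w" if "\<beta> \<in> R" for \<beta>
    unfolding \<eta>_def
  proof (rule the_equality)
    show "\<exists>\<beta>'\<in>R. ?pb \<beta> = ?pb \<beta>' \<and> \<beta> w = \<beta>' w" using that by (intro bexI[of _ \<beta>]) simp_all
    fix c assume "\<exists>\<beta>'\<in>R. ?pb \<beta> = ?pb \<beta>' \<and> c = \<beta>' w"
    then obtain \<beta>' where \<beta>': "\<beta>' \<in> R" "?pb \<beta> = ?pb \<beta>'" "c = \<beta>' w" by (elim bexE conjE) (rule that)
    have "\<beta> (\<tau> t) = \<beta>' (\<tau> t)" if "t \<in> T" for t using fun_cong[OF \<beta>'(2), of t] that by simp
    then show "c = \<beta> w" using welldef[rule_format, OF \<open>\<beta> \<in> R\<close> \<beta>'(1)] \<beta>'(3) by simp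
  qed
  have add: "(\<lambda>x. \<beta> x + \<beta>' x) \<in> R" and mult: "(\<lambda>x. \<beta> x * \<beta>' x) \<in> R" if "\<beta> \<in> R" "\<beta>' \<in> R" for \<beta> \<beta>'
    using closed that by auto
  have pc: "\<exists>\<beta>\<in>R. ext0 T (\<lambda>_. c) = ?pb \<beta> \<and> \<beta> w = c" for c
  proof -
    obtain \<beta> where \<beta>: "\<beta> \<in> R" "\<beta> w = c" "\<forall>t\<in>T. \<beta> (\<tau> t) = c" using const by blast
    have "ext0 T (\<lambda>_. c) = ?pb \<beta>" using \<beta>(3) by (intro ext0_cong) simp
    then show ?thesis using \<beta>(1,2) by blast
  qed
  have pa: "?pb (\<lambda>x. b x + b' x) = (\<lambda>x. ?pb b x + ?pb b' x)" for b b' by (auto simp: ext0_def)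
  have pm: "?pb (\<lambda>x. b x * b' x) = (\<lambda>x. ?pb b x * ?pb b' x)" for b b' by (auto simp: ext0_def)
  have "fun_subalg T (?pb ` R)"
    unfolding fun_subalg_def
  proof (intro conjI ballI allI impI)
    fix c show "ext0 T (\<lambda>_. c) \<in> ?pb ` R" using pc[of c] by blast
  next
    fix f g assume "f \<in> ?pb ` R" "g \<in> ?pb ` R"
    then obtain b b' where b: "b \<in> R" "b' \<in> R" "f = ?pb b" "g = ?pb b'" by blast
    show "(\<lambda>x. f x + g x) \<in> ?pb ` R"
      using add[OF b(1,2)] pa[of b b'] b(3,4) by (intro image_eqI[of _ _ "\<lambda>x. b x + b' x"]) auto
    show "(\<lambda>x. f x * g x) \<in> ?pb ` R"
      using mult[OF b(1,2)] pm[of b b'] b(3,4) by (intro image_eqI[of _ _ "\<lambda>x. b x * b' x"]) auto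
  qed auto
  moreover have "alg_hom T (?pb ` R) \<eta>"
    unfolding alg_hom_def
  proof (intro conjI ballI allI impI)
    fix c show "\<eta> (ext0 T (\<lambda>_. c)) = c" using pc[of c] \<eta> by auto
  next
    fix f g assume "f \<in> ?pb ` R" "g \<in> ?pb ` R"
    then obtain b b' where b: "b \<in> R" "b' \<in> R" "f = ?pb b" "g = ?pb b'" by blast
    show "\<eta> (\<lambda>x. f x + g x) = \<eta> f + \<eta> g"
      using \<eta>[OF add[OF b(1,2)]] \<eta> b unfolding pa by simp
    show "\<eta> (\<lambda>x. f x * g x) = \<eta> f * \<eta> g"
      using \<eta>[OF mult[OF b(1,2)]] \<eta> b unfolding pm by simp
  qed
  ultimately show ?thesis using \<eta> by blast
qed

text \<open>Here \<open>T\<close> is the source itself: evaluation at a point of the closure is a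
  character of the functions pulled back from \<open>B\<close>, and its lift is a point of
  \<open>A\<close> over the given one.\<close>

lemma finite_image_closed:
  assumes I: "fun_subalg X I" and A: "A = spec_variety X I" and B: "fun_variety B"
    and sep: "\<And>y z. y \<in> pts B \<Longrightarrow> z \<in> pts B \<Longrightarrow> \<forall>b\<in>fns B. b y = b z \<Longrightarrow> y = z"
    and fin: "finite_morphism A B \<phi>"
    and maps: "\<And>x. x \<in> pts A \<Longrightarrow> \<phi> x \<in> pts B"
    and pull: "\<And>b. b \<in> fns B \<Longrightarrow> ext0 (pts A) (\<lambda>x. b (\<phi> x)) \<in> fns A"
  shows "zariski B closure_of (\<phi> ` pts A) \<subseteq> \<phi> ` pts A"
proof
  fix y assume y: "y \<in> zariski B closure_of (\<phi> ` pts A)"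
  have subB: "fun_subalg (pts B) (fns B)" using B by (simp add: fun_variety_def)
  have im: "\<phi> ` pts A \<subseteq> pts B" using maps by blast
  have yB: "y \<in> pts B" and yv: "\<And>f. f \<in> fns B \<Longrightarrow> (\<forall>x\<in>pts A. f (\<phi> x) = 0) \<Longrightarrow> f y = 0"
    using y unfolding zariski_closure_of[OF B im] by auto
  obtain M where M: "finite M" "M \<subseteq> fns A"
    "\<forall>a\<in>fns A. \<exists>c. (\<forall>b\<in>M. c b \<in> fns B) \<and> (\<forall>x\<in>pts A. a x = (\<Sum>b\<in>M. c b (\<phi> x) * b x))"
    using fin unfolding finite_morphism_def by blast
  let ?pb = "\<lambda>b. ext0 (pts A) (\<lambda>x. b (\<phi> x))"
  have const: "\<forall>c. \<exists>\<beta>\<in>fns B. \<beta> y = c \<and> (\<forall>x\<in>pts A. \<beta> (\<phi> x) = c)"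
  proof
    fix c show "\<exists>\<beta>\<in>fns B. \<beta> y = c \<and> (\<forall>x\<in>pts A. \<beta> (\<phi> x) = c)"
      using fun_subalg_const[OF subB, of c] yB maps by (intro bexI[of _ "ext0 (pts B) (\<lambda>_. c)"]) auto
  qed
  have closed: "\<forall>\<beta>\<in>fns B. \<forall>\<beta>'\<in>fns B. (\<lambda>x. \<beta> x + \<beta>' x) \<in> fns B \<and> (\<lambda>x. \<beta> x * \<beta>' x) \<in> fns B"
    using fun_subalg_add[OF subB] fun_subalg_mult[OF subB] by simp
  have welldef: "\<forall>b\<in>fns B. \<forall>b'\<in>fns B. (\<forall>x\<in>pts A. b (\<phi> x) = b' (\<phi> x)) \<longrightarrow> b y = b' y"
  proof (intro ballI impI)
    fix b b' assume "b \<in> fns B" "b' \<in> fns B" "\<forall>x\<in>pts A. b (\<phi> x) = b' (\<phi> x)"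
    then show "b y = b' y" using yv[OF fun_subalg_diff[OF subB, of b b']] by simp
  qed
  obtain \<eta> where B': "fun_subalg (pts A) (?pb ` fns B)" and hom: "alg_hom (pts A) (?pb ` fns B) \<eta>"
    and \<eta>: "\<forall>b\<in>fns B. \<eta> (?pb b) = b y"
    using pullback_character[OF const closed welldef]
    by (elim exE conjE) (rule that)
  have pull': "\<forall>b\<in>fns B. ext0 (pts A) (\<lambda>t. b (\<phi> t)) \<in> ?pb ` fns B" by simp
  have id: "\<forall>t\<in>pts A. t \<in> pts A" by simp
  obtain D \<eta>' \<xi> where L: "\<forall>b\<in>?pb ` fns B. \<eta>' b = \<eta> b" "\<xi> \<in> pts A"
    "\<forall>a\<in>fns A. a \<xi> = \<eta>' (ext0 (pts A) (\<lambda>t. a t))"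
    using finite_lift[OF I A M, of "pts A" "\<lambda>x. x", OF id B' pull' hom] by (elim exE conjE) simp
  have subA: "fun_subalg (pts A) (fns A)"
    using fun_variety_spec_variety[OF I] by (simp add: A fun_variety_def)
  have "b (\<phi> \<xi>) = b y" if b: "b \<in> fns B" for b
  proof -
    have "b (\<phi> \<xi>) = ?pb b \<xi>" using L(2) by simp
    also have "\<dots> = \<eta>' (?pb b)" using bspec[OF L(3) pull[OF b]] by (simp add: fun_subalg_ext0[OF subA pull[OF b]])
    also have "\<dots> = b y" using L(1) \<eta> b by auto
    finally show ?thesis .
  qed
  then have "\<phi> \<xi> = y" using sep[OF maps[OF L(2)] yB] by blast
  then show "y \<in> \<phi> ` pts A" using L(2) by blast
qed

text \<open>Let \<open>T\<close> be closed in the fibre product and \<open>w\<close> in the closure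
  of its projection. Evaluation at \<open>w\<close> lifts to a point \<open>\<xi>\<close>, the map
  from \<open>T\<close> to \<open>A\<close> being the first projection. The lifted character
  computes the value at \<open>(\<xi>, w)\<close> of any function on the product from its
  restriction to \<open>T\<close>, so no function separates \<open>(\<xi>, w)\<close> from
  \<open>T\<close>.\<close>

lemma finite_imp_proper:
  assumes I: "fun_subalg X I" and A: "A = spec_variety X I" and B: "fun_variety B"
    and sep: "\<And>y z. y \<in> pts B \<Longrightarrow> z \<in> pts B \<Longrightarrow> \<forall>b\<in>fns B. b y = b z \<Longrightarrow> y = z"
    and fin: "finite_morphism A B \<phi>"
    and pull: "\<And>b. b \<in> fns B \<Longrightarrow> ext0 (pts A) (\<lambda>x. b (\<phi> x)) \<in> fns A"
  shows "proper_morphism A B \<phi>"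
  unfolding proper_morphism_def Let_def
proof (intro conjI allI impI)
  show m: "morphism A B \<phi>" using fin unfolding finite_morphism_def by blast
  have fvA: "fun_variety A" using fun_variety_spec_variety[OF I] by (simp add: A)
  have maps: "\<phi> x \<in> pts B" if "x \<in> pts A" for x
    using morphism_on_maps[OF fvA B order_refl order_refl m that] .
  obtain M where M: "finite M" "M \<subseteq> fns A"
    "\<forall>a\<in>fns A. \<exists>c. (\<forall>b\<in>M. c b \<in> fns B) \<and> (\<forall>x\<in>pts A. a x = (\<Sum>b\<in>M. c b (\<phi> x) * b x))"
    using fin unfolding finite_morphism_def by blast
  fix k :: nat and W \<psi>
  define C where "C = closed_subvariety (coord_space {..<k}) W"
  assume "morphism (closed_subvariety (coord_space {..<k}) W) B \<psi>"
  then have \<psi>: "morphism C B \<psi>" by (simp add: C_def)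
  have fvC: "fun_variety C" by (simp add: C_def fun_variety_closed_subvariety)
  have pC: "pts C = W" by (simp add: C_def)
  note \<psi>maps = morphism_on_maps[OF fvC B order_refl order_refl \<psi>]
  note \<psi>reg = morphism_on_regular[OF fvC B order_refl order_refl \<psi>]
  define F where "F = {(x, w). x \<in> pts A \<and> w \<in> W \<and> \<phi> x = \<psi> w}"
  let ?P = "prod_variety A C"
  have fvP: "fun_variety ?P" by (rule fun_variety_prod_variety)
  have pP: "pts ?P = pts A \<times> W" by (simp add: prod_variety_def pC)
  have fP: "fns ?P = fun_alg (pts A \<times> W) ((\<lambda>f. f \<circ> fst) ` fns A \<union> (\<lambda>g. g \<circ> snd) ` fns C)"
    by (simp add: prod_variety_def pC)
  have topP: "topspace (subtopology (zariski ?P) F) = F"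
    using topspace_zariski[OF fvP] by (auto simp: pP F_def)
  have "closed_map (subtopology (zariski ?P) F) (zariski C) snd"
    unfolding closed_map_def
  proof (intro allI impI)
    fix T assume T: "closedin (subtopology (zariski ?P) F) T"
    then have TF: "T \<subseteq> F" using closedin_subset topP by metis
    have TP: "T \<subseteq> pts A \<times> W" using TF by (auto simp: F_def)
    have sT: "snd ` T \<subseteq> pts C" using TF by (auto simp: F_def pC)
    have "zariski C closure_of (snd ` T) \<subseteq> snd ` T"
    proof
      fix w assume w: "w \<in> zariski C closure_of (snd ` T)"
      have wC: "w \<in> pts C" using w topspace_zariski[OF fvC] by (simp add: in_closure_of)
      \<comment> \<open>Regular functions rather than \<open>fns C\<close>, since
        \<open>\<psi>\<close> is only known to pull \<open>fns B\<close> back to regular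
        functions.\<close>
      define R where "R = {\<beta>. regular_on C (pts C) \<beta>}"
      let ?pb = "\<lambda>\<beta>. ext0 T (\<lambda>t. \<beta> (snd t))"
      have Rc: "(\<lambda>_. c) \<in> R" for c unfolding R_def using regular_on_const[OF fvC order_refl] by blast
      have Ra: "(\<lambda>x. \<beta> x + \<beta>' x) \<in> R" if "\<beta> \<in> R" "\<beta>' \<in> R" for \<beta> \<beta>'
        using that regular_on_add[OF fvC order_refl] unfolding R_def by blast
      have Rm: "(\<lambda>x. \<beta> x * \<beta>' x) \<in> R" if "\<beta> \<in> R" "\<beta>' \<in> R" for \<beta> \<beta>'
        using that regular_on_mult[OF fvC order_refl] unfolding R_def by blast
      have welldef: "\<forall>\<beta>\<in>R. \<forall>\<beta>'\<in>R. (\<forall>t\<in>T. \<beta> (snd t) = \<beta>' (snd t)) \<longrightarrow> \<beta> w = \<beta>' w"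
      proof (intro ballI impI)
        fix \<beta> \<beta>' assume that: "\<beta> \<in> R" "\<beta>' \<in> R" "\<forall>t\<in>T. \<beta> (snd t) = \<beta>' (snd t)"
        have "\<beta> w + (-1) * \<beta>' w = 0"
        proof (rule regular_on_vanish_closure[OF fvC sT _ _ w])
          show "regular_on C (pts C) (\<lambda>x. \<beta> x + (-1) * \<beta>' x)"
            using Ra[OF that(1) Rm[OF Rc[of "-1"] that(2)]] unfolding R_def by blast
          show "\<beta> x + (-1) * \<beta>' x = 0" if "x \<in> snd ` T" for x
            using that \<open>\<forall>t\<in>T. \<beta> (snd t) = \<beta>' (snd t)\<close> by (elim imageE) simp
        qed
        then show "\<beta> w = \<beta>' w" by simp
      qed
      have const: "\<forall>c. \<exists>\<beta>\<in>R. \<beta> w = c \<and> (\<forall>t\<in>T. \<beta> (snd t) = c)"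
      proof
        fix c show "\<exists>\<beta>\<in>R. \<beta> w = c \<and> (\<forall>t\<in>T. \<beta> (snd t) = c)"
          using Rc[of c] by (intro bexI[of _ "\<lambda>_. c"]) simp_all
      qed
      have closed: "\<forall>\<beta>\<in>R. \<forall>\<beta>'\<in>R. (\<lambda>x. \<beta> x + \<beta>' x) \<in> R \<and> (\<lambda>x. \<beta> x * \<beta>' x) \<in> R"
        using Ra Rm by simp
      obtain \<eta> where B': "fun_subalg T (?pb ` R)" and hom: "alg_hom T (?pb ` R) \<eta>"
        and \<eta>: "\<forall>\<beta>\<in>R. \<eta> (?pb \<beta>) = \<beta> w"
        using pullback_character[OF const closed welldef]
        by (elim exE conjE) (rule that)
      have \<phi>\<psi>: "ext0 T (\<lambda>t. b (\<phi> (fst t))) = ?pb (\<lambda>w. b (\<psi> w))" for b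
      proof
        fix t
        have "\<phi> (fst t) = \<psi> (snd t)" if "t \<in> T" using TF that by (auto simp: F_def)
        then show "ext0 T (\<lambda>t. b (\<phi> (fst t))) t = ?pb (\<lambda>w. b (\<psi> w)) t" by (cases "t \<in> T") auto
      qed
      have pull': "\<forall>b\<in>fns B. ext0 T (\<lambda>t. b (\<phi> (fst t))) \<in> ?pb ` R"
        unfolding \<phi>\<psi> using \<psi>reg by (auto simp: R_def)
      have fstA: "\<forall>t\<in>T. fst t \<in> pts A" using TP by auto
      obtain D \<eta>' \<xi> where L: "fun_subalg T D" "?pb ` R \<subseteq> D" "\<forall>a\<in>fns A. ext0 T (\<lambda>t. a (fst t)) \<in> D"
        "alg_hom T D \<eta>'" "\<forall>b\<in>?pb ` R. \<eta>' b = \<eta> b" "\<xi> \<in> pts A"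
        "\<forall>a\<in>fns A. a \<xi> = \<eta>' (ext0 T (\<lambda>t. a (fst t)))"
        using finite_lift[OF I A M, of T fst, OF fstA B' pull' hom] by (elim exE conjE) (rule that)
      have R\<eta>: "\<eta>' (?pb \<beta>) = \<beta> w" if "\<beta> \<in> R" for \<beta> using L(5) \<eta> that by auto
      \<comment> \<open>On \<open>T\<close> both ways round the fibre square agree, so the lift lies
        over \<open>\<psi> w\<close>.\<close>
      have "b (\<phi> \<xi>) = b (\<psi> w)" if b: "b \<in> fns B" for b
      proof -
        have "b (\<phi> \<xi>) = \<eta>' (ext0 T (\<lambda>t. ext0 (pts A) (\<lambda>x. b (\<phi> x)) (fst t)))"
          using bspec[OF L(7) pull[OF b]] L(6) by simp
        also have "ext0 T (\<lambda>t. ext0 (pts A) (\<lambda>x. b (\<phi> x)) (fst t)) = ext0 T (\<lambda>t. b (\<phi> (fst t)))"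
          using fstA by (intro ext) (simp add: ext0_def)
        also have "\<dots> = ?pb (\<lambda>w. b (\<psi> w))" by (rule \<phi>\<psi>)
        finally show ?thesis using R\<eta> \<psi>reg[OF b] by (simp add: R_def)
      qed
      then have "\<phi> \<xi> = \<psi> w" using sep[OF maps[OF L(6)] \<psi>maps[OF wC]] by blast
      then have F: "(\<xi>, w) \<in> F" using L(6) wC by (simp add: F_def pC)
      have ev: "ext0 T f \<in> D \<and> f (\<xi>, w) = \<eta>' (ext0 T f)" if "f \<in> fns ?P" for f
        using that unfolding fP
      proof (induction rule: fun_alg.induct)
        case (const c)
        have "ext0 T (ext0 (pts A \<times> W) (\<lambda>_. c)) = ext0 T (\<lambda>_. c)" using TP by (rule ext0_ext0)
        then show ?case
          using alg_hom_const[OF L(1,4)] fun_subalg_const[OF L(1)] L(6) wC by (simp add: pC)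
      next
        case (gen f)
        have r: "ext0 T (ext0 (pts A \<times> W) f) = ext0 T f" using TP by (rule ext0_ext0)
        have e: "ext0 (pts A \<times> W) f (\<xi>, w) = f (\<xi>, w)" using L(6) wC by (simp add: pC)
        from gen show ?case
        proof
          assume "f \<in> (\<lambda>f. f \<circ> fst) ` fns A"
          then show ?thesis unfolding r e using L(3,7) by (auto simp: comp_def)
        next
          assume "f \<in> (\<lambda>g. g \<circ> snd) ` fns C"
          then obtain g where g: "g \<in> fns C" "f = (\<lambda>t. g (snd t))" by (auto simp: comp_def)
          have "g \<in> R" using regular_on_fns[OF fvC order_refl g(1)] by (simp add: R_def)
          then show ?thesis unfolding r e using R\<eta> L(2) g by auto
        qed
      next
        case (add f g)
        have "ext0 T (\<lambda>x. f x + g x) = (\<lambda>x. ext0 T f x + ext0 T g x)" by (auto simp: ext0_def)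
        then show ?case using add alg_hom_add[OF L(1,4)] fun_subalg_add[OF L(1)] by simp
      next
        case (mult f g)
        have "ext0 T (\<lambda>x. f x * g x) = (\<lambda>x. ext0 T f x * ext0 T g x)" by (auto simp: ext0_def)
        then show ?case using mult alg_hom_mult[OF L(1,4)] fun_subalg_mult[OF L(1)] by simp
      qed
      have "(\<xi>, w) \<in> T"
      proof (rule ccontr)
        assume "(\<xi>, w) \<notin> T"
        then obtain f where f: "f \<in> fns ?P" "f (\<xi>, w) \<noteq> 0" "\<forall>y\<in>T. f y = 0"
          using closedin_zariski_separate[OF fvP T _ F] L(6) wC pP pC by auto
        then have "ext0 T f = (\<lambda>_. 0)" by (auto simp: ext0_def)
        then show False using ev[OF f(1)] f(2) alg_hom_zero[OF L(1,4)] by simp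
      qed
      then show "w \<in> snd ` T" by force
    qed
    then show "closedin (zariski C) (snd ` T)"
      using sT topspace_zariski[OF fvC] closure_of_subset[of "snd ` T" "zariski C"]
      by (metis closedin_closure_of subset_antisym)
  qed
  then show "closed_map (subtopology (zariski (prod_variety A (closed_subvariety (coord_space {..<k}) W)))
      {(x, w). x \<in> pts A \<and> w \<in> W \<and> \<phi> x = \<psi> w}) (zariski (closed_subvariety (coord_space {..<k}) W)) snd"
    by (simp add: C_def F_def)
qed

section \<open>Polynomials in one variable\<close>

text \<open>Lagrange interpolation at 0, ..., m. The weights depend only on \<open>m\<close> and
  \<open>k\<close>, so taking a coefficient is a fixed linear combination of values, and values of
  forms are the available coordinate functions.\<close>

lemma coeff_interpolation:
  "\<exists>\<gamma>. \<forall>p::complex poly. degree p \<le> m \<longrightarrow> coeff p k = (\<Sum>i\<le>m. \<gamma> i * poly p (of_nat i))"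
proof -
  define L where "L = (\<lambda>i. \<Prod>j\<in>{..m} - {i}. [:- of_nat j, 1 :: complex:])"
  define c where "c = (\<lambda>i. poly (L i) (of_nat i))"
  have cne: "c i \<noteq> 0" for i by (auto simp: c_def L_def poly_prod)
  have cL: "poly (L i) (of_nat i) = c i" for i by (simp add: c_def)
  have L0: "poly (L i) (of_nat j) = 0" if "i \<noteq> j" "j \<le> m" for i j
    using that by (auto simp: L_def poly_prod intro!: bexI[of _ j])
  have dL: "degree (L i) \<le> m" if "i \<le> m" for i
  proof -
    have "degree (L i) \<le> sum (degree \<circ> (\<lambda>j. [:- of_nat j, 1 :: complex:])) ({..m} - {i})"
      unfolding L_def by (rule degree_prod_sum_le) simp
    also have "\<dots> \<le> m" using that by simp
    finally show ?thesis .
  qed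
  have "coeff p k = (\<Sum>i\<le>m. coeff (L i) k / c i * poly p (of_nat i))" if p: "degree p \<le> m" for p
  proof -
    define q where "q = (\<Sum>i\<le>m. smult (poly p (of_nat i) / c i) (L i))"
    have "degree q \<le> m"
      unfolding q_def by (rule degree_sum_le) (use dL in \<open>auto intro: le_trans[OF degree_smult_le]\<close>)
    moreover have "poly p (of_nat j) = poly q (of_nat j)" if "j \<le> m" for j
    proof -
      have "poly q (of_nat j) = (\<Sum>i\<le>m. if i = j then poly p (of_nat j) else 0)"
        unfolding q_def poly_sum using that L0 cne cL by (intro sum.cong) auto
      then show ?thesis using that by simp
    qed
    moreover have "card (of_nat ` {..m} :: complex set) = Suc m"
      by (subst card_image) (auto simp: inj_on_def)
    ultimately have "p = q"
      using p by (intro poly_eqI_degree[of "of_nat ` {..m}"]) auto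
    then have "coeff p k = coeff q k" by simp
    also have "\<dots> = (\<Sum>i\<le>m. coeff (L i) k / c i * poly p (of_nat i))"
      unfolding q_def by (simp add: coeff_sum mult.commute)
    finally show ?thesis .
  qed
  then show ?thesis by (intro exI[of _ "\<lambda>i. coeff (L i) k / c i"] allI impI)
qed

text \<open>Stands in for a limit at 0: an identity known on a punctured line is carried to the
  missing point.\<close>

lemma poly_eq_0_punctured:
  fixes p :: "complex poly"
  assumes "\<And>z. z \<noteq> 0 \<Longrightarrow> poly p z = 0"
  shows "p = 0"
proof (rule ccontr)
  assume "p \<noteq> 0"
  then have "finite {z. poly p z = 0}" by (rule poly_roots_finite)
  moreover have "UNIV - {0} \<subseteq> {z. poly p z = 0}" using assms by auto
  ultimately have "finite (UNIV - {0::complex})" using finite_subset by blast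
  then show False using infinite_UNIV_char_0[where 'a=complex] by simp
qed

lemma poly_sum_list: "poly (\<Sum>t\<leftarrow>ts. f t) z = (\<Sum>t\<leftarrow>ts. poly (f t) z)"
  by (induction ts) auto

text \<open>Isolates the terms of one weight in a sum that scales by a single power of z. It serves
  both for the degree of forms and for the weight under the torus.\<close>

lemma compare_powers:
  fixes c :: "'t \<Rightarrow> complex"
  assumes "\<And>z. z \<noteq> 0 \<Longrightarrow> (\<Sum>t\<leftarrow>ts. c t * z ^ k t) = C * z ^ K"
  shows "(\<Sum>t\<leftarrow>filter (\<lambda>t. k t = K) ts. c t) = C"
proof -
  define p where "p = (\<Sum>t\<leftarrow>ts. monom (c t) (k t)) - monom C K"
  have "p = 0"
    by (rule poly_eq_0_punctured) (simp add: p_def poly_sum_list poly_monom assms)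
  then have "coeff p K = 0" by simp
  moreover have "coeff (\<Sum>t\<leftarrow>ts. monom (c t) (k t)) K = (\<Sum>t\<leftarrow>filter (\<lambda>t. k t = K) ts. c t)"
    by (induction ts) auto
  ultimately show ?thesis by (simp add: p_def)
qed

(* Chosen so that sum_dm_coeff holds, which is dedekind_mertens_coeff for G a power of b + a t. *)
fun dm_coeff :: "nat \<Rightarrow> nat \<Rightarrow> complex" where
  "dm_coeff d j = 1 - (\<Sum>i<j. dm_coeff d i * of_nat ((j + d) choose (i + d)))"

declare dm_coeff.simps [simp del]

text \<open>In closed form \<open>dm_coeff d i\<close> is the coefficient of x^i in (1 + x)^(-d),
  and the sum is the coefficient of x^j in (1 + x)^(-d) (1 + x)^(j + d) = (1 + x)^j. The recursive
  definition makes it immediate.\<close>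

lemma sum_dm_coeff: "(\<Sum>i\<le>j. dm_coeff d i * of_nat ((j + d) choose (i + d))) = 1"
proof -
  have "(\<Sum>i\<le>j. dm_coeff d i * of_nat ((j + d) choose (i + d))) =
      (\<Sum>i<j. dm_coeff d i * of_nat ((j + d) choose (i + d))) + dm_coeff d j"
    by (simp add: lessThan_Suc_atMost[symmetric])
  then show ?thesis by (simp add: dm_coeff.simps[of d j])
qed

text \<open>Both sides are linear in \<open>G\<close>, so for nonzero \<open>a\<close> it is enough
  to take G = (b + a t)^j. Then each term on the right is a^(n + d) b^j times
  \<open>dm_coeff d i\<close> times a binomial coefficient, and \<open>sum_dm_coeff\<close>
  applies.\<close>

lemma dedekind_mertens_coeff:
  fixes G :: "complex poly"
  assumes G: "degree G \<le> n" and d: "d > 0"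
  shows "a ^ (n + d) * poly G 0 =
    (\<Sum>i\<le>n. dm_coeff d i * a ^ (n - i) * b ^ i * coeff ([:b, a:] ^ d * G) (i + d))"
proof (cases "a = 0")
  case True
  \<comment> \<open>For \<open>a = 0\<close> only the term i = n carries no power of
    \<open>a\<close>, and n + d exceeds the degree of b^d G.\<close>
  have *: "coeff ([:b, a:] ^ d * G) (n + d) = 0"
  proof -
    have "[:b, a:] ^ d = [:b ^ d:]" using True by (simp add: poly_const_pow)
    then have "coeff ([:b, a:] ^ d * G) (n + d) = b ^ d * coeff G (n + d)" by simp
    then show ?thesis using G d by (simp add: coeff_eq_0)
  qed
  have "(\<Sum>i\<le>n. dm_coeff d i * a ^ (n - i) * b ^ i * coeff ([:b, a:] ^ d * G) (i + d)) = 0"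
  proof (rule sum.neutral, rule ballI)
    fix i assume "i \<in> {..n}"
    then show "dm_coeff d i * a ^ (n - i) * b ^ i * coeff ([:b, a:] ^ d * G) (i + d) = 0"
      using * True by (cases "i = n") auto
  qed
  then show ?thesis using True d by simp
next
  case False
  \<comment> \<open>\<open>G\<close> rewritten as a polynomial in s = b + a t; \<open>c\<close>
    lists its coefficients.\<close>
  define G' where "G' = pcompose G [:- b / a, 1 / a:]"
  define c where "c = coeff G'"
  have dG': "degree G' \<le> n" using G False by (simp add: G'_def degree_pcompose)
  have GG': "G = pcompose G' [:b, a:]"
  proof -
    have "pcompose [:- b / a, 1 / a:] [:b, a:] = [:0, 1:]" using False by (simp add: pcompose_pCons)
    then show ?thesis by (simp add: G'_def pcompose_assoc[symmetric])
  qed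
  have G_eq: "G = (\<Sum>j\<le>n. smult (c j) ([:b, a:] ^ j))"
  proof -
    have "poly G x = poly (\<Sum>j\<le>n. smult (c j) ([:b, a:] ^ j)) x" for x
    proof -
      have "poly G x = poly G' (b + x * a)" by (subst GG') (simp add: poly_pcompose)
      also have "\<dots> = (\<Sum>j\<le>degree G'. c j * (b + x * a) ^ j)" by (simp add: poly_altdef c_def)
      also have "\<dots> = (\<Sum>j\<le>n. c j * (b + x * a) ^ j)"
        using dG' by (intro sum.mono_neutral_left) (auto simp: c_def coeff_eq_0)
      finally show ?thesis by (simp add: poly_sum)
    qed
    then show ?thesis by (simp add: poly_eq_poly_eq_iff[symmetric] fun_eq_iff)
  qed
  have H: "[:b, a:] ^ d * G = (\<Sum>j\<le>n. smult (c j) ([:b, a:] ^ (j + d)))"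
    by (subst G_eq) (simp add: sum_distrib_left power_add mult.commute)
  have pw: "coeff ([:b, a:] ^ (j + d)) (i + d) = of_nat ((j + d) choose (i + d)) * a ^ (i + d) * b ^ (j - i)" for i j
  proof (cases "i \<le> j")
    case True
    then show ?thesis by (subst coeff_linear_poly_power) auto
  next
    case False
    have "degree ([:b, a:] ^ (j + d)) \<le> j + d"
      using degree_power_le[of "[:b, a:]" "j + d"] degree_pCons_le[of b "[:a:]"] by (simp split: if_splits)
    then have "degree ([:b, a:] ^ (j + d)) < i + d" using False by linarith
    then show ?thesis using False by (simp add: coeff_eq_0 binomial_eq_0)
  qed
  have "(\<Sum>i\<le>n. dm_coeff d i * a ^ (n - i) * b ^ i * coeff ([:b, a:] ^ d * G) (i + d)) =
      (\<Sum>i\<le>n. \<Sum>j\<le>n. a ^ (n + d) * (c j * b ^ j) * (dm_coeff d i * of_nat ((j + d) choose (i + d))))"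
  proof (rule sum.cong[OF refl])
    fix i assume i: "i \<in> {..n}"
    have "dm_coeff d i * a ^ (n - i) * b ^ i * coeff ([:b, a:] ^ d * G) (i + d) =
        (\<Sum>j\<le>n. dm_coeff d i * a ^ (n - i) * b ^ i * (c j * (of_nat ((j + d) choose (i + d)) * a ^ (i + d) * b ^ (j - i))))"
      by (simp add: H coeff_sum sum_distrib_left pw)
    also have "\<dots> = (\<Sum>j\<le>n. a ^ (n + d) * (c j * b ^ j) * (dm_coeff d i * of_nat ((j + d) choose (i + d))))"
    proof (rule sum.cong[OF refl])
      fix j
      show "dm_coeff d i * a ^ (n - i) * b ^ i * (c j * (of_nat ((j + d) choose (i + d)) * a ^ (i + d) * b ^ (j - i))) =
          a ^ (n + d) * (c j * b ^ j) * (dm_coeff d i * of_nat ((j + d) choose (i + d)))"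
      proof (cases "i \<le> j")
        case True
        have "a ^ (n - i) * a ^ (i + d) = a ^ (n + d)" using i by (simp add: power_add[symmetric])
        moreover have "b ^ i * b ^ (j - i) = b ^ j" using True by (simp add: power_add[symmetric])
        moreover have "dm_coeff d i * a ^ (n - i) * b ^ i * (c j * (of_nat ((j + d) choose (i + d)) * a ^ (i + d) * b ^ (j - i))) =
            (a ^ (n - i) * a ^ (i + d)) * (c j * (b ^ i * b ^ (j - i))) * (dm_coeff d i * of_nat ((j + d) choose (i + d)))"
          by (simp only: mult_ac)
        ultimately show ?thesis by simp
      qed (simp add: binomial_eq_0)
    qed
    finally show "dm_coeff d i * a ^ (n - i) * b ^ i * coeff ([:b, a:] ^ d * G) (i + d) = \<dots>" .
  qed
  also have "\<dots> = (\<Sum>j\<le>n. a ^ (n + d) * (c j * b ^ j) * (\<Sum>i\<le>n. dm_coeff d i * of_nat ((j + d) choose (i + d))))"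
    by (subst sum.swap) (simp add: sum_distrib_left)
  also have "\<dots> = (\<Sum>j\<le>n. a ^ (n + d) * (c j * b ^ j))"
  proof (rule sum.cong[OF refl])
    fix j assume "j \<in> {..n}"
    then have "(\<Sum>i\<le>n. dm_coeff d i * of_nat ((j + d) choose (i + d))) =
        (\<Sum>i\<le>j. dm_coeff d i * of_nat ((j + d) choose (i + d)))"
      by (intro sum.mono_neutral_right) (auto simp: binomial_eq_0)
    then show "a ^ (n + d) * (c j * b ^ j) * (\<Sum>i\<le>n. dm_coeff d i * of_nat ((j + d) choose (i + d))) =
        a ^ (n + d) * (c j * b ^ j)" by (simp add: sum_dm_coeff)
  qed
  also have "\<dots> = a ^ (n + d) * poly G 0"
    using arg_cong[OF G_eq, of "\<lambda>p. poly p 0"] by (simp add: poly_sum sum_distrib_left)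
  finally show ?thesis by simp
qed

text \<open>Coefficients are replaced by values through interpolation. In the application (b + l
  a)^d G(l) is a value of the product form. It matters that \<open>\<kappa>\<close> is uniform in
  \<open>a\<close>, \<open>b\<close> and \<open>G\<close>, which vary with the pair.\<close>

lemma dedekind_mertens:
  assumes d: "d > 0"
  shows "\<exists>\<kappa>. \<forall>a b (G :: complex poly). degree G \<le> n \<longrightarrow>
    a ^ (n + d) * poly G 0 =
      (\<Sum>i\<le>n. \<Sum>l\<le>n + d. \<kappa> i l * a ^ (n - i) * b ^ i * ((b + of_nat l * a) ^ d * poly G (of_nat l)))"
proof -
  have "\<forall>k. \<exists>\<gamma>. \<forall>p::complex poly. degree p \<le> n + d \<longrightarrow> coeff p k = (\<Sum>l\<le>n + d. \<gamma> l * poly p (of_nat l))"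
    using coeff_interpolation by blast
  from choice[OF this] obtain \<gamma> where \<gamma>:
    "\<forall>k. \<forall>p::complex poly. degree p \<le> n + d \<longrightarrow> coeff p k = (\<Sum>l\<le>n + d. \<gamma> k l * poly p (of_nat l))" by blast
  have "a ^ (n + d) * poly G 0 =
      (\<Sum>i\<le>n. \<Sum>l\<le>n + d. (dm_coeff d i * \<gamma> (i + d) l) * a ^ (n - i) * b ^ i * ((b + of_nat l * a) ^ d * poly G (of_nat l)))"
    if G: "degree G \<le> n" for a b and G :: "complex poly"
  proof -
    have "degree ([:b, a:] ^ d) \<le> d"
      using degree_power_le[of "[:b, a:]" d] by (simp split: if_splits)
    then have "degree ([:b, a:] ^ d * G) \<le> n + d"
      using degree_mult_le[of "[:b, a:] ^ d" G] G by linarith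
    then have "coeff ([:b, a:] ^ d * G) k = (\<Sum>l\<le>n + d. \<gamma> k l * poly ([:b, a:] ^ d * G) (of_nat l))" for k
      using \<gamma> by blast
    then show ?thesis
      unfolding dedekind_mertens_coeff[OF G d, of a b]
      by (intro sum.cong refl) (simp add: sum_distrib_left mult_ac)
  qed
  then show ?thesis by (intro exI[of _ "\<lambda>i l. dm_coeff d i * \<gamma> (i + d) l"]) blast
qed

section \<open>Finite-dimensional spaces of functions\<close>

definition lin_subspace :: "('i \<Rightarrow> complex) set \<Rightarrow> bool" where
  "lin_subspace V \<longleftrightarrow> (\<lambda>_. 0) \<in> V \<and> (\<forall>v\<in>V. \<forall>w\<in>V. (\<lambda>i. v i + w i) \<in> V) \<and> (\<forall>c. \<forall>v\<in>V. (\<lambda>i. c * v i) \<in> V)"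

lemma dualI:
  assumes "\<And>v. v \<notin> V \<Longrightarrow> l v = 0" "\<And>v w. v \<in> V \<Longrightarrow> w \<in> V \<Longrightarrow> l (\<lambda>i. v i + w i) = l v + l w"
    "\<And>c v. v \<in> V \<Longrightarrow> l (\<lambda>i. c * v i) = c * l v"
  shows "l \<in> dual V"
  using assms unfolding dual_def by blast

context
  fixes V :: "('i \<Rightarrow> complex) set"
  assumes V: "lin_subspace V"
begin

lemma lin_subspace_zero: "(\<lambda>_. 0) \<in> V"
  and lin_subspace_add: "v \<in> V \<Longrightarrow> w \<in> V \<Longrightarrow> (\<lambda>i. v i + w i) \<in> V"
  and lin_subspace_scale: "v \<in> V \<Longrightarrow> (\<lambda>i. c * v i) \<in> V"
  using V unfolding lin_subspace_def by blast+

lemma lin_subspace_sum: "(\<And>k. k \<in> K \<Longrightarrow> v k \<in> V) \<Longrightarrow> (\<lambda>i. \<Sum>k\<in>K. c k * v k i) \<in> V"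
proof (induction K rule: infinite_finite_induct)
  case (insert k K)
  then have "(\<lambda>i. c k * v k i + (\<Sum>k\<in>K. c k * v k i)) \<in> V"
    by (intro lin_subspace_add lin_subspace_scale) auto
  then show ?case using insert.hyps by simp
qed (auto intro: lin_subspace_zero)

lemma dual_add: "l \<in> dual V \<Longrightarrow> v \<in> V \<Longrightarrow> w \<in> V \<Longrightarrow> l (\<lambda>i. v i + w i) = l v + l w"
  and dual_scale: "l \<in> dual V \<Longrightarrow> v \<in> V \<Longrightarrow> l (\<lambda>i. c * v i) = c * l v"
  and dual_outside: "l \<in> dual V \<Longrightarrow> v \<notin> V \<Longrightarrow> l v = 0"
  unfolding dual_def by blast+

lemma dual_zero: "l \<in> dual V \<Longrightarrow> l (\<lambda>_. 0) = 0"
  using dual_scale[OF _ lin_subspace_zero, of l 0] by simp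

lemma dual_sum:
  assumes l: "l \<in> dual V" and "finite K"
  shows "(\<And>k. k \<in> K \<Longrightarrow> v k \<in> V) \<Longrightarrow> l (\<lambda>i. \<Sum>k\<in>K. c k * v k i) = (\<Sum>k\<in>K. c k * l (v k))"
  using \<open>finite K\<close>
proof (induction K rule: finite_induct)
  case empty
  then show ?case using dual_zero[OF l] by simp
next
  case (insert k K)
  have "l (\<lambda>i. \<Sum>k\<in>insert k K. c k * v k i) = l (\<lambda>i. c k * v k i + (\<Sum>k\<in>K. c k * v k i))"
    using insert by simp
  also have "\<dots> = c k * l (v k) + l (\<lambda>i. \<Sum>k\<in>K. c k * v k i)"
    using insert.prems by (subst dual_add[OF l lin_subspace_scale lin_subspace_sum]) (auto simp: dual_scale[OF l])
  finally show ?case using insert by simp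
qed

lemma lin_subspace_dual: "lin_subspace (dual V)"
  unfolding lin_subspace_def by (auto simp: dual_def algebra_simps)

lemma evaluation_in_dual: "ext0 V (\<lambda>f. f x) \<in> dual V"
  by (rule dualI) (auto simp: lin_subspace_add lin_subspace_scale)

end

(* A frame makes every functional on V a combination of evaluations at points. *)
definition eval_frame :: "('i \<Rightarrow> complex) set \<Rightarrow> 'i set \<Rightarrow> ('i \<Rightarrow> 'i \<Rightarrow> complex) \<Rightarrow> bool" where
  "eval_frame V P e \<longleftrightarrow> finite P \<and> (\<forall>p\<in>P. e p \<in> V) \<and> (\<forall>f\<in>V. f = (\<lambda>x. \<Sum>p\<in>P. f p * e p x))"

definition fun_span :: "'b set \<Rightarrow> ('b \<Rightarrow> 'i \<Rightarrow> complex) \<Rightarrow> ('i \<Rightarrow> complex) set" where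
  "fun_span G g = {(\<lambda>x. \<Sum>b\<in>G. c b * g b x) | c. True}"

lemma lin_subspace_fun_span: "lin_subspace (fun_span G g)"
  unfolding lin_subspace_def
proof (intro conjI ballI allI)
  show "(\<lambda>_. 0) \<in> fun_span G g" unfolding fun_span_def by (intro CollectI exI[of _ "\<lambda>_. 0"]) simp
next
  fix v w assume "v \<in> fun_span G g" "w \<in> fun_span G g"
  then obtain c c' where *: "v = (\<lambda>x. \<Sum>b\<in>G. c b * g b x)" "w = (\<lambda>x. \<Sum>b\<in>G. c' b * g b x)"
    unfolding fun_span_def by auto
  show "(\<lambda>i. v i + w i) \<in> fun_span G g" unfolding fun_span_def *
    by (intro CollectI exI[of _ "\<lambda>b. c b + c' b"]) (simp add: distrib_right sum.distrib)
next
  fix a v assume "v \<in> fun_span G g"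
  then obtain c where *: "v = (\<lambda>x. \<Sum>b\<in>G. c b * g b x)" unfolding fun_span_def by auto
  show "(\<lambda>i. a * v i) \<in> fun_span G g" unfolding fun_span_def *
    by (intro CollectI exI[of _ "\<lambda>b. a * c b"]) (simp add: sum_distrib_left mult.assoc)
qed

lemma fun_span_base:
  assumes "finite G" "b \<in> G" shows "g b \<in> fun_span G g"
proof -
  have "g b x = (\<Sum>b'\<in>G. (if b' = b then 1 else 0) * g b' x)" for x
    using assms by (simp add: if_distrib[of "\<lambda>c. c * _"] cong: if_cong)
  then show ?thesis unfolding fun_span_def by (intro CollectI exI[of _ "\<lambda>b'. if b' = b then 1 else 0"]) auto
qed

lemma fun_span_subset:
  assumes "lin_subspace V" "\<And>b. b \<in> G \<Longrightarrow> g b \<in> V" shows "fun_span G g \<subseteq> V"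
  unfolding fun_span_def using lin_subspace_sum[OF assms(1)] assms(2) by auto

text \<open>Points are added greedily: the remainder of a new generator after interpolation at the
  points found so far is either 0 or nonzero at some \<open>r\<close>, which becomes the next point.
  The Kronecker property of \<open>e\<close> is carried along the induction to make the remainder
  vanish at the old points.\<close>

lemma eval_frame_fun_span:
  assumes "finite G"
  shows "\<exists>P e. eval_frame (fun_span G g) P e"
proof -
  have "\<exists>P e. finite P \<and> (\<forall>p\<in>P. e p \<in> fun_span G g) \<and> (\<forall>b\<in>G. \<forall>x. g b x = (\<Sum>p\<in>P. g b p * e p x)) \<and>
      (\<forall>p\<in>P. \<forall>q\<in>P. e p q = (if p = q then 1 else 0))"
    using assms
  proof (induction G rule: finite_induct)
    case empty
    then show ?case by (intro exI[of _ "{}"]) auto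
  next
    case (insert b G)
    from insert.IH obtain P e where P: "finite P" "\<forall>p\<in>P. e p \<in> fun_span G g"
      "\<forall>b\<in>G. \<forall>x. g b x = (\<Sum>p\<in>P. g b p * e p x)" "\<forall>p\<in>P. \<forall>q\<in>P. e p q = (if p = q then 1 else 0)"
      by (elim exE conjE) (rule that)
    let ?V = "fun_span (insert b G) g"
    have V: "lin_subspace ?V" by (rule lin_subspace_fun_span)
    have "fun_span G g \<subseteq> ?V"
      using insert.hyps by (intro fun_span_subset[OF V] fun_span_base) auto
    then have eV: "e p \<in> ?V" if "p \<in> P" for p using P(2) that by blast
    define h where "h = (\<lambda>x. g b x - (\<Sum>p\<in>P. g b p * e p x))"
    have "(\<lambda>x. g b x + (-1) * (\<Sum>p\<in>P. g b p * e p x)) \<in> ?V"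
      using insert.hyps eV
      by (intro lin_subspace_add[OF V] lin_subspace_scale[OF V] lin_subspace_sum[OF V] fun_span_base) auto
    then have hV: "h \<in> ?V" by (simp add: h_def)
    have hP: "h q = 0" if "q \<in> P" for q
    proof -
      have "(\<Sum>p\<in>P. g b p * e p q) = (\<Sum>p\<in>P. if p = q then g b q else 0)"
        using P(4) that by (intro sum.cong) auto
      then show ?thesis using P(1) that by (simp add: h_def)
    qed
    show ?case
    proof (cases "\<forall>x. h x = 0")
      case True
      then have "g b x - (\<Sum>p\<in>P. g b p * e p x) = 0" for x unfolding h_def by blast
      then have gb: "g b x = (\<Sum>p\<in>P. g b p * e p x)" for x by (rule eq_iff_diff_eq_0[THEN iffD2])
      have "\<forall>c\<in>insert b G. \<forall>x. g c x = (\<Sum>p\<in>P. g c p * e p x)"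
        using P(3) gb by (intro ballI allI, elim insertE) blast+
      moreover have "\<forall>p\<in>P. e p \<in> ?V" using eV by blast
      ultimately show ?thesis by (intro exI[of _ P] exI[of _ e] conjI P(1) P(4))
    next
      case False
      then obtain r where r: "h r \<noteq> 0" by blast
      then have rP: "r \<notin> P" using hP by blast
      define k where "k = (\<lambda>x. inverse (h r) * h x)"
      \<comment> \<open>\<open>k\<close> is 1 at \<open>r\<close> and 0 on \<open>P\<close>;
        subtracting a multiple of it makes each old \<open>e p\<close> vanish at
        \<open>r\<close>.\<close>
      define e' where "e' = (\<lambda>p. if p = r then k else (\<lambda>x. e p x + (- e p r) * k x))"
      have kV: "k \<in> ?V" unfolding k_def by (rule lin_subspace_scale[OF V hV])
      have kr: "k r = 1" using r by (simp add: k_def)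
      have kP: "k q = 0" if "q \<in> P" for q using hP[OF that] by (simp add: k_def)
      have e'P: "e' p = (\<lambda>x. e p x + (- e p r) * k x)" if "p \<in> P" for p
        using that rP by (auto simp: e'_def)
      have sum_e': "(\<Sum>p\<in>insert r P. f p * e' p x) = f r * k x + ((\<Sum>p\<in>P. f p * e p x) - (\<Sum>p\<in>P. f p * e p r) * k x)" for f x
      proof -
        have "(\<Sum>p\<in>insert r P. f p * e' p x) = f r * k x + (\<Sum>p\<in>P. f p * e' p x)"
          using P(1) rP by (simp add: e'_def)
        also have "(\<Sum>p\<in>P. f p * e' p x) = (\<Sum>p\<in>P. f p * e p x - f p * e p r * k x)"
          by (intro sum.cong refl) (simp add: e'P algebra_simps)
        finally show ?thesis by (simp add: sum_subtractf sum_distrib_right)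
      qed
      have "\<forall>c\<in>insert b G. \<forall>x. g c x = (\<Sum>p\<in>insert r P. g c p * e' p x)"
      proof (intro ballI allI)
        fix c x assume "c \<in> insert b G"
        then consider "c = b" | "c \<in> G" by blast
        then show "g c x = (\<Sum>p\<in>insert r P. g c p * e' p x)"
        proof cases
          case 1
          have "g b x = h x + (\<Sum>p\<in>P. g b p * e p x)" for x by (simp add: h_def)
          moreover have "h x = h r * k x" using r by (simp add: k_def)
          ultimately show ?thesis unfolding sum_e' 1 by (simp add: h_def algebra_simps)
        next
          case 2
          then have "(\<Sum>p\<in>P. g c p * e p x) = g c x" "(\<Sum>p\<in>P. g c p * e p r) = g c r" using P(3) by simp_all
          then show ?thesis unfolding sum_e' by simp
        qed
      qed
      moreover have "\<forall>p\<in>insert r P. e' p \<in> ?V"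
      proof
        fix p assume "p \<in> insert r P"
        then consider "p = r" | "p \<in> P" by blast
        then show "e' p \<in> ?V"
        proof cases
          case 1
          then show ?thesis using kV by (simp add: e'_def)
        next
          case 2
          then show ?thesis unfolding e'P[OF 2]
            by (intro lin_subspace_add[OF V] lin_subspace_scale[OF V] eV kV)
        qed
      qed
      moreover have "\<forall>p\<in>insert r P. \<forall>q\<in>insert r P. e' p q = (if p = q then 1 else 0)"
        using P(4) kr kP rP by (auto simp: e'_def)
      moreover have "finite (insert r P)" using P(1) by simp
      ultimately show ?thesis by (intro exI[of _ "insert r P"] exI[of _ e'] conjI)
    qed
  qed
  then obtain P e where P: "finite P" "\<forall>p\<in>P. e p \<in> fun_span G g"
      "\<forall>b\<in>G. \<forall>x. g b x = (\<Sum>p\<in>P. g b p * e p x)" by (elim exE conjE) (rule that, assumption+)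
  have "f = (\<lambda>x. \<Sum>p\<in>P. f p * e p x)" if "f \<in> fun_span G g" for f
  proof
    fix x
    from that obtain c where c: "f = (\<lambda>x. \<Sum>b\<in>G. c b * g b x)" unfolding fun_span_def by blast
    have "f x = (\<Sum>b\<in>G. c b * (\<Sum>p\<in>P. g b p * e p x))"
      unfolding c by (intro sum.cong refl arg_cong2[of _ _ _ _ "(*)"]) (use P(3) in blast)
    also have "\<dots> = (\<Sum>b\<in>G. \<Sum>p\<in>P. c b * g b p * e p x)" by (simp add: sum_distrib_left mult.assoc)
    also have "\<dots> = (\<Sum>p\<in>P. f p * e p x)" unfolding c by (subst sum.swap) (simp add: sum_distrib_right)
    finally show "f x = (\<Sum>p\<in>P. f p * e p x)" .
  qed
  then have "\<forall>f\<in>fun_span G g. f = (\<lambda>x. \<Sum>p\<in>P. f p * e p x)" by blast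
  then show ?thesis unfolding eval_frame_def by (intro exI[of _ P] exI[of _ e] conjI P(1,2))
qed

lemma dual_eval_frame:
  assumes V: "lin_subspace V" and e: "eval_frame V P e" and l: "l \<in> dual V" and f: "f \<in> V"
  shows "l f = (\<Sum>p\<in>P. f p * l (e p))"
proof -
  have "l f = l (\<lambda>x. \<Sum>p\<in>P. f p * e p x)" using e f unfolding eval_frame_def by metis
  also have "\<dots> = (\<Sum>p\<in>P. f p * l (e p))"
    using e dual_sum[OF V l, of P e] unfolding eval_frame_def by blast
  finally show ?thesis .
qed

lemma lin_subspace_coord_space: "lin_subspace (coord_space I)"
  by (auto simp: lin_subspace_def coord_space_def)

lemma unit_vec_in_coord_space: "i \<in> I \<Longrightarrow> unit_vec i \<in> coord_space I"
  by (auto simp: coord_space_def unit_vec_def)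

lemma coord_space_expand:
  assumes "finite I" "v \<in> coord_space I"
  shows "v = (\<lambda>j. \<Sum>i\<in>I. v i * unit_vec i j)"
proof
  fix j
  have "(\<Sum>i\<in>I. v i * unit_vec i j) = (\<Sum>i\<in>I. if i = j then v j else 0)"
    by (intro sum.cong) (auto simp: unit_vec_def)
  then show "v j = (\<Sum>i\<in>I. v i * unit_vec i j)"
    using assms by (auto simp: coord_space_def)
qed

lemma dual_coord_space:
  assumes "finite I" "l \<in> dual (coord_space I)" "v \<in> coord_space I"
  shows "l v = (\<Sum>i\<in>I. v i * l (unit_vec i))"
proof -
  have "l v = l (\<lambda>j. \<Sum>i\<in>I. v i * unit_vec i j)" using coord_space_expand[OF assms(1,3)] by simp
  also have "\<dots> = (\<Sum>i\<in>I. v i * l (unit_vec i))"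
    using assms unit_vec_in_coord_space by (intro dual_sum[OF lin_subspace_coord_space]) auto
  finally show ?thesis .
qed

lemma eval_frame_dual_coord_space:
  assumes I: "finite I"
  shows "\<exists>e. eval_frame (dual (coord_space I)) (unit_vec ` I) e"
proof -
  let ?V = "coord_space I"
  \<comment> \<open>The sum recovers the index from its unit vector, so that
    \<open>e (unit_vec i)\<close> is the coordinate function of \<open>i\<close>.\<close>
  define e where "e = (\<lambda>p. ext0 ?V (\<lambda>X. \<Sum>i\<in>I. if p = unit_vec i then X i else 0))"
  have inj: "unit_vec i = unit_vec j \<longleftrightarrow> i = j" for i j :: 'a
    by (metis unit_vec_def zero_neq_one)
  have eu: "e (unit_vec i) = ext0 ?V (\<lambda>X. X i)" if "i \<in> I" for i
    using that I by (auto simp: e_def inj)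
  have "\<forall>p\<in>unit_vec ` I. e p \<in> dual ?V"
    using eu evaluation_in_dual[OF lin_subspace_coord_space, of I] by auto
  moreover have "l = (\<lambda>x. \<Sum>p\<in>unit_vec ` I. l p * e p x)" if l: "l \<in> dual ?V" for l
  proof
    fix X
    show "l X = (\<Sum>p\<in>unit_vec ` I. l p * e p X)"
    proof (cases "X \<in> ?V")
      case True
      have "(\<Sum>p\<in>unit_vec ` I. l p * e p X) = (\<Sum>i\<in>I. l (unit_vec i) * e (unit_vec i) X)"
        by (subst sum.reindex) (auto simp: inj_on_def inj)
      also have "\<dots> = (\<Sum>i\<in>I. X i * l (unit_vec i))"
        using True by (intro sum.cong) (auto simp: eu)
      finally show ?thesis using dual_coord_space[OF I l True] by simp
    next
      case False
      then have "e p X = 0" for p by (simp add: e_def)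
      then show ?thesis using False dual_outside[OF lin_subspace_coord_space l] by simp
    qed
  qed
  ultimately show ?thesis using I unfolding eval_frame_def by (intro exI[of _ e]) auto
qed

section \<open>Polynomial expressions\<close>

lemma fun_alg_restrict:
  assumes "Y \<subseteq> X" "f \<in> fun_alg X F" shows "ext0 Y f \<in> fun_alg Y F"
  using assms(2)
proof (induction rule: fun_alg.induct)
  case (const c)
  then show ?case using fun_alg.const[of Y c F] by (simp add: ext0_ext0[OF assms(1)])
next
  case (gen f)
  then show ?case using fun_alg.gen[of f F Y] by (simp add: ext0_ext0[OF assms(1)])
next
  case (add f g)
  have "ext0 Y (\<lambda>x. f x + g x) = (\<lambda>x. ext0 Y f x + ext0 Y g x)" by (rule ext) (simp add: ext0_def)
  then show ?case using fun_alg.add[OF add.IH] by simp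
next
  case (mult f g)
  have "ext0 Y (\<lambda>x. f x * g x) = (\<lambda>x. ext0 Y f x * ext0 Y g x)" by (rule ext) (simp add: ext0_def)
  then show ?case using fun_alg.mult[OF mult.IH] by simp
qed

lemma fun_alg_extend:
  assumes "Y \<subseteq> X" "g \<in> fun_alg Y F" shows "\<exists>f\<in>fun_alg X F. g = ext0 Y f"
  using assms(2)
proof (induction rule: fun_alg.induct)
  case (const c)
  then show ?case
    by (intro bexI[of _ "ext0 X (\<lambda>_. c)"] fun_alg.const) (simp add: ext0_ext0[OF assms(1)])
next
  case (gen f)
  then show ?case
    by (intro bexI[of _ "ext0 X f"] fun_alg.gen) (simp_all add: ext0_ext0[OF assms(1)])
next
  case (add f g)
  then obtain f' g' where *: "f' \<in> fun_alg X F" "g' \<in> fun_alg X F" "f = ext0 Y f'" "g = ext0 Y g'" by blast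
  have "(\<lambda>x. f x + g x) = ext0 Y (\<lambda>x. f' x + g' x)" unfolding * by (rule ext) (simp add: ext0_def)
  then show ?case using fun_alg.add[OF *(1,2)] by blast
next
  case (mult f g)
  then obtain f' g' where *: "f' \<in> fun_alg X F" "g' \<in> fun_alg X F" "f = ext0 Y f'" "g = ext0 Y g'" by blast
  have "(\<lambda>x. f x * g x) = ext0 Y (\<lambda>x. f' x * g' x)" unfolding * by (rule ext) (simp add: ext0_def)
  then show ?case using fun_alg.mult[OF *(1,2)] by blast
qed

text \<open>A polynomial as a list of coefficients with lists of variables. Representations are not
  unique, but only values matter, and the length of a list of variables is the degree of its
  term.\<close>

definition poly_expr :: "('p \<Rightarrow> 'x \<Rightarrow> complex) \<Rightarrow> (complex \<times> 'p list) list \<Rightarrow> 'x \<Rightarrow> complex" where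
  "poly_expr g ts x = (\<Sum>t\<leftarrow>ts. fst t * (\<Prod>p\<leftarrow>snd t. g p x))"

definition expr_over :: "'p set \<Rightarrow> (complex \<times> 'p list) list \<Rightarrow> bool" where
  "expr_over P ts \<longleftrightarrow> (\<forall>t\<in>set ts. set (snd t) \<subseteq> P)"

lemma poly_expr_append: "poly_expr g (ts @ us) x = poly_expr g ts x + poly_expr g us x"
  by (simp add: poly_expr_def)

definition expr_times :: "(complex \<times> 'p list) list \<Rightarrow> (complex \<times> 'p list) list \<Rightarrow> (complex \<times> 'p list) list" where
  "expr_times ts us = concat (map (\<lambda>t. map (\<lambda>u. (fst t * fst u, snd t @ snd u)) us) ts)"

lemma poly_expr_times: "poly_expr g (expr_times ts us) x = poly_expr g ts x * poly_expr g us x"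
proof (induction ts)
  case Nil
  then show ?case by (simp add: poly_expr_def expr_times_def)
next
  case (Cons t ts)
  have "poly_expr g (map (\<lambda>u. (fst t * fst u, snd t @ snd u)) us) x =
      fst t * (\<Prod>p\<leftarrow>snd t. g p x) * poly_expr g us x"
    by (induction us) (simp_all add: poly_expr_def algebra_simps)
  moreover have "expr_times (t # ts) us = map (\<lambda>u. (fst t * fst u, snd t @ snd u)) us @ expr_times ts us"
    by (simp add: expr_times_def)
  moreover have "poly_expr g (t # ts) x = fst t * (\<Prod>p\<leftarrow>snd t. g p x) + poly_expr g ts x"
    by (simp add: poly_expr_def)
  ultimately show ?case using Cons by (simp add: poly_expr_append algebra_simps)
qed

lemma expr_over_times: "expr_over P ts \<Longrightarrow> expr_over P us \<Longrightarrow> expr_over P (expr_times ts us)"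
  by (fastforce simp: expr_over_def expr_times_def)

lemma fun_alg_poly_expr:
  assumes F: "\<And>f. f \<in> F \<Longrightarrow> \<exists>ts. expr_over P ts \<and> (\<forall>x\<in>X. f x = poly_expr g ts x)"
    and f: "f \<in> fun_alg X F"
  shows "\<exists>ts. expr_over P ts \<and> (\<forall>x\<in>X. f x = poly_expr g ts x)"
  using f
proof (induction rule: fun_alg.induct)
  case (const c)
  then show ?case by (intro exI[of _ "[(c, [])]"]) (simp add: expr_over_def poly_expr_def)
next
  case (gen f)
  then obtain ts where "expr_over P ts" "\<forall>x\<in>X. f x = poly_expr g ts x" using F by blast
  then show ?case by (intro exI[of _ ts]) simp
next
  case (add f f')
  then obtain ts us where "expr_over P ts" "\<forall>x\<in>X. f x = poly_expr g ts x"
    "expr_over P us" "\<forall>x\<in>X. f' x = poly_expr g us x" by blast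
  then show ?case
    by (intro exI[of _ "ts @ us"]) (auto simp: expr_over_def poly_expr_append)
next
  case (mult f f')
  then obtain ts us where "expr_over P ts" "\<forall>x\<in>X. f x = poly_expr g ts x"
    "expr_over P us" "\<forall>x\<in>X. f' x = poly_expr g us x" by blast
  then show ?case
    by (intro exI[of _ "expr_times ts us"]) (auto simp: expr_over_times poly_expr_times)
qed

lemma linear_poly_expr:
  assumes "finite P"
  shows "\<exists>ts. expr_over P ts \<and> (\<forall>x. poly_expr g ts x = (\<Sum>p\<in>P. c p * g p x))"
proof -
  obtain ps where ps: "set ps = P" "distinct ps" using finite_distinct_list[OF assms] by blast
  show ?thesis
  proof (intro exI[of _ "map (\<lambda>p. (c p, [p])) ps"] conjI allI)
    show "expr_over P (map (\<lambda>p. (c p, [p])) ps)" using ps by (auto simp: expr_over_def)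
    fix x
    have "poly_expr g (map (\<lambda>p. (c p, [p])) ps) x = (\<Sum>p\<leftarrow>ps. c p * g p x)"
      by (simp add: poly_expr_def comp_def)
    then show "poly_expr g (map (\<lambda>p. (c p, [p])) ps) x = (\<Sum>p\<in>P. c p * g p x)"
      using ps sum_list_distinct_conv_sum_set[of ps] by simp
  qed
qed

lemma fun_alg_dual_poly_expr:
  assumes V: "lin_subspace V" and e: "eval_frame V P e" and X: "X \<subseteq> V" and f: "f \<in> fun_alg X (dual V)"
  shows "\<exists>ts. expr_over P ts \<and> (\<forall>x\<in>X. f x = poly_expr (\<lambda>p v. v p) ts x)"
proof (rule fun_alg_poly_expr[OF _ f])
  fix l assume l: "l \<in> dual V"
  have "finite P" using e by (simp add: eval_frame_def)
  from linear_poly_expr[OF this, of "\<lambda>p v. v p" "\<lambda>p. l (e p)"]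
  obtain ts where ts: "expr_over P ts" "\<forall>v. poly_expr (\<lambda>p v. v p) ts v = (\<Sum>p\<in>P. l (e p) * v p)" by blast
  have "l x = poly_expr (\<lambda>p v. v p) ts x" if "x \<in> X" for x
  proof -
    have "x \<in> V" using that X by blast
    then show ?thesis using dual_eval_frame[OF V e l, of x] ts(2) by (simp add: mult.commute)
  qed
  then show "\<exists>ts. expr_over P ts \<and> (\<forall>x\<in>X. l x = poly_expr (\<lambda>p v. v p) ts x)" using ts by blast
qed

text \<open>Used with \<open>poly_eq_0_punctured\<close> to carry the vanishing of a function to the
  one missing point of a line.\<close>

lemma fun_alg_dual_line:
  assumes V: "lin_subspace V" and f: "f \<in> fun_alg V (dual V)" and v: "v \<in> V" "w \<in> V"
  shows "\<exists>p. \<forall>t. f (\<lambda>i. v i + t * w i) = poly p t"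
  using f
proof (induction rule: fun_alg.induct)
  case (const c)
  have "(\<lambda>i. v i + t * w i) \<in> V" for t using v by (intro lin_subspace_add[OF V] lin_subspace_scale[OF V])
  then show ?case by (intro exI[of _ "[:c:]"]) simp
next
  case (gen l)
  have in_V: "(\<lambda>i. v i + t * w i) \<in> V" for t using v by (intro lin_subspace_add[OF V] lin_subspace_scale[OF V])
  have "l (\<lambda>i. v i + t * w i) = l v + t * l w" for t
    using dual_add[OF V gen v(1) lin_subspace_scale[OF V v(2)]] dual_scale[OF V gen v(2)] by simp
  then show ?case using in_V by (intro exI[of _ "[:l v, l w:]"]) simp
next
  case (add f g)
  then obtain p q where "\<forall>t. f (\<lambda>i. v i + t * w i) = poly p t" "\<forall>t. g (\<lambda>i. v i + t * w i) = poly q t" by blast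
  then show ?case by (intro exI[of _ "p + q"]) simp
next
  case (mult f g)
  then obtain p q where "\<forall>t. f (\<lambda>i. v i + t * w i) = poly p t" "\<forall>t. g (\<lambda>i. v i + t * w i) = poly q t" by blast
  then show ?case by (intro exI[of _ "p * q"]) simp
qed

lemma evaluation_in_fun_alg:
  assumes V: "lin_subspace V" and X: "X \<subseteq> V"
  shows "ext0 X (\<lambda>f. f p) \<in> fun_alg X (dual V)"
  using fun_alg.gen[OF evaluation_in_dual[OF V, of p], of X] by (simp add: ext0_ext0[OF X])

lemma fun_alg_dual_separates:
  assumes V: "lin_subspace V" and X: "X \<subseteq> V" and y: "y \<in> X" "z \<in> X"
    and eq: "\<forall>b\<in>fun_alg X (dual V). b y = b z"
  shows "y = z"
proof
  fix p show "y p = z p"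
    using bspec[OF eq evaluation_in_fun_alg[OF V X, of p]] y by simp
qed

text \<open>The values of the character on the evaluations at the frame points are the coordinates
  of a vector \<open>y\<close>. Every functional is a combination of these evaluations, so the
  character agrees with evaluation at \<open>y\<close> on generators and hence everywhere.\<close>

lemma alg_hom_is_evaluation:
  assumes V: "lin_subspace V" and e: "eval_frame V P e" and \<eta>: "alg_hom V (fun_alg V (dual V)) \<eta>"
  shows "\<exists>y\<in>V. \<forall>b\<in>fun_alg V (dual V). b y = \<eta> b"
proof -
  note A = fun_subalg_fun_alg[of V "dual V"]
  have P: "finite P" "\<And>p. p \<in> P \<Longrightarrow> e p \<in> V" using e by (auto simp: eval_frame_def)
  let ?ev = "\<lambda>p. ext0 V (\<lambda>f. f p)"
  define y where "y = (\<lambda>x. \<Sum>p\<in>P. \<eta> (?ev p) * e p x)"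
  have y: "y \<in> V" unfolding y_def using P by (intro lin_subspace_sum[OF V]) auto
  have lin: "l y = \<eta> (ext0 V l)" if l: "l \<in> dual V" for l
  proof -
    have "ext0 V l = (\<lambda>f. \<Sum>p\<in>P. l (e p) * ?ev p f)"
    proof
      fix f
      show "ext0 V l f = (\<Sum>p\<in>P. l (e p) * ?ev p f)"
        using dual_eval_frame[OF V e l, of f] by (cases "f \<in> V") (simp_all add: mult.commute)
    qed
    then have "\<eta> (ext0 V l) = \<eta> (\<lambda>f. \<Sum>p\<in>P. l (e p) * ?ev p f)" by simp
    also have "\<dots> = (\<Sum>p\<in>P. \<eta> (\<lambda>f. l (e p) * ?ev p f))"
      using P(1) by (intro alg_hom_sum[OF A \<eta>] fun_subalg_scale[OF A] evaluation_in_fun_alg[OF V]) auto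
    also have "\<dots> = (\<Sum>p\<in>P. l (e p) * \<eta> (?ev p))"
      by (intro sum.cong refl alg_hom_scale[OF A \<eta>] evaluation_in_fun_alg[OF V]) auto
    also have "\<dots> = l y"
      unfolding y_def using dual_sum[OF V l P(1), of e "\<lambda>p. \<eta> (?ev p)"] P(2) by (simp add: mult.commute)
    finally show ?thesis by simp
  qed
  have "b y = \<eta> b" if "b \<in> fun_alg V (dual V)" for b
    using that
  proof (induction rule: fun_alg.induct)
    case (const c)
    then show ?case using y alg_hom_const[OF A \<eta>] by simp
  next
    case (gen f)
    then show ?case using y lin by simp
  next
    case (add f g)
    then show ?case using alg_hom_add[OF A \<eta>] by simp
  next
    case (mult f g)
    then show ?case using alg_hom_mult[OF A \<eta>] by simp
  qed
  then show ?thesis using y by blast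
qed

section \<open>Homogeneous polynomials\<close>

lemma sym_power_dualD:
  assumes "q \<in> sym_power_dual k V"
  shows "q \<in> fun_alg V (dual V)" "v \<in> V \<Longrightarrow> q (\<lambda>i. c * v i) = c ^ k * q v" "v \<notin> V \<Longrightarrow> q v = 0"
  using assms fun_alg_outside[of q V "dual V" v] unfolding sym_power_dual_def by auto

lemma lin_subspace_sym_power_dual:
  assumes V: "lin_subspace V" shows "lin_subspace (sym_power_dual k V)"
proof -
  note A = fun_subalg_fun_alg[of V "dual V"]
  show ?thesis
    unfolding lin_subspace_def
    by (auto simp: sym_power_dual_def fun_subalg_zero[OF A] algebra_simps
        intro!: fun_subalg_add[OF A] fun_subalg_scale[OF A])
qed

lemma sym_power_dual_mult:
  assumes "p \<in> sym_power_dual j V" "q \<in> sym_power_dual k V"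
  shows "(\<lambda>X. p X * q X) \<in> sym_power_dual (j + k) V"
  using assms by (auto simp: sym_power_dual_def power_add intro!: fun_alg.mult)

lemma dual_in_sym_power_dual:
  assumes V: "lin_subspace V" and l: "l \<in> dual V" shows "l \<in> sym_power_dual 1 V"
proof -
  have "ext0 V l = l" using dual_outside[OF V l] by (intro ext) (simp add: ext0_def)
  then show ?thesis
    using fun_alg.gen[OF l, of V] dual_scale[OF V l] by (simp add: sym_power_dual_def)
qed

lemma power_dual_mult_in_sym_power_dual:
  assumes V: "lin_subspace V" and l: "l \<in> dual V" and q: "q \<in> sym_power_dual k V"
  shows "(\<lambda>X. l X ^ d * q X) \<in> sym_power_dual (d + k) V"
proof (induction d)
  case 0
  then show ?case using q by simp
next
  case (Suc d)
  show ?case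
    using sym_power_dual_mult[OF dual_in_sym_power_dual[OF V l] Suc] by (simp add: mult.assoc)
qed

context
  fixes I :: "'i set" and V
  assumes I: "finite I"
  defines "V \<equiv> coord_space I"
begin

lemma monomial_in_sym_power_dual:
  assumes "set xs \<subseteq> I"
  shows "ext0 V (\<lambda>X. \<Prod>i\<leftarrow>xs. X i) \<in> sym_power_dual (length xs) V"
proof -
  have V: "lin_subspace V" unfolding V_def by (rule lin_subspace_coord_space)
  have "ext0 V (\<lambda>X. \<Prod>i\<leftarrow>xs. X i) \<in> fun_alg V (dual V)"
    by (rule fun_subalg_prod_list[OF fun_subalg_fun_alg, where ps = xs and g = "\<lambda>i X. X i"])
      (rule evaluation_in_fun_alg[OF V order_refl])
  moreover have "(\<Prod>i\<leftarrow>xs. c * X i) = c ^ length xs * (\<Prod>i\<leftarrow>xs. X i)" for c :: complex and X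
    by (induction xs) simp_all
  ultimately show ?thesis
    using lin_subspace_scale[OF V] by (simp add: sym_power_dual_def)
qed

text \<open>Homogeneity turns q(zX) into z^k q(X); comparing powers of z shows that the terms of
  degree other than \<open>k\<close> can be discarded.\<close>

lemma sym_power_dual_expand:
  assumes q: "q \<in> sym_power_dual k V"
  shows "\<exists>ts. (\<forall>t\<in>set ts. set (snd t) \<subseteq> I \<and> length (snd t) = k) \<and>
    (\<forall>X\<in>V. q X = poly_expr (\<lambda>i X. X i) ts X)"
proof -
  have V: "lin_subspace V" unfolding V_def by (rule lin_subspace_coord_space)
  have "\<exists>ts. expr_over I ts \<and> (\<forall>x\<in>V. q x = poly_expr (\<lambda>i X. X i) ts x)"
  proof (rule fun_alg_poly_expr[OF _ sym_power_dualD(1)[OF q]])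
    fix l assume l: "l \<in> dual V"
    from linear_poly_expr[OF I, of "\<lambda>i X. X i" "\<lambda>i. l (unit_vec i)"]
    obtain ts where ts: "expr_over I ts" "\<forall>x. poly_expr (\<lambda>i X. X i) ts x = (\<Sum>i\<in>I. l (unit_vec i) * x i)" by blast
    have "l x = poly_expr (\<lambda>i X. X i) ts x" if "x \<in> V" for x
      using dual_coord_space[OF I, of l x] l that ts(2) by (simp add: V_def mult.commute)
    then show "\<exists>ts. expr_over I ts \<and> (\<forall>x\<in>V. l x = poly_expr (\<lambda>i X. X i) ts x)" using ts by blast
  qed
  then obtain ts where ts: "expr_over I ts" "\<forall>x\<in>V. q x = poly_expr (\<lambda>i X. X i) ts x" by blast
  define us where "us = filter (\<lambda>t. length (snd t) = k) ts"
  have "q X = poly_expr (\<lambda>i X. X i) us X" if X: "X \<in> V" for X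
  proof -
    have "(\<Sum>t\<leftarrow>ts. (fst t * (\<Prod>i\<leftarrow>snd t. X i)) * z ^ length (snd t)) = q X * z ^ k" for z
    proof -
      have "q X * z ^ k = q (\<lambda>i. z * X i)" using sym_power_dualD(2)[OF q X] by simp
      also have "\<dots> = (\<Sum>t\<leftarrow>ts. fst t * (\<Prod>i\<leftarrow>snd t. z * X i))"
        using ts(2) lin_subspace_scale[OF V X] by (simp add: poly_expr_def)
      finally have eq: "q X * z ^ k = (\<Sum>t\<leftarrow>ts. fst t * (\<Prod>i\<leftarrow>snd t. z * X i))" .
      have "(\<Prod>i\<leftarrow>xs. z * X i) = z ^ length xs * (\<Prod>i\<leftarrow>xs. X i)" for xs
        by (induction xs) simp_all
      then show ?thesis unfolding eq by (simp add: mult_ac)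
    qed
    from compare_powers[OF this] show ?thesis by (simp add: us_def poly_expr_def)
  qed
  moreover have "\<forall>t\<in>set us. set (snd t) \<subseteq> I \<and> length (snd t) = k"
    using ts(1) by (auto simp: us_def expr_over_def)
  ultimately show ?thesis by blast
qed

lemma eval_frame_sym_power_dual: "\<exists>P e. eval_frame (sym_power_dual k V) P e"
proof -
  have V: "lin_subspace V" unfolding V_def by (rule lin_subspace_coord_space)
  define G where "G = {xs. set xs \<subseteq> I \<and> length xs = k}"
  define g where "g = (\<lambda>xs. ext0 V (\<lambda>X. \<Prod>i\<leftarrow>xs. X i))"
  have G: "finite G" unfolding G_def using I by (rule finite_lists_length_eq)
  note S = lin_subspace_fun_span[of G g]
  have "sym_power_dual k V = fun_span G g"
  proof
    show "fun_span G g \<subseteq> sym_power_dual k V"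
      using monomial_in_sym_power_dual
      by (intro fun_span_subset lin_subspace_sym_power_dual V) (auto simp: G_def g_def)
    show "sym_power_dual k V \<subseteq> fun_span G g"
    proof
      fix q assume q: "q \<in> sym_power_dual k V"
      obtain ts where ts: "\<forall>t\<in>set ts. set (snd t) \<subseteq> I \<and> length (snd t) = k"
        "\<forall>X\<in>V. q X = poly_expr (\<lambda>i X. X i) ts X" using sym_power_dual_expand[OF q] by blast
      have "(\<lambda>X. \<Sum>t\<leftarrow>ts. fst t * g (snd t) X) \<in> fun_span G g"
        using ts(1)
      proof (induction ts)
        case Nil
        then show ?case using lin_subspace_zero[OF S] by simp
      next
        case (Cons t ts)
        then have "g (snd t) \<in> fun_span G g" by (intro fun_span_base[OF G]) (auto simp: G_def)
        then have "(\<lambda>X. fst t * g (snd t) X + (\<Sum>t\<leftarrow>ts. fst t * g (snd t) X)) \<in> fun_span G g"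
          using Cons by (intro lin_subspace_add[OF S] lin_subspace_scale[OF S]) auto
        then show ?case by simp
      qed
      moreover have "q = (\<lambda>X. \<Sum>t\<leftarrow>ts. fst t * g (snd t) X)"
      proof
        fix X show "q X = (\<Sum>t\<leftarrow>ts. fst t * g (snd t) X)"
        proof (cases "X \<in> V")
          case False
          then have "(\<Sum>t\<leftarrow>ts. fst t * g (snd t) X) = 0" by (induction ts) (simp_all add: g_def)
          then show ?thesis using sym_power_dualD(3)[OF q False] by simp
        qed (use ts(2) in \<open>simp add: poly_expr_def g_def\<close>)
      qed
      ultimately show "q \<in> fun_span G g" by simp
    qed
  qed
  then show ?thesis using eval_frame_fun_span[OF G, of g] by simp
qed

text \<open>The bound on the degree is what \<open>dedekind_mertens\<close> asks of
  \<open>G\<close>.\<close>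

lemma sym_power_dual_line:
  assumes q: "q \<in> sym_power_dual k V" and XY: "X \<in> V" "Y \<in> V"
  shows "\<exists>p. degree p \<le> k \<and> (\<forall>t. q (\<lambda>i. Y i + t * X i) = poly p t)"
proof -
  have V: "lin_subspace V" unfolding V_def by (rule lin_subspace_coord_space)
  obtain ts where ts: "\<forall>t\<in>set ts. set (snd t) \<subseteq> I \<and> length (snd t) = k"
    "\<forall>X\<in>V. q X = poly_expr (\<lambda>i X. X i) ts X" using sym_power_dual_expand[OF q] by blast
  have line: "\<exists>p. degree p \<le> length xs \<and> (\<forall>t. (\<Prod>i\<leftarrow>xs. Y i + t * X i) = poly p t)" for xs
  proof (induction xs)
    case Nil
    then show ?case by (intro exI[of _ 1]) simp
  next
    case (Cons i xs)
    then obtain p where p: "degree p \<le> length xs" "\<forall>t. (\<Prod>i\<leftarrow>xs. Y i + t * X i) = poly p t" by blast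
    have "degree ([:Y i, X i:] * p) \<le> Suc (length xs)"
      using degree_mult_le[of "[:Y i, X i:]" p] p(1) by (simp split: if_splits)
    then show ?case using p(2) by (intro exI[of _ "[:Y i, X i:] * p"]) (simp add: distrib_right)
  qed
  have "\<exists>p. degree p \<le> k \<and> (\<forall>t. poly_expr (\<lambda>i X. X i) ts (\<lambda>i. Y i + t * X i) = poly p t)"
    using ts(1)
  proof (induction ts)
    case Nil
    then show ?case by (intro exI[of _ 0]) (simp add: poly_expr_def)
  next
    case (Cons u ts)
    then obtain p where p: "degree p \<le> k"
      "\<forall>t. poly_expr (\<lambda>i X. X i) ts (\<lambda>i. Y i + t * X i) = poly p t" by auto
    obtain p' where p': "degree p' \<le> k" "\<forall>t. (\<Prod>i\<leftarrow>snd u. Y i + t * X i) = poly p' t"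
      using line[of "snd u"] Cons.prems by auto
    have "degree (smult (fst u) p' + p) \<le> k"
      using p p' by (intro degree_add_le order_trans[OF degree_smult_le])
    then show ?case using p(2) p'(2)
      by (intro exI[of _ "smult (fst u) p' + p"]) (simp add: poly_expr_def)
  qed
  moreover have "(\<lambda>i. Y i + t * X i) \<in> V" for t
    using XY by (intro lin_subspace_add[OF V] lin_subspace_scale[OF V])
  ultimately show ?thesis using ts(2) by simp
qed

end

declare One_nat_def [simp del]

section \<open>Linear automorphisms\<close>

definition lin_map_on :: "('i \<Rightarrow> complex) set \<Rightarrow> (('i \<Rightarrow> complex) \<Rightarrow> 'i \<Rightarrow> complex) \<Rightarrow> bool" where
  "lin_map_on V k \<longleftrightarrow> (\<forall>v\<in>V. k v \<in> V) \<and> (\<forall>v\<in>V. \<forall>w\<in>V. k (\<lambda>i. v i + w i) = (\<lambda>i. k v i + k w i)) \<and>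
     (\<forall>c. \<forall>v\<in>V. k (\<lambda>i. c * v i) = (\<lambda>i. c * k v i))"

text \<open>An automorphism as a pair of mutually inverse maps that are constrained on
  \<open>V\<close> only. Explicit constructions then need neither \<open>restrict\<close> nor
  \<open>inv_into\<close>; \<open>GL_lin_inverses\<close> and \<open>lin_inverses_GL\<close>
  translate between the two views.\<close>

definition lin_inverses_on ::
    "('i \<Rightarrow> complex) set \<Rightarrow> (('i \<Rightarrow> complex) \<Rightarrow> 'i \<Rightarrow> complex) \<Rightarrow> (('i \<Rightarrow> complex) \<Rightarrow> 'i \<Rightarrow> complex) \<Rightarrow> bool" where
  "lin_inverses_on V k k' \<longleftrightarrow> lin_map_on V k \<and> lin_map_on V k' \<and> (\<forall>v\<in>V. k' (k v) = v) \<and> (\<forall>v\<in>V. k (k' v) = v)"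

lemma lin_map_onD:
  assumes "lin_map_on V k" "v \<in> V"
  shows "k v \<in> V" "w \<in> V \<Longrightarrow> k (\<lambda>i. v i + w i) = (\<lambda>i. k v i + k w i)" "k (\<lambda>i. c * v i) = (\<lambda>i. c * k v i)"
  using assms unfolding lin_map_on_def by blast+

lemma lin_inverses_onD:
  assumes "lin_inverses_on V k k'"
  shows "lin_map_on V k" "lin_map_on V k'" "v \<in> V \<Longrightarrow> k' (k v) = v" "v \<in> V \<Longrightarrow> k (k' v) = v"
  using assms unfolding lin_inverses_on_def by blast+

lemma GL_lin_inverses:
  assumes V: "lin_subspace V" and g: "g \<in> GL V"
  shows "lin_inverses_on V g (inv_into V g)"
proof -
  let ?k = "inv_into V g"
  have bij: "bij_betw g V V" and
    add: "\<And>v w. v \<in> V \<Longrightarrow> w \<in> V \<Longrightarrow> g (\<lambda>i. v i + w i) = (\<lambda>i. g v i + g w i)" and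
    scale: "\<And>c v. v \<in> V \<Longrightarrow> g (\<lambda>i. c * v i) = (\<lambda>i. c * g v i)"
    using g unfolding GL_def by blast+
  have gV: "g v \<in> V" if "v \<in> V" for v using bij_betwE[OF bij] that by blast
  have kV: "?k v \<in> V" if "v \<in> V" for v using bij_betwE[OF bij_betw_inv_into[OF bij]] that by blast
  have kg: "?k (g v) = v" if "v \<in> V" for v using bij_betw_inv_into_left[OF bij that] .
  have gk: "g (?k v) = v" if "v \<in> V" for v using bij_betw_inv_into_right[OF bij that] .
  have lin_g: "lin_map_on V g" unfolding lin_map_on_def using gV add scale by blast
  have "?k (\<lambda>i. v i + w i) = (\<lambda>i. ?k v i + ?k w i)" if "v \<in> V" "w \<in> V" for v w
    using kg[OF lin_subspace_add[OF V kV kV], of v w] add[OF kV kV, of v w] gk that by simp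
  moreover have "?k (\<lambda>i. c * v i) = (\<lambda>i. c * ?k v i)" if "v \<in> V" for v c
    using kg[OF lin_subspace_scale[OF V kV], of v c] scale[OF kV, of v c] gk that by simp
  ultimately have "lin_map_on V ?k" unfolding lin_map_on_def using kV by blast
  then show ?thesis unfolding lin_inverses_on_def using lin_g kg gk by blast
qed

lemma lin_inverses_GL:
  assumes V: "lin_subspace V" and k: "lin_inverses_on V k k'"
  shows "restrict k V \<in> GL V" "v \<in> V \<Longrightarrow> inv_into V (restrict k V) v = k' v"
proof -
  note D = lin_inverses_onD[OF k]
  have bij: "bij_betw (restrict k V) V V"
    by (rule bij_betwI[of _ _ _ k']) (use D(3,4) lin_map_onD(1)[OF D(1)] lin_map_onD(1)[OF D(2)] in auto)
  show "restrict k V \<in> GL V"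
    unfolding GL_def
    using bij lin_map_onD(2,3)[OF D(1)] lin_subspace_add[OF V] lin_subspace_scale[OF V] by simp
  assume v: "v \<in> V"
  then show "inv_into V (restrict k V) v = k' v"
    using bij_betw_inv_into_left[OF bij lin_map_onD(1)[OF D(2) v]] D(4)[OF v] lin_map_onD(1)[OF D(2) v] by simp
qed

lemma image_eq_of_inverses:
  assumes "lin_inverses_on V k k'" "W \<subseteq> V" "\<And>w. w \<in> W \<Longrightarrow> k w \<in> W" "\<And>w. w \<in> W \<Longrightarrow> k' w \<in> W"
  shows "k ` W = W"
proof
  show "k ` W \<subseteq> W" using assms(3) by blast
  show "W \<subseteq> k ` W"
  proof
    fix w assume "w \<in> W"
    then show "w \<in> k ` W" using assms(2,4) lin_inverses_onD(4)[OF assms(1), of w] by (intro image_eqI[of _ _ "k' w"]) auto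
  qed
qed

section \<open>The permanent\<close>

lemma permanent_cong:
  assumes "\<And>i j. i \<in> I \<Longrightarrow> j \<in> I \<Longrightarrow> X (i, j) = Y (i, j)"
  shows "permanent I X = permanent I Y"
  unfolding permanent_def
  by (intro sum.cong prod.cong refl) (use assms permutes_in_image in fastforce)

lemma permanent_scale:
  assumes "finite I" shows "permanent I (\<lambda>p. c * X p) = c ^ card I * permanent I X"
  by (simp add: permanent_def prod.distrib sum_distrib_left)

text \<open>Any permutation other than the identity moves some index and thereby meets a zero
  entry.\<close>

lemma permanent_identity:
  assumes I: "finite I"
  shows "permanent I (\<lambda>p. if fst p = snd p \<and> fst p \<in> I then 1 else 0) = 1"
proof -
  let ?X = "\<lambda>p. if fst p = snd p \<and> fst p \<in> I then 1 else 0 :: complex"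
  have z: "(\<Prod>i\<in>I. ?X (i, \<pi> i)) = 0" if "\<pi> permutes I" "\<pi> \<noteq> id" for \<pi>
  proof -
    from that(2) obtain i where "\<pi> i \<noteq> i" by (metis eq_id_iff)
    then have "i \<in> I" using that(1) by (meson permutes_not_in)
    then show ?thesis using \<open>\<pi> i \<noteq> i\<close> I by (intro prod_zero bexI[of _ i]) auto
  qed
  have "permanent I ?X = (\<Sum>\<pi>\<in>{id}. \<Prod>i\<in>I. ?X (i, \<pi> i))"
    unfolding permanent_def
    by (intro sum.mono_neutral_right finite_permutations I) (use z permutes_id in auto)
  then show ?thesis by simp
qed

lemma complex_nth_root:
  fixes c :: complex
  assumes "n > 0" "c \<noteq> 0"
  shows "\<exists>z. z \<noteq> 0 \<and> z ^ n = c"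
proof -
  have "exp (Ln c / of_nat n) ^ n = exp (of_nat n * (Ln c / of_nat n))"
    by (simp add: exp_of_nat_mult[symmetric])
  also have "\<dots> = c" using assms by simp
  finally show ?thesis by (intro exI[of _ "exp (Ln c / of_nat n)"]) simp
qed

section \<open>The orbits of the permanent and of the padded permanent\<close>

lemma ext0_add: "ext0 I (\<lambda>i. v i + w i) = (\<lambda>i. ext0 I v i + ext0 I w i)"
  and ext0_scale: "ext0 I (\<lambda>i. c * v i) = (\<lambda>i. c * ext0 I v i)"
  by (auto simp: ext0_def)

lemma ext0_coord_space: "ext0 I v \<in> coord_space I"
  by (simp add: coord_space_def)

lemma ext0_id: "v \<in> coord_space I \<Longrightarrow> ext0 I v = v"
  by (auto simp: ext0_def coord_space_def)

lemma coord_space_mono: "I \<subseteq> J \<Longrightarrow> coord_space I \<subseteq> coord_space J"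
  by (auto simp: coord_space_def)

locale permanent_spaces =
  fixes m n :: nat
  assumes n_pos: "0 < n" and nm: "n < m"
begin

abbreviation "E \<equiv> spaceE m"
abbreviation "S \<equiv> spaceS m n"
abbreviation "S1 \<equiv> spaceS1 m n"
abbreviation "d \<equiv> m - n"
abbreviation "J \<equiv> {m - n + 1..m}"
abbreviation "pr1 \<equiv> ext0 (idxS1 m n)"
abbreviation "prS \<equiv> ext0 (idxS m n)"
abbreviation "e11 \<equiv> unit_vec (1::nat, 1::nat)"

lemma d_pos: "d > 0" and dn: "d + n = m" using nm by auto

lemma finite_idx: "finite (idxE m)" "finite (idxS m n)" "finite (idxS1 m n)"
  by (auto simp: idxE_def idxS_def idxS1_def)

lemma idx11: "(1, 1) \<notin> idxS1 m n" using nm by (auto simp: idxS1_def)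

lemma idx_subset: "idxS1 m n \<subseteq> idxS m n" "idxS m n \<subseteq> idxE m" "idxS1 m n \<subseteq> idxE m" "(1, 1) \<in> idxE m" "(1, 1) \<in> idxS m n"
  using nm by (auto simp: idxS_def idxS1_def idxE_def)

lemma subspaces: "lin_subspace E" "lin_subspace S" "lin_subspace S1"
  by (simp_all add: spaceE_def spaceS_def spaceS1_def lin_subspace_coord_space)

lemma space_subset: "S1 \<subseteq> S" "S \<subseteq> E" "S1 \<subseteq> E"
  unfolding spaceE_def spaceS_def spaceS1_def using idx_subset by (auto intro!: coord_space_mono)

lemma pr1_in: "pr1 X \<in> S1" and prS_in: "prS X \<in> S"
  by (simp_all add: spaceS1_def spaceS_def ext0_coord_space)

lemma pr1_id: "X \<in> S1 \<Longrightarrow> pr1 X = X" and prS_id: "X \<in> S \<Longrightarrow> prS X = X"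
  by (simp_all add: spaceS1_def spaceS_def ext0_id)

lemma e11_in: "e11 \<in> S" "e11 \<in> E"
  by (simp_all add: spaceS_def spaceE_def unit_vec_in_coord_space idx_subset)

lemma pr1_e11: "pr1 e11 = (\<lambda>_. 0)" using idx11 by (auto simp: ext0_def unit_vec_def)

lemma line11_eq: "v \<in> line11 \<longleftrightarrow> v = (\<lambda>i. v (1, 1) * e11 i)"
  by (auto simp: line11_def coord_space_def unit_vec_def fun_eq_iff)

lemma prS_decomp: "prS X = (\<lambda>i. X (1, 1) * e11 i + pr1 X i)"
  using idx11 by (auto simp: ext0_def unit_vec_def idxS_def fun_eq_iff)

lemma permanent_pr1: "permanent J (pr1 X) = permanent J X"
  by (rule permanent_cong) (simp add: idxS1_def)

text \<open>A group element fixes the coordinates outside the \<open>S1\<close> block, and the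
  permanent sees only that block, so the orbit is described by automorphisms of \<open>S1\<close>
  alone. Since the action on forms substitutes the inverse, \<open>k\<close> is the inverse of the
  group element.\<close>

lemma Zo_iff:
  "f \<in> Zo m n \<longleftrightarrow> (\<exists>k k'. lin_inverses_on S1 k k' \<and> f = ext0 E (\<lambda>X. permanent J (k (pr1 X))))"
proof
  let ?C = "coord_space (idxE m - idxS1 m n)"
  assume "f \<in> Zo m n"
  then obtain g where g: "g \<in> GL E" "g ` S1 = S1" "\<forall>w\<in>?C. g w = w"
    and f: "f = act_poly E g (perm_form m n)"
    unfolding Zo_def GLS1_def GL_summand_def by blast
  let ?k = "inv_into E g"
  note inv = GL_lin_inverses[OF subspaces(1) g(1)]
  note D = lin_inverses_onD[OF inv]
  have gS1: "g v \<in> S1" if "v \<in> S1" for v using g(2) that by blast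
  have kS1: "?k v \<in> S1" if v: "v \<in> S1" for v
  proof -
    obtain w where "w \<in> S1" "v = g w" using g(2) v by blast
    then show ?thesis using D(3)[of w] space_subset by auto
  qed
  have inv1: "lin_inverses_on S1 ?k g"
    unfolding lin_inverses_on_def lin_map_on_def
    using kS1 gS1 D(3,4) lin_map_onD(2,3)[OF D(1)] lin_map_onD(2,3)[OF D(2)] space_subset(3) by (meson subsetD)
  have "f = ext0 E (\<lambda>X. permanent J (?k (pr1 X)))"
    unfolding f act_poly_def
  proof (rule ext0_cong)
    fix X assume X: "X \<in> E"
    \<comment> \<open>The component of \<open>X\<close> that the group element fixes; it has no
      entries in the block of the permanent.\<close>
    define W where "W = (\<lambda>i. X i - pr1 X i)"
    have W: "W \<in> ?C" "W \<in> E"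
      using X by (auto simp: W_def coord_space_def ext0_def spaceE_def)
    have "?k W = W" using D(3)[OF W(2)] g(3) W(1) by simp
    have "X = (\<lambda>i. pr1 X i + W i)" by (simp add: W_def)
    then have "?k X = (\<lambda>i. ?k (pr1 X) i + ?k W i)"
      using lin_map_onD(2)[OF D(2), of "pr1 X" W] W(2) pr1_in space_subset(3) by (metis subsetD)
    then have kX: "?k X = (\<lambda>i. ?k (pr1 X) i + W i)" using \<open>?k W = W\<close> by simp
    have "perm_form m n (?k X) = permanent J (?k X)"
      using lin_map_onD(1)[OF D(2) X] by (simp add: perm_form_def)
    also have "\<dots> = permanent J (?k (pr1 X))"
      unfolding kX by (rule permanent_cong) (simp add: W_def idxS1_def)
    finally show "perm_form m n (?k X) = permanent J (?k (pr1 X))" .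
  qed
  then show "\<exists>k k'. lin_inverses_on S1 k k' \<and> f = ext0 E (\<lambda>X. permanent J (k (pr1 X)))"
    using inv1 by blast
next
  let ?C = "coord_space (idxE m - idxS1 m n)"
  assume "\<exists>k k'. lin_inverses_on S1 k k' \<and> f = ext0 E (\<lambda>X. permanent J (k (pr1 X)))"
  then obtain k k' where k: "lin_inverses_on S1 k k'" and f: "f = ext0 E (\<lambda>X. permanent J (k (pr1 X)))" by blast
  \<comment> \<open>\<open>K h\<close> acts as \<open>h\<close> on the \<open>S1\<close> block and
    as the identity on the other coordinates.\<close>
  define K where "K = (\<lambda>k X i. k (pr1 X) i + (X i - pr1 X i))"
  have K_apply: "K h Y = (\<lambda>i. h (pr1 Y) i + (Y i - pr1 Y i))" for h Y by (simp add: K_def)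
  have lin: "lin_map_on E (K h)" if h: "lin_map_on S1 h" for h
    unfolding lin_map_on_def
  proof (intro conjI ballI allI)
    fix v w assume vw: "v \<in> E" "w \<in> E"
    have "h (pr1 v) \<in> S1" using lin_map_onD(1)[OF h pr1_in] .
    then show "K h v \<in> E" using space_subset(3) vw
      unfolding K_def spaceE_def coord_space_def by (auto simp: ext0_def)
    show "K h (\<lambda>i. v i + w i) = (\<lambda>i. K h v i + K h w i)"
      unfolding K_def ext0_add lin_map_onD(2)[OF h pr1_in pr1_in] by (simp add: algebra_simps)
    fix c show "K h (\<lambda>i. c * v i) = (\<lambda>i. c * K h v i)"
      unfolding K_def ext0_scale lin_map_onD(3)[OF h pr1_in] by (simp add: algebra_simps)
  qed
  have pr1K: "pr1 (K h X) = h (pr1 X)" if "lin_map_on S1 h" for h X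
  proof -
    have "h (pr1 X) \<in> S1" using lin_map_onD(1)[OF that pr1_in] .
    then show ?thesis unfolding K_def
      by (auto simp: ext0_def fun_eq_iff spaceS1_def coord_space_def)
  qed
  have KK: "K h (K h' X) = X" if "lin_map_on S1 h" "lin_map_on S1 h'" "\<forall>v\<in>S1. h (h' v) = v" for h h' X
  proof -
    have "K h (K h' X) = (\<lambda>i. h (h' (pr1 X)) i + (K h' X i - h' (pr1 X) i))"
      unfolding K_apply[of h "K h' X"] pr1K[OF that(2)] ..
    then show ?thesis using that(3) pr1_in by (simp add: K_def)
  qed
  note D = lin_inverses_onD[OF k]
  have inv: "lin_inverses_on E (K k') (K k)"
    unfolding lin_inverses_on_def using lin D KK by blast
  define g where "g = restrict (K k') E"
  have g: "g \<in> GL E" unfolding g_def by (rule lin_inverses_GL(1)[OF subspaces(1) inv])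
  have ginv: "inv_into E g X = K k X" if "X \<in> E" for X
    unfolding g_def by (rule lin_inverses_GL(2)[OF subspaces(1) inv that])
  have KS1: "K h w = h w" if "w \<in> S1" "lin_map_on S1 h" for h w
    using that pr1_id by (simp add: K_def)
  have "K k' ` S1 = S1"
    by (rule image_eq_of_inverses[OF inv space_subset(3)]) (use KS1 D lin_map_onD(1) in auto)
  moreover have "g ` S1 = K k' ` S1"
    unfolding g_def using space_subset(3) by (intro image_cong) auto
  moreover have "\<forall>w\<in>?C. g w = w"
  proof
    fix w assume w: "w \<in> ?C"
    then have "w \<in> E" by (auto simp: spaceE_def coord_space_def)
    moreover have "pr1 w = (\<lambda>_. 0)" using w by (auto simp: ext0_def coord_space_def)
    moreover have "k' (\<lambda>_. 0) = (\<lambda>_. 0)"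
      using lin_map_onD(3)[OF D(2) lin_subspace_zero[OF subspaces(3)], of 0] by simp
    ultimately show "g w = w" by (simp add: g_def K_def)
  qed
  ultimately have "g \<in> GLS1 m n" using g by (simp add: GLS1_def GL_summand_def)
  moreover have "f = act_poly E g (perm_form m n)"
    unfolding f act_poly_def
  proof (rule ext0_cong)
    fix X assume X: "X \<in> E"
    have "perm_form m n (inv_into E g X) = permanent J (K k X)"
      using lin_map_onD(1)[OF lin[OF D(1)] X] ginv[OF X] by (simp add: perm_form_def)
    also have "\<dots> = permanent J (k (pr1 X))" using permanent_pr1[of "K k X"] pr1K[OF D(1)] by simp
    finally show "permanent J (k (pr1 X)) = perm_form m n (inv_into E g X)" by simp
  qed
  ultimately show "f \<in> Zo m n" unfolding Zo_def by blast
qed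

lemma bar_apply: "X \<in> E \<Longrightarrow> bar m n l X = l (prS X)"
  by (simp add: bar_def)

lemma dualS1_iff: "l \<in> dualS1 m n \<longleftrightarrow> l \<in> dual S \<and> l e11 = 0"
  by (simp add: dualS1_def)

lemma dual_S_decomp:
  assumes "l \<in> dual S" shows "l (prS X) = X (1, 1) * l e11 + l (pr1 X)"
proof -
  have "pr1 X \<in> S" using pr1_in space_subset by blast
  then show ?thesis unfolding prS_decomp
    using dual_add[OF subspaces(2) assms lin_subspace_scale[OF subspaces(2) e11_in(1)]]
      dual_scale[OF subspaces(2) assms e11_in(1)] by simp
qed

text \<open>The inverse of a group element preserves both \<open>S\<close> and the line, so it is
  block triangular on \<open>S\<close>: its (1,1) coordinate is a functional \<open>l\<close>, and
  modulo the line it induces an automorphism \<open>k\<close> of \<open>S1\<close>. Substituting it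
  into the padded permanent gives the d-th power of \<open>l\<close> times the permanent of the
  transformed block.\<close>

lemma orbitRp_subset:
  assumes "q \<in> orbitRp m n"
  shows "\<exists>l\<in>dual S - dualS1 m n. \<exists>f\<in>Zo m n. q = (\<lambda>X. bar m n l X ^ d * f X)"
proof -
  let ?C = "spaceSperp m n"
  obtain g where g: "g \<in> GL E" "g ` S = S" "\<forall>w\<in>?C. g w = w" "g ` line11 = line11"
    and q: "q = act_poly E g (padded_perm m n)"
    using assms unfolding orbitRp_def groupR_def LP2_def GL_summand_def by blast
  let ?K = "inv_into E g"
  have L: "line11 \<subseteq> E" unfolding line11_def spaceE_def by (rule coord_space_mono) (use idx_subset in simp)
  note inv = GL_lin_inverses[OF subspaces(1) g(1)]
  note D = lin_inverses_onD[OF inv]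
  have gS: "g v \<in> S" if "v \<in> S" for v using g(2) that by blast
  have gL: "g v \<in> line11" if "v \<in> line11" for v using g(4) that by blast
  have KS: "?K v \<in> S" if v: "v \<in> S" for v
  proof -
    obtain w where "w \<in> S" "v = g w" using g(2) v by blast
    then show ?thesis using D(3)[of w] space_subset by auto
  qed
  have KL: "?K v \<in> line11" if v: "v \<in> line11" for v
  proof -
    obtain w where "w \<in> line11" "v = g w" using g(4) v by blast
    then show ?thesis using D(3)[of w] L by auto
  qed
  have e11L: "e11 \<in> line11" by (simp add: line11_def unit_vec_in_coord_space)
  have expand: "h (prS X) = (\<lambda>i. X (1, 1) * h e11 i + h (pr1 X) i)" if h: "lin_map_on E h" for h X
  proof -
    have "pr1 X \<in> E" using pr1_in space_subset by blast
    then have "h (\<lambda>i. X (1, 1) * e11 i + pr1 X i) = (\<lambda>i. h (\<lambda>i. X (1, 1) * e11 i) i + h (pr1 X) i)"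
      by (intro lin_map_onD(2)[OF h] lin_subspace_scale[OF subspaces(1)] e11_in)
    then show ?thesis unfolding prS_decomp lin_map_onD(3)[OF h e11_in(2)] .
  qed
  \<comment> \<open>The contribution of \<open>e11\<close> stays in the line, so the
    \<open>S1\<close> part of the result depends only on the \<open>S1\<close> part of the
    argument.\<close>
  have kill: "pr1 (h (prS X)) = pr1 (h (pr1 X))" if h: "lin_map_on E h" "h e11 \<in> line11" for h X
  proof -
    have "h e11 i = 0" if "i \<in> idxS1 m n" for i
    proof -
      have "i \<notin> {(1, 1)}" using that idx11 by blast
      then show ?thesis using h(2) unfolding line11_def coord_space_def by blast
    qed
    then show ?thesis unfolding expand[OF h(1)] by (auto simp: ext0_def)
  qed
  define l where "l = ext0 S (\<lambda>X. ?K X (1, 1))"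
  define k where "k = (\<lambda>X. pr1 (?K X))"
  define k' where "k' = (\<lambda>X. pr1 (g X))"
  have l: "l \<in> dual S"
  proof (rule dualI)
    fix v w c assume "v \<in> S"
    then have v: "v \<in> S" "v \<in> E" using space_subset by auto
    show "l (\<lambda>i. c * v i) = c * l v"
      using v lin_map_onD(3)[OF D(2) v(2)] lin_subspace_scale[OF subspaces(2) v(1)] by (simp add: l_def)
    assume "w \<in> S"
    then have w: "w \<in> S" "w \<in> E" using space_subset by auto
    show "l (\<lambda>i. v i + w i) = l v + l w"
      using v w lin_map_onD(2)[OF D(2) v(2) w(2)] lin_subspace_add[OF subspaces(2) v(1) w(1)] by (simp add: l_def)
  qed (simp_all add: l_def)
  \<comment> \<open>The inverse maps the line to itself, so a zero (1,1) coordinate would mean that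
    it annihilates \<open>e11\<close>.\<close>
  have "l e11 \<noteq> 0"
  proof
    assume "l e11 = 0"
    then have "?K e11 (1, 1) = 0" using e11_in by (simp add: l_def)
    then have K0: "?K e11 = (\<lambda>_. 0)" using KL[OF e11L] unfolding line11_eq by (metis mult_zero_left)
    have "g (\<lambda>_. 0) = (\<lambda>_. 0)"
      using lin_map_onD(3)[OF D(1) lin_subspace_zero[OF subspaces(1)], of 0] by simp
    then have "e11 = (\<lambda>_. 0)" using D(4)[OF e11_in(2)] K0 by simp
    then show False by (metis unit_vec_def zero_neq_one)
  qed
  then have l': "l \<in> dual S - dualS1 m n" using l by (simp add: dualS1_iff)
  have lin1: "lin_map_on S1 (\<lambda>X. pr1 (h X))" if h: "lin_map_on E h" for h
    unfolding lin_map_on_def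
  proof (intro conjI ballI allI)
    fix v w c assume v: "v \<in> S1"
    show "pr1 (h v) \<in> S1" by (rule pr1_in)
    have vE: "v \<in> E" using v space_subset by blast
    show "pr1 (h (\<lambda>i. c * v i)) = (\<lambda>i. c * pr1 (h v) i)"
      unfolding lin_map_onD(3)[OF h vE] by (rule ext0_scale)
    assume "w \<in> S1"
    then have wE: "w \<in> E" using space_subset by blast
    show "pr1 (h (\<lambda>i. v i + w i)) = (\<lambda>i. pr1 (h v) i + pr1 (h w) i)"
      unfolding lin_map_onD(2)[OF h vE wE] by (rule ext0_add)
  qed
  have inv1: "pr1 (h (pr1 (h' v))) = v"
    if h: "lin_map_on E h" "h e11 \<in> line11" "h (h' v) = v" "h' v \<in> S" "v \<in> S1" for h h' v
    using kill[OF h(1,2), of "h' v"] h(3,4,5) by (simp add: prS_id pr1_id)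
  have "lin_inverses_on S1 k k'"
    unfolding lin_inverses_on_def k_def k'_def
  proof (intro conjI ballI lin1 D)
    fix v assume "v \<in> S1"
    then have v: "v \<in> S1" "v \<in> S" "v \<in> E" using space_subset by auto
    show "pr1 (g (pr1 (?K v))) = v"
      by (rule inv1[of g ?K v, OF D(1) gL[OF e11L] D(4)[OF v(3)] KS[OF v(2)] v(1)])
    show "pr1 (?K (pr1 (g v))) = v"
      by (rule inv1[of ?K g v, OF D(2) KL[OF e11L] D(3)[OF v(3)] gS[OF v(2)] v(1)])
  qed
  then have f: "ext0 E (\<lambda>X. permanent J (k (pr1 X))) \<in> Zo m n" (is "?f \<in> _") using Zo_iff by blast
  have "q X = bar m n l X ^ d * ?f X" for X
  proof (cases "X \<in> E")
    case True
    define W where "W = (\<lambda>i. X i - prS X i)"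
    have W: "W \<in> ?C" "W \<in> E"
      using True by (auto simp: W_def coord_space_def ext0_def spaceE_def spaceSperp_def)
    have "?K W = W" using D(3)[OF W(2)] g(3) W(1) by simp
    have prE: "prS X \<in> E" using prS_in space_subset by blast
    have "X = (\<lambda>i. prS X i + W i)" by (simp add: W_def)
    then have "?K X = (\<lambda>i. ?K (prS X) i + ?K W i)"
      using lin_map_onD(2)[OF D(2) prE W(2)] by simp
    then have KX: "?K X = (\<lambda>i. ?K (prS X) i + W i)" using \<open>?K W = W\<close> by simp
    have "W (1, 1) = 0" using idx_subset by (simp add: W_def)
    then have 1: "?K X (1, 1) = bar m n l X" using KX bar_apply[OF True] prS_in by (simp add: l_def)
    have "pr1 W = (\<lambda>_. 0)"
      by (intro ext) (use subsetD[OF idx_subset(1)] in \<open>simp add: W_def ext0_def\<close>)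
    then have "pr1 (?K X) = pr1 (?K (prS X))" unfolding KX ext0_add by simp
    also have "\<dots> = k (pr1 X)" unfolding k_def by (rule kill[OF D(2) KL[OF e11L]])
    finally have 2: "permanent J (?K X) = permanent J (k (pr1 X))" using permanent_pr1[of "?K X"] by simp
    show ?thesis
      using True lin_map_onD(1)[OF D(2) True] 1 2 by (simp add: q act_poly_def padded_perm_def)
  qed (simp add: q act_poly_def)
  then show ?thesis using l' f by blast
qed

text \<open>The block triangular map \<open>K\<close> with (1,1) coordinate \<open>l\<close> and
  block \<open>k\<close> is written down explicitly; \<open>G\<close> is its inverse, obtained by
  solving for the (1,1) coordinate. The action substitutes inverses, so \<open>G\<close> gives the
  group element and \<open>K\<close> the substitution.\<close>

lemma orbitRp_supset:
  assumes l: "l \<in> dual S - dualS1 m n" and f: "f \<in> Zo m n"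
  shows "(\<lambda>X. bar m n l X ^ d * f X) \<in> orbitRp m n"
proof -
  have lS: "l \<in> dual S" and l0: "l e11 \<noteq> 0" using l by (auto simp: dualS1_iff)
  obtain k k' where k: "lin_inverses_on S1 k k'" and f: "f = ext0 E (\<lambda>X. permanent J (k (pr1 X)))"
    using f Zo_iff by blast
  note D = lin_inverses_onD[OF k]
  define K where "K = (\<lambda>X i. if i = (1, 1) then l (prS X) else if i \<in> idxS1 m n then k (pr1 X) i else X i)"
  define G where "G = (\<lambda>X i. if i = (1, 1) then (X (1, 1) - l (k' (pr1 X))) / l e11
    else if i \<in> idxS1 m n then k' (pr1 X) i else X i)"
  have kS1: "k (pr1 X) \<in> S1" "k' (pr1 X) \<in> S1" for X
    using lin_map_onD(1)[OF D(1) pr1_in] lin_map_onD(1)[OF D(2) pr1_in] by auto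
  have out: "v i = 0" if "v \<in> S1" "i \<notin> idxS1 m n" for v i
    using that unfolding spaceS1_def coord_space_def by blast
  have K_apply: "K Y i = (if i = (1, 1) then l (prS Y) else if i \<in> idxS1 m n then k (pr1 Y) i else Y i)" for Y i
    by (simp add: K_def)
  have G_apply: "G Y i = (if i = (1, 1) then (Y (1, 1) - l (k' (pr1 Y))) / l e11
      else if i \<in> idxS1 m n then k' (pr1 Y) i else Y i)" for Y i
    by (simp add: G_def)
  have pK: "pr1 (K X) = k (pr1 X)" for X
    using idx11 out[OF kS1(1)[of X]] by (auto simp: K_def ext0_def fun_eq_iff)
  have pG: "pr1 (G X) = k' (pr1 X)" for X
    using idx11 out[OF kS1(2)[of X]] by (auto simp: G_def ext0_def fun_eq_iff)
  have lG: "l (prS (G X)) = X (1, 1)" for X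
    unfolding dual_S_decomp[OF lS] pG using l0 by (simp add: G_def)
  have KG: "K (G X) = X" for X
  proof
    fix i show "K (G X) i = X i"
      using D(4)[OF pr1_in, of X] by (auto simp: K_apply[of "G X"] lG pG) (auto simp: G_apply ext0_def)
  qed
  have GK: "G (K X) = X" for X
  proof
    fix i
    have "k' (k (pr1 X)) = pr1 X" using D(3)[OF pr1_in] .
    moreover have "K X (1, 1) = X (1, 1) * l e11 + l (pr1 X)" by (simp add: K_def dual_S_decomp[OF lS])
    ultimately show "G (K X) i = X i"
      using l0 by (auto simp: G_apply[of "K X"] pK) (auto simp: K_apply ext0_def)
  qed
  have linK: "lin_map_on E K"
    unfolding lin_map_on_def
  proof (intro conjI ballI allI)
    fix v w c assume v: "v \<in> E"
    show "K v \<in> E" using v idx_subset by (auto simp: K_def spaceE_def coord_space_def)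
    show "K (\<lambda>i. c * v i) = (\<lambda>i. c * K v i)"
      unfolding K_def ext0_scale lin_map_onD(3)[OF D(1) pr1_in] dual_scale[OF subspaces(2) lS prS_in] by auto
    show "K (\<lambda>i. v i + w i) = (\<lambda>i. K v i + K w i)"
      unfolding K_def ext0_add lin_map_onD(2)[OF D(1) pr1_in pr1_in] dual_add[OF subspaces(2) lS prS_in prS_in] by auto
  qed
  have k'S: "k' (pr1 X) \<in> S" for X using kS1 space_subset by blast
  have linG: "lin_map_on E G"
    unfolding lin_map_on_def
  proof (intro conjI ballI allI)
    fix v w c assume v: "v \<in> E"
    show "G v \<in> E" using v idx_subset by (auto simp: G_def spaceE_def coord_space_def)
    show "G (\<lambda>i. c * v i) = (\<lambda>i. c * G v i)"
      unfolding G_def ext0_scale lin_map_onD(3)[OF D(2) pr1_in] dual_scale[OF subspaces(2) lS k'S]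
      by (auto simp: algebra_simps)
    show "G (\<lambda>i. v i + w i) = (\<lambda>i. G v i + G w i)"
      unfolding G_def ext0_add lin_map_onD(2)[OF D(2) pr1_in pr1_in] dual_add[OF subspaces(2) lS k'S k'S]
      by (auto simp: add_divide_distrib diff_divide_distrib)
  qed
  have inv: "lin_inverses_on E G K" unfolding lin_inverses_on_def using linK linG KG GK by blast
  define g where "g = restrict G E"
  have g: "g \<in> GL E" unfolding g_def by (rule lin_inverses_GL(1)[OF subspaces(1) inv])
  have ginv: "inv_into E g X = K X" if "X \<in> E" for X
    unfolding g_def by (rule lin_inverses_GL(2)[OF subspaces(1) inv that])
  have L: "line11 \<subseteq> E" unfolding line11_def spaceE_def by (rule coord_space_mono) (use idx_subset in simp)
  have zero: "k (\<lambda>_. 0) = (\<lambda>_. 0)" "k' (\<lambda>_. 0) = (\<lambda>_. 0)"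
    using lin_map_onD(3)[OF D(1) lin_subspace_zero[OF subspaces(3)], of 0]
      lin_map_onD(3)[OF D(2) lin_subspace_zero[OF subspaces(3)], of 0] by simp_all
  have l_zero: "l (\<lambda>_. 0) = 0" using dual_zero[OF subspaces(2) lS] .
  have "G ` S = S"
    by (rule image_eq_of_inverses[OF inv space_subset(2)])
      (auto simp: G_def K_def spaceS_def coord_space_def idxS_def)
  moreover have "g ` S = G ` S" unfolding g_def using space_subset by (intro image_cong) auto
  moreover have "G ` line11 = line11"
  proof (rule image_eq_of_inverses[OF inv L])
    fix w assume w: "w \<in> line11"
    have "w i = 0" if "i \<in> idxS1 m n" for i
    proof -
      have "i \<notin> {(1, 1)}" using that idx11 by blast
      then show ?thesis using w unfolding line11_def coord_space_def by blast
    qed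
    then have "pr1 w = (\<lambda>_. 0)" by (intro ext) (simp add: ext0_def)
    then show "G w \<in> line11" "K w \<in> line11"
      using w zero by (auto simp: G_def K_def line11_def coord_space_def)
  qed
  moreover have "g ` line11 = G ` line11" unfolding g_def using L by (intro image_cong) auto
  moreover have "\<forall>w\<in>spaceSperp m n. g w = w"
  proof
    fix w assume w: "w \<in> spaceSperp m n"
    then have "w \<in> E" by (auto simp: spaceE_def coord_space_def spaceSperp_def)
    moreover have w0: "w i = 0" if "i \<in> idxS m n" for i
      using w that unfolding spaceSperp_def coord_space_def by blast
    moreover have "w (1, 1) = 0" using w0 idx_subset by blast
    moreover have "pr1 w = (\<lambda>_. 0)"
      by (intro ext) (use w0 subsetD[OF idx_subset(1)] in \<open>simp add: ext0_def\<close>)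
    ultimately show "g w = w"
      using zero l_zero idx_subset by (intro ext) (auto simp: g_def G_apply)
  qed
  ultimately have "g \<in> groupR m n" using g by (simp add: groupR_def LP2_def GL_summand_def)
  moreover have "(\<lambda>X. bar m n l X ^ d * f X) = act_poly E g (padded_perm m n)"
  proof
    fix X show "bar m n l X ^ d * f X = act_poly E g (padded_perm m n) X"
    proof (cases "X \<in> E")
      case True
      have "permanent J (K X) = permanent J (k (pr1 X))" using permanent_pr1[of "K X"] pK by simp
      moreover have "K X (1, 1) = bar m n l X" using bar_apply[OF True] by (simp add: K_def)
      ultimately show ?thesis
        using True ginv lin_map_onD(1)[OF linK True] by (simp add: f act_poly_def padded_perm_def)
    qed (simp add: f act_poly_def)
  qed
  ultimately show ?thesis unfolding orbitRp_def by blast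
qed

lemma orbitRp_eq:
  "orbitRp m n = {(\<lambda>X. bar m n l X ^ d * f X) | l f. l \<in> dual S - dualS1 m n \<and> f \<in> Zo m n}"
  using orbitRp_subset orbitRp_supset by blast

lemma Zo_sym_power: "Zo m n \<subseteq> sym_power_dual n E"
proof
  fix f assume "f \<in> Zo m n"
  then obtain k k' where k: "lin_inverses_on S1 k k'" and f: "f = ext0 E (\<lambda>X. permanent J (k (pr1 X)))"
    using Zo_iff by blast
  note D = lin_inverses_onD[OF k]
  note A = fun_subalg_fun_alg[of E "dual E"]
  have coord: "ext0 E (\<lambda>X. k (pr1 X) p) \<in> dual E" for p
    by (rule dualI)
      (auto simp: ext0_add ext0_scale lin_map_onD[OF D(1) pr1_in] pr1_in
        lin_subspace_add[OF subspaces(1)] lin_subspace_scale[OF subspaces(1)])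
  have coord': "ext0 E (\<lambda>X. k (pr1 X) p) \<in> fun_alg E (dual E)" for p
    using fun_alg.gen[OF coord, of E] by (simp add: ext0_ext0)
  have prod: "ext0 E (\<lambda>X. \<Prod>i\<in>I. k (pr1 X) (i, \<pi> i)) \<in> fun_alg E (dual E)" for \<pi> and I :: "nat set"
  proof (induction I rule: infinite_finite_induct)
    case (insert i I)
    have "ext0 E (\<lambda>X. \<Prod>i\<in>insert i I. k (pr1 X) (i, \<pi> i)) =
        (\<lambda>X. ext0 E (\<lambda>X. k (pr1 X) (i, \<pi> i)) X * ext0 E (\<lambda>X. \<Prod>i\<in>I. k (pr1 X) (i, \<pi> i)) X)"
      using insert.hyps by (intro ext) (simp add: ext0_def)
    then show ?case using fun_alg.mult[OF coord' insert.IH] by simp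
  qed (use fun_alg.const[of E 1] in auto)
  have "f = (\<lambda>X. \<Sum>\<pi> | \<pi> permutes J. ext0 E (\<lambda>X. \<Prod>i\<in>J. k (pr1 X) (i, \<pi> i)) X)"
    unfolding f by (intro ext) (simp add: ext0_def permanent_def)
  moreover have "\<dots> \<in> fun_alg E (dual E)" by (intro fun_subalg_sum[OF A] prod)
  ultimately have "f \<in> fun_alg E (dual E)" by simp
  moreover have "f (\<lambda>i. c * X i) = c ^ n * f X" if "X \<in> E" for c X
  proof -
    have "card J = n" using nm by simp
    then show ?thesis
      using that lin_subspace_scale[OF subspaces(1) that]
      by (simp add: f ext0_scale lin_map_onD(3)[OF D(1) pr1_in] permanent_scale)
  qed
  ultimately show "f \<in> sym_power_dual n E" by (simp add: sym_power_dual_def)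
qed

lemma Zo_pr1: "f \<in> Zo m n \<Longrightarrow> X \<in> E \<Longrightarrow> f X = f (pr1 X)"
  unfolding Zo_iff using subsetD[OF space_subset(3) pr1_in[of X]] by (auto simp: pr1_id[OF pr1_in])

text \<open>The permanent has degree n, so multiplication by \<open>c\<close> is a dilation of
  \<open>S1\<close> by an n-th root of \<open>c\<close>.\<close>

lemma Zo_scale:
  assumes f: "f \<in> Zo m n" and c: "c \<noteq> 0" shows "(\<lambda>X. c * f X) \<in> Zo m n"
proof -
  obtain k k' where k: "lin_inverses_on S1 k k'" and f: "f = ext0 E (\<lambda>X. permanent J (k (pr1 X)))"
    using f Zo_iff by blast
  note D = lin_inverses_onD[OF k]
  obtain z where z: "z \<noteq> 0" "z ^ n = c" using complex_nth_root[OF n_pos c] by blast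
  have lin: "lin_map_on S1 (\<lambda>X i. a * h X i)" if h: "lin_map_on S1 h" for h a
    unfolding lin_map_on_def
    using lin_map_onD[OF h] lin_subspace_scale[OF subspaces(3)] by (auto simp: algebra_simps)
  have "lin_inverses_on S1 (\<lambda>X i. z * k X i) (\<lambda>X i. inverse z * k' X i)"
    unfolding lin_inverses_on_def
    using lin[OF D(1), of z] lin[OF D(2), of "inverse z"] D(3,4) z(1)
      lin_map_onD(1,3)[OF D(1)] lin_map_onD(1,3)[OF D(2)] by (simp add: mult.assoc[symmetric])
  moreover have "card J = n" using nm by simp
  then have "(\<lambda>X. c * f X) = ext0 E (\<lambda>X. permanent J (\<lambda>i. z * k (pr1 X) i))"
    using z(2) by (intro ext) (simp add: f ext0_def permanent_scale)
  ultimately show ?thesis unfolding Zo_iff by blast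
qed

text \<open>At the matrix that \<open>k\<close> sends to the identity block, the value is the
  permanent of the identity, which is 1.\<close>

lemma Zo_nonzero:
  assumes f: "f \<in> Zo m n" shows "\<exists>X\<in>S1. f X \<noteq> 0"
proof -
  obtain k k' where k: "lin_inverses_on S1 k k'" and f: "f = ext0 E (\<lambda>X. permanent J (k (pr1 X)))"
    using f Zo_iff by blast
  note D = lin_inverses_onD[OF k]
  define U where "U = (\<lambda>p::nat \<times> nat. if fst p = snd p \<and> fst p \<in> J then 1 else 0 :: complex)"
  have U: "U \<in> S1" by (auto simp: U_def spaceS1_def coord_space_def idxS1_def)
  have kU: "k' U \<in> S1" using lin_map_onD(1)[OF D(2) U] .
  have "f (k' U) = permanent J U"
    using kU space_subset D(4)[OF U] by (auto simp: f pr1_id)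
  also have "\<dots> = 1" unfolding U_def by (rule permanent_identity) simp
  finally show ?thesis using kU by (intro bexI[of _ "k' U"]) auto
qed

lemma Zo_nonempty: "\<exists>f. f \<in> Zo m n"
proof -
  have "lin_inverses_on S1 (\<lambda>X. X) (\<lambda>X. X)" by (simp add: lin_inverses_on_def lin_map_on_def)
  then show ?thesis unfolding Zo_iff by (intro exI) (rule conjI, assumption, rule refl)
qed

end

section \<open>Points of spectra and pull-backs\<close>

text \<open>It is enough that the frame coordinates of \<open>\<tau>\<close> lie in
  \<open>D\<close>, because every functional is a combination of evaluations at frame
  points.\<close>

lemma pullback_in_subalg:
  assumes D: "fun_subalg X D" and V: "lin_subspace V" and e: "eval_frame V P e"
    and Y: "Y \<subseteq> V" and \<tau>: "\<And>x. x \<in> X \<Longrightarrow> \<tau> x \<in> Y"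
    and coord: "\<And>p. p \<in> P \<Longrightarrow> ext0 X (\<lambda>x. \<tau> x p) \<in> D"
    and b: "b \<in> fun_alg Y (dual V)"
  shows "ext0 X (\<lambda>x. b (\<tau> x)) \<in> D"
  using b
proof (induction rule: fun_alg.induct)
  case (const c)
  have "ext0 X (\<lambda>x. ext0 Y (\<lambda>_. c) (\<tau> x)) = ext0 X (\<lambda>_. c)" using \<tau> by (intro ext0_cong) simp
  then show ?case using fun_subalg_const[OF D] by simp
next
  case (gen l)
  have "ext0 X (\<lambda>x. ext0 Y l (\<tau> x)) = (\<lambda>x. \<Sum>p\<in>P. l (e p) * ext0 X (\<lambda>x. \<tau> x p) x)"
  proof
    fix x
    have "ext0 Y l (\<tau> x) = (\<Sum>p\<in>P. l (e p) * \<tau> x p)" if "x \<in> X"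
      using \<tau>[OF that] Y dual_eval_frame[OF V e gen, of "\<tau> x"] by (simp add: subset_iff mult.commute)
    then show "ext0 X (\<lambda>x. ext0 Y l (\<tau> x)) x = (\<Sum>p\<in>P. l (e p) * ext0 X (\<lambda>x. \<tau> x p) x)"
      by (cases "x \<in> X") simp_all
  qed
  moreover have "(\<lambda>x. \<Sum>p\<in>P. l (e p) * ext0 X (\<lambda>x. \<tau> x p) x) \<in> D"
    by (intro fun_subalg_sum[OF D] fun_subalg_scale[OF D] coord)
  ultimately show ?case by simp
next
  case (add f g)
  have "ext0 X (\<lambda>x. f (\<tau> x) + g (\<tau> x)) = (\<lambda>x. ext0 X (\<lambda>x. f (\<tau> x)) x + ext0 X (\<lambda>x. g (\<tau> x)) x)"
    by (rule ext) (simp add: ext0_def)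
  then show ?case using fun_subalg_add[OF D add.IH] by simp
next
  case (mult f g)
  have "ext0 X (\<lambda>x. f (\<tau> x) * g (\<tau> x)) = (\<lambda>x. ext0 X (\<lambda>x. f (\<tau> x)) x * ext0 X (\<lambda>x. g (\<tau> x)) x)"
    by (rule ext) (simp add: ext0_def)
  then show ?case using fun_subalg_mult[OF D mult.IH] by simp
qed

text \<open>The image under \<open>\<tau>\<close> of a point that is given only as a character. It
  yields the values of \<open>alpha\<close> as well as the two components of a pair in
  \<open>projSZ_surj\<close>.\<close>

lemma alg_hom_pullback_point:
  assumes D: "fun_subalg X D" and V: "lin_subspace V" and e: "eval_frame V P e"
    and \<tau>: "\<And>x. x \<in> X \<Longrightarrow> \<tau> x \<in> V"
    and coord: "\<And>p. p \<in> P \<Longrightarrow> ext0 X (\<lambda>x. \<tau> x p) \<in> D"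
    and \<xi>: "alg_hom X D \<xi>"
  shows "\<exists>y\<in>V. \<forall>b\<in>fun_alg V (dual V). b y = \<xi> (ext0 X (\<lambda>x. b (\<tau> x)))"
proof -
  have pull: "ext0 X (\<lambda>x. b (\<tau> x)) \<in> D" if "b \<in> fun_alg V (dual V)" for b
    using pullback_in_subalg[OF D V e order_refl \<tau> coord that] .
  have "alg_hom V (fun_alg V (dual V)) (\<lambda>b. \<xi> (ext0 X (\<lambda>x. b (\<tau> x))))"
    unfolding alg_hom_def
  proof (intro conjI allI ballI)
    fix c
    have "ext0 X (\<lambda>x. ext0 V (\<lambda>_. c) (\<tau> x)) = ext0 X (\<lambda>_. c)" using \<tau> by (intro ext0_cong) simp
    then show "\<xi> (ext0 X (\<lambda>x. ext0 V (\<lambda>_. c) (\<tau> x))) = c" using alg_hom_const[OF D \<xi>] by simp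
  next
    fix f g assume fg: "f \<in> fun_alg V (dual V)" "g \<in> fun_alg V (dual V)"
    have "ext0 X (\<lambda>x. f (\<tau> x) + g (\<tau> x)) = (\<lambda>x. ext0 X (\<lambda>x. f (\<tau> x)) x + ext0 X (\<lambda>x. g (\<tau> x)) x)"
      by (rule ext) (simp add: ext0_def)
    then show "\<xi> (ext0 X (\<lambda>x. f (\<tau> x) + g (\<tau> x))) = \<xi> (ext0 X (\<lambda>x. f (\<tau> x))) + \<xi> (ext0 X (\<lambda>x. g (\<tau> x)))"
      using alg_hom_add[OF D \<xi> pull pull, OF fg] by simp
    have "ext0 X (\<lambda>x. f (\<tau> x) * g (\<tau> x)) = (\<lambda>x. ext0 X (\<lambda>x. f (\<tau> x)) x * ext0 X (\<lambda>x. g (\<tau> x)) x)"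
      by (rule ext) (simp add: ext0_def)
    then show "\<xi> (ext0 X (\<lambda>x. f (\<tau> x) * g (\<tau> x))) = \<xi> (ext0 X (\<lambda>x. f (\<tau> x))) * \<xi> (ext0 X (\<lambda>x. g (\<tau> x)))"
      using alg_hom_mult[OF D \<xi> pull pull, OF fg] by simp
  qed
  from alg_hom_is_evaluation[OF V e this] show ?thesis .
qed

lemma fun_alg_dual_dilate:
  assumes V: "lin_subspace V" and b: "b \<in> fun_alg V (dual V)"
  shows "ext0 V (\<lambda>v. b (\<lambda>i. c * v i)) \<in> fun_alg V (dual V)"
  using b
proof (induction rule: fun_alg.induct)
  case (const a)
  have "ext0 V (\<lambda>v. ext0 V (\<lambda>_. a) (\<lambda>i. c * v i)) = ext0 V (\<lambda>_. a)"
    by (intro ext0_cong) (simp add: lin_subspace_scale[OF V])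
  then show ?case using fun_alg.const by simp
next
  case (gen l)
  have "ext0 V (\<lambda>v. ext0 V l (\<lambda>i. c * v i)) = (\<lambda>v. c * ext0 V l v)"
    by (rule ext) (simp add: ext0_def lin_subspace_scale[OF V] dual_scale[OF V gen])
  then show ?case using fun_subalg_scale[OF fun_subalg_fun_alg fun_alg.gen[OF gen]] by simp
next
  case (add f g)
  have "ext0 V (\<lambda>v. f (\<lambda>i. c * v i) + g (\<lambda>i. c * v i)) =
      (\<lambda>v. ext0 V (\<lambda>v. f (\<lambda>i. c * v i)) v + ext0 V (\<lambda>v. g (\<lambda>i. c * v i)) v)"
    by (rule ext) (simp add: ext0_def)
  then show ?case using fun_alg.add[OF add.IH] by simp
next
  case (mult f g)
  have "ext0 V (\<lambda>v. f (\<lambda>i. c * v i) * g (\<lambda>i. c * v i)) =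
      (\<lambda>v. ext0 V (\<lambda>v. f (\<lambda>i. c * v i)) v * ext0 V (\<lambda>v. g (\<lambda>i. c * v i)) v)"
    by (rule ext) (simp add: ext0_def)
  then show ?case using fun_alg.mult[OF mult.IH] by simp
qed

context permanent_spaces
begin

section \<open>The variety of pairs and its invariants\<close>

abbreviation "Sn \<equiv> sym_power_dual n E"
abbreviation "Sm \<equiv> sym_power_dual m E"
abbreviation "SZ \<equiv> dual S \<times> Z m n"

lemma lin_Sym: "lin_subspace (sym_power_dual k E)"
  by (rule lin_subspace_sym_power_dual[OF subspaces(1)])

lemma lin_dual_S: "lin_subspace (dual S)"
  by (rule lin_subspace_dual[OF subspaces(2)])

lemma frame_Sym: "\<exists>P e. eval_frame (sym_power_dual k E) P e"
  unfolding spaceE_def by (rule eval_frame_sym_power_dual[OF finite_idx(1)])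

lemma frame_dual_S: "\<exists>e. eval_frame (dual S) (unit_vec ` idxS m n) e"
  unfolding spaceS_def by (rule eval_frame_dual_coord_space[OF finite_idx(2)])

lemma Z_iff: "f \<in> Z m n \<longleftrightarrow> f \<in> Sn \<and> (\<forall>b\<in>fun_alg Sn (dual Sn). (\<forall>g\<in>Zo m n. b g = 0) \<longrightarrow> b f = 0)"
proof -
  have "Z m n = {y \<in> Sn. \<forall>f\<in>fun_alg Sn (dual Sn). (\<forall>x\<in>Zo m n. f x = 0) \<longrightarrow> f y = 0}"
    unfolding Z_def
    using zariski_closure_of[OF fun_variety_closed_subvariety[of Sn Sn], of "Zo m n"] Zo_sym_power by simp
  then show ?thesis by blast
qed

lemma Z_vanish:
  assumes "f \<in> Z m n" "b \<in> fun_alg Sn (dual Sn)" "\<And>g. g \<in> Zo m n \<Longrightarrow> b g = 0"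
  shows "b f = 0"
proof -
  have "\<forall>g\<in>Zo m n. b g = 0" using assms(3) by (rule ballI)
  then show ?thesis using assms(1,2) unfolding Z_iff by simp
qed

lemma Z_sub: "Z m n \<subseteq> Sn"
  using Z_iff by blast

lemma Zo_sub_Z: "Zo m n \<subseteq> Z m n"
proof
  fix f assume f: "f \<in> Zo m n"
  show "f \<in> Z m n"
    unfolding Z_iff
  proof (intro conjI ballI impI)
    show "f \<in> Sn" using f Zo_sym_power by blast
    fix b assume "\<forall>g\<in>Zo m n. b g = 0"
    then show "b f = 0" using f by (rule bspec)
  qed
qed

text \<open>Independence of the other coordinates is a closed condition, a difference of two
  evaluations, and so passes from \<open>Zo\<close> to its closure.\<close>

lemma Z_pr1:
  assumes f: "f \<in> Z m n" and X: "X \<in> E" shows "f X = f (pr1 X)"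
proof -
  let ?b = "\<lambda>f. ext0 Sn (\<lambda>f. f X) f - ext0 Sn (\<lambda>f. f (pr1 X)) f"
  have "?b \<in> fun_alg Sn (dual Sn)"
    by (intro fun_subalg_diff[OF fun_subalg_fun_alg] evaluation_in_fun_alg[OF lin_Sym order_refl])
  then have "?b f = 0"
  proof (rule Z_vanish[OF f])
    fix g assume "g \<in> Zo m n"
    then show "?b g = 0" using Zo_pr1[OF _ X] Zo_sym_power by (simp add: subset_iff)
  qed
  then show ?thesis using f Z_sub by (simp add: subset_iff)
qed

lemma Z_scale_nonzero:
  assumes f: "f \<in> Z m n" and c: "c \<noteq> 0" shows "(\<lambda>X. c * f X) \<in> Z m n"
  unfolding Z_iff
proof (intro conjI ballI impI)
  show "(\<lambda>X. c * f X) \<in> Sn" using f Z_sub lin_subspace_scale[OF lin_Sym] by blast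
  fix b assume b: "b \<in> fun_alg Sn (dual Sn)" "\<forall>g\<in>Zo m n. b g = 0"
  have "ext0 Sn (\<lambda>v. b (\<lambda>i. c * v i)) g = 0" if "g \<in> Zo m n" for g
    using b(2) Zo_scale[OF that c] by (simp add: ext0_def)
  then have "ext0 Sn (\<lambda>v. b (\<lambda>i. c * v i)) f = 0"
    by (rule Z_vanish[OF f fun_alg_dual_dilate[OF lin_Sym b(1)]])
  then show "b (\<lambda>X. c * f X) = 0" using f Z_sub by (simp add: subset_iff)
qed

lemma Z_scale:
  assumes f: "f \<in> Z m n" shows "(\<lambda>X. c * f X) \<in> Z m n"
proof (cases "c = 0")
  case True
  have fS: "f \<in> Sn" using f Z_sub by blast
  \<comment> \<open>The zero form lies on the line through \<open>f\<close>, whose other points are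
    covered by \<open>Z_scale_nonzero\<close>.\<close>
  have "b (\<lambda>_. 0) = 0" if b: "b \<in> fun_alg Sn (dual Sn)" "\<forall>g\<in>Zo m n. b g = 0" for b
  proof -
    obtain p where p: "\<forall>t. b (\<lambda>i. 0 + t * f i) = poly p t"
      using fun_alg_dual_line[OF lin_Sym b(1) lin_subspace_zero[OF lin_Sym] fS] by blast
    have "poly p t = 0" if "t \<noteq> 0" for t
    proof -
      have "b (\<lambda>X. t * f X) = 0"
        by (rule Z_vanish[OF Z_scale_nonzero[OF f that] b(1)]) (use b(2) in simp)
      then show ?thesis using p[rule_format, of t] by simp
    qed
    then have "p = 0" by (rule poly_eq_0_punctured)
    then show ?thesis using p[rule_format, of 0] by simp
  qed
  then show ?thesis unfolding Z_iff using True lin_subspace_zero[OF lin_Sym] by simp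
qed (use Z_scale_nonzero[OF f] in blast)

lemma pts_SZ: "pts (varSZ m n) = SZ"
  by (simp add: varSZ_def prod_variety_def)

lemma fns_SZ: "fns (varSZ m n) = fun_alg SZ ((\<lambda>f. f \<circ> fst) ` fun_alg (dual S) (dual (dual S)) \<union>
    (\<lambda>g. g \<circ> snd) ` fun_alg (Z m n) (dual Sn))"
  by (simp add: varSZ_def prod_variety_def)

lemma subalg_SZ: "fun_subalg SZ (fns (varSZ m n))"
  unfolding fns_SZ by (rule fun_subalg_fun_alg)

lemma coord_fst: "ext0 SZ (\<lambda>x. fst x v) \<in> fns (varSZ m n)"
proof -
  have "ext0 SZ (ext0 (dual S) (\<lambda>l. l v) \<circ> fst) \<in> fns (varSZ m n)"
    unfolding fns_SZ using evaluation_in_fun_alg[OF lin_dual_S order_refl, of v] by (intro fun_alg.gen) blast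
  moreover have "ext0 SZ (ext0 (dual S) (\<lambda>l. l v) \<circ> fst) = ext0 SZ (\<lambda>x. fst x v)"
    by (rule ext0_cong) auto
  ultimately show ?thesis by simp
qed

lemma coord_snd: "ext0 SZ (\<lambda>x. snd x y) \<in> fns (varSZ m n)"
proof -
  have "ext0 SZ (ext0 (Z m n) (\<lambda>l. l y) \<circ> snd) \<in> fns (varSZ m n)"
    unfolding fns_SZ using evaluation_in_fun_alg[OF lin_Sym Z_sub, of y] by (intro fun_alg.gen) blast
  moreover have "ext0 SZ (ext0 (Z m n) (\<lambda>l. l y) \<circ> snd) = ext0 SZ (\<lambda>x. snd x y)"
    by (rule ext0_cong) auto
  ultimately show ?thesis by simp
qed

definition coordinate :: "cmat + cmat \<Rightarrow> poly_fun \<times> poly_fun \<Rightarrow> complex" where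
  "coordinate p x = (case p of Inl v \<Rightarrow> fst x v | Inr y \<Rightarrow> snd x y)"

text \<open>Coordinates of a pair are the values of \<lambda> at basis vectors, tagged
  \<open>Inl\<close>, and the values of f at frame points, tagged \<open>Inr\<close>.\<close>

lemma SZ_expand:
  assumes e: "eval_frame Sn P2 e2" and a: "a \<in> fns (varSZ m n)"
  shows "\<exists>ts. expr_over (unit_vec ` idxS m n <+> P2) ts \<and> (\<forall>x\<in>SZ. a x = poly_expr coordinate ts x)"
proof (rule fun_alg_poly_expr[OF _ a[unfolded fns_SZ]])
  let ?P1 = "unit_vec ` idxS m n :: cmat set"
  obtain e1 where e1: "eval_frame (dual S) ?P1 e1" using frame_dual_S by blast
  fix f assume "f \<in> (\<lambda>f. f \<circ> fst) ` fun_alg (dual S) (dual (dual S)) \<union> (\<lambda>g. g \<circ> snd) ` fun_alg (Z m n) (dual Sn)"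
  then show "\<exists>ts. expr_over (?P1 <+> P2) ts \<and> (\<forall>x\<in>SZ. f x = poly_expr coordinate ts x)"
  proof
    assume "f \<in> (\<lambda>f. f \<circ> fst) ` fun_alg (dual S) (dual (dual S))"
    then obtain h where h: "h \<in> fun_alg (dual S) (dual (dual S))" "f = h \<circ> fst" by blast
    obtain ts where ts: "expr_over ?P1 ts" "\<forall>x\<in>dual S. h x = poly_expr (\<lambda>p v. v p) ts x"
      using fun_alg_dual_poly_expr[OF lin_dual_S e1 order_refl h(1)] by blast
    show ?thesis
    proof (intro exI[of _ "map (\<lambda>t. (fst t, map Inl (snd t))) ts"] conjI ballI)
      show "expr_over (?P1 <+> P2) (map (\<lambda>t. (fst t, map Inl (snd t))) ts)"
        using ts(1) by (fastforce simp: expr_over_def)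
      fix x assume "x \<in> SZ"
      then show "f x = poly_expr coordinate (map (\<lambda>t. (fst t, map Inl (snd t))) ts) x"
        using ts(2) h(2) by (auto simp: poly_expr_def coordinate_def comp_def)
    qed
  next
    assume "f \<in> (\<lambda>g. g \<circ> snd) ` fun_alg (Z m n) (dual Sn)"
    then obtain h where h: "h \<in> fun_alg (Z m n) (dual Sn)" "f = h \<circ> snd" by blast
    obtain ts where ts: "expr_over P2 ts" "\<forall>x\<in>Z m n. h x = poly_expr (\<lambda>p v. v p) ts x"
      using fun_alg_dual_poly_expr[OF lin_Sym e Z_sub h(1)] by blast
    show ?thesis
    proof (intro exI[of _ "map (\<lambda>t. (fst t, map Inr (snd t))) ts"] conjI ballI)
      show "expr_over (?P1 <+> P2) (map (\<lambda>t. (fst t, map Inr (snd t))) ts)"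
        using ts(1) by (fastforce simp: expr_over_def)
      fix x assume "x \<in> SZ"
      then show "f x = poly_expr coordinate (map (\<lambda>t. (fst t, map Inr (snd t))) ts) x"
        using ts(2) h(2) by (auto simp: poly_expr_def coordinate_def comp_def)
    qed
  qed
qed

text \<open>The arguments may be arbitrary matrices and not only basis vectors and frame points, so
  that values of the product form are covered too.\<close>

definition mon :: "cmat list \<Rightarrow> cmat list \<Rightarrow> poly_fun \<times> poly_fun \<Rightarrow> complex" where
  "mon us ys x = (\<Prod>u\<leftarrow>us. fst x u) * (\<Prod>y\<leftarrow>ys. snd x y)"

definition lefts :: "('x + 'y) list \<Rightarrow> 'x list" where
  "lefts ps = map projl (filter isl ps)"

definition rights :: "('x + 'y) list \<Rightarrow> 'y list" where
  "rights ps = map projr (filter (\<lambda>p. \<not> isl p) ps)"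

lemma prod_coordinate: "(\<Prod>p\<leftarrow>ps. coordinate p x) = mon (lefts ps) (rights ps) x"
proof (induction ps)
  case (Cons p ps)
  then show ?case by (cases p) (simp_all add: mon_def lefts_def rights_def coordinate_def)
qed (simp add: mon_def lefts_def rights_def)

lemma mon_append: "mon (us @ us') (ys @ ys') x = mon us ys x * mon us' ys' x"
  by (simp add: mon_def)

abbreviation "Inv \<equiv> invariants (varSZ m n) (UNIV - {0}) (torus_act m n)"

lemma subalg_Inv: "fun_subalg SZ Inv"
proof -
  note A = subalg_SZ
  have t: "torus_act m n z x \<in> SZ" if "x \<in> SZ" for z x
    using that Z_scale lin_subspace_scale[OF lin_dual_S] by (auto simp: torus_act_def)
  show ?thesis
    unfolding fun_subalg_def invariants_def pts_SZ
    using fun_subalg_outside[OF A] fun_subalg_const[OF A] fun_subalg_add[OF A] fun_subalg_mult[OF A] t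
    by simp
qed

lemma torus_in_SZ: "x \<in> SZ \<Longrightarrow> torus_act m n z x \<in> SZ"
  using Z_scale lin_subspace_scale[OF lin_dual_S] by (auto simp: torus_act_def)

text \<open>The weight is \<open>length us\<close> minus \<open>d * length ys\<close>; its negative
  part stands on the left so that only natural exponents occur.\<close>

lemma mon_torus:
  assumes "z \<noteq> 0"
  shows "mon us ys (torus_act m n z x) * z ^ (d * length ys) = z ^ length us * mon us ys x"
proof -
  have "z powi (int n - int m) = inverse (z ^ d)"
    using nm by (simp add: power_int_def nat_diff_distrib' power_inverse)
  then have 1: "snd (torus_act m n z x) y = inverse (z ^ d) * snd x y" for y
    by (simp add: torus_act_def split_beta)
  have 2: "fst (torus_act m n z x) u = z * fst x u" for u
    by (simp add: torus_act_def split_beta)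
  have 3: "(\<Prod>u\<leftarrow>us. z * fst x u) = z ^ length us * (\<Prod>u\<leftarrow>us. fst x u)" by (induction us) simp_all
  have 4: "(\<Prod>y\<leftarrow>ys. inverse (z ^ d) * snd x y) * z ^ (d * length ys) = (\<Prod>y\<leftarrow>ys. snd x y)"
    using assms by (induction ys) (simp_all add: power_add field_simps)
  show ?thesis unfolding mon_def 1 2 3 using 4 by (simp add: mult_ac)
qed

lemma mon_in_Inv:
  assumes "length us = d * length ys" shows "ext0 SZ (mon us ys) \<in> Inv"
proof -
  have "(\<lambda>x. ext0 SZ (\<lambda>x. \<Prod>u\<leftarrow>us. fst x u) x * ext0 SZ (\<lambda>x. \<Prod>y\<leftarrow>ys. snd x y) x) \<in> fns (varSZ m n)"
    by (intro fun_subalg_mult[OF subalg_SZ] fun_subalg_prod_list[OF subalg_SZ, where g = "\<lambda>u x. fst x u"]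
        fun_subalg_prod_list[OF subalg_SZ, where g = "\<lambda>u x. snd x u"] coord_fst coord_snd)
  moreover have "(\<lambda>x. ext0 SZ (\<lambda>x. \<Prod>u\<leftarrow>us. fst x u) x * ext0 SZ (\<lambda>x. \<Prod>y\<leftarrow>ys. snd x y) x) = ext0 SZ (mon us ys)"
    by (rule ext) (simp add: ext0_def mon_def)
  moreover have "ext0 SZ (mon us ys) (torus_act m n z x) = ext0 SZ (mon us ys) x" if "z \<noteq> 0" "x \<in> SZ" for z x
    using mon_torus[OF that(1), of us ys x] torus_in_SZ[OF that(2)] that assms by simp
  ultimately show ?thesis by (simp add: invariants_def pts_SZ)
qed

text \<open>For an invariant the value along a torus orbit does not depend on z, so only terms of
  weight 0 survive a comparison of powers of z.\<close>

lemma Inv_expand: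
  assumes e: "eval_frame Sn P2 e2" and a: "a \<in> Inv"
  shows "\<exists>ts. (\<forall>t\<in>set ts. set (fst (snd t)) \<subseteq> unit_vec ` idxS m n \<and> set (snd (snd t)) \<subseteq> P2 \<and>
      length (fst (snd t)) = d * length (snd (snd t))) \<and>
    (\<forall>x\<in>SZ. a x = (\<Sum>t\<leftarrow>ts. fst t * mon (fst (snd t)) (snd (snd t)) x))"
proof -
  have aS: "a \<in> fns (varSZ m n)" and inv: "\<And>z x. z \<noteq> 0 \<Longrightarrow> x \<in> SZ \<Longrightarrow> a (torus_act m n z x) = a x"
    using a by (auto simp: invariants_def pts_SZ)
  obtain ts where ts: "expr_over (unit_vec ` idxS m n <+> P2) ts" "\<forall>x\<in>SZ. a x = poly_expr coordinate ts x"
    using SZ_expand[OF e aS] by blast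
  define us where "us = map (\<lambda>t. (fst t, lefts (snd t), rights (snd t))) ts"
  have us: "set (fst (snd t)) \<subseteq> unit_vec ` idxS m n \<and> set (snd (snd t)) \<subseteq> P2" if "t \<in> set us" for t
    using that ts(1) unfolding us_def expr_over_def lefts_def rights_def by fastforce
  have a_eq: "a x = (\<Sum>t\<leftarrow>us. fst t * mon (fst (snd t)) (snd (snd t)) x)" if "x \<in> SZ" for x
    using bspec[OF ts(2) that] by (simp add: us_def poly_expr_def prod_coordinate comp_def)
  \<comment> \<open>An upper bound for the number of f-factors. Multiplying by z^(d N) makes all
    exponents natural, and weight 0 becomes \<open>k t = d * N\<close>.\<close>
  define N where "N = (\<Sum>t\<leftarrow>us. length (snd (snd t)))"
  have N: "length (snd (snd t)) \<le> N" if "t \<in> set us" for t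
    unfolding N_def using that by (intro member_le_sum_list) auto
  define k where "k = (\<lambda>t::complex \<times> cmat list \<times> cmat list. length (fst (snd t)) + d * (N - length (snd (snd t))))"
  define vs where "vs = filter (\<lambda>t. k t = d * N) us"
  have "a x = (\<Sum>t\<leftarrow>vs. fst t * mon (fst (snd t)) (snd (snd t)) x)" if x: "x \<in> SZ" for x
  proof -
    have "(\<Sum>t\<leftarrow>us. (fst t * mon (fst (snd t)) (snd (snd t)) x) * z ^ k t) = a x * z ^ (d * N)" if z: "z \<noteq> 0" for z
    proof -
      have step: "fst t * mon (fst (snd t)) (snd (snd t)) (torus_act m n z x) * z ^ (d * N) =
          (fst t * mon (fst (snd t)) (snd (snd t)) x) * z ^ k t" if "t \<in> set us" for t
      proof -
        have "d * N = d * length (snd (snd t)) + d * (N - length (snd (snd t)))"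
          using N[OF that] by (simp add: add_mult_distrib2[symmetric])
        then have "z ^ (d * N) = z ^ (d * length (snd (snd t))) * z ^ (d * (N - length (snd (snd t))))"
          by (simp add: power_add)
        then show ?thesis
          using mon_torus[OF z, of "fst (snd t)" "snd (snd t)" x] by (simp add: k_def power_add mult_ac)
      qed
      have "(\<Sum>t\<leftarrow>us. (fst t * mon (fst (snd t)) (snd (snd t)) x) * z ^ k t) =
          (\<Sum>t\<leftarrow>us. fst t * mon (fst (snd t)) (snd (snd t)) (torus_act m n z x) * z ^ (d * N))"
        by (intro arg_cong[of _ _ sum_list] map_cong refl) (rule step[symmetric])
      also have "\<dots> = a (torus_act m n z x) * z ^ (d * N)"
        unfolding a_eq[OF torus_in_SZ[OF x]] by (simp add: sum_list_mult_const)
      finally show ?thesis using inv[OF z x] by simp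
    qed
    from compare_powers[OF this] show ?thesis by (simp add: vs_def)
  qed
  moreover have "length (fst (snd t)) = d * length (snd (snd t))" if "t \<in> set vs" for t
  proof -
    have t: "t \<in> set us" "length (fst (snd t)) + d * (N - length (snd (snd t))) = d * N"
      using that by (auto simp: vs_def k_def)
    have "d * N = d * length (snd (snd t)) + d * (N - length (snd (snd t)))"
      using N[OF t(1)] by (simp add: add_mult_distrib2[symmetric])
    then show ?thesis using t(2) by linarith
  qed
  moreover have "set vs \<subseteq> set us" by (auto simp: vs_def)
  ultimately show ?thesis using us by (intro exI[of _ vs]) blast
qed

section \<open>The induced morphism\<close>

abbreviation "\<phi> \<equiv> mult_map m n"
abbreviation "P \<equiv> max_spec SZ Inv"

lemma quotSZ_spec: "quotSZ m n = spec_variety SZ Inv"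
  unfolding quotSZ_def git_quotient_spec_variety pts_SZ ..

lemma pts_quot: "pts (quotSZ m n) = P" and
  fns_quot: "fns (quotSZ m n) = (\<lambda>a. ext0 P (\<lambda>\<xi>. \<xi> a)) ` Inv"
  by (simp_all add: quotSZ_spec)

lemma fun_variety_quot: "fun_variety (quotSZ m n)"
  unfolding quotSZ_spec by (rule fun_variety_spec_variety[OF subalg_Inv])

lemma hom_P: "\<xi> \<in> P \<Longrightarrow> alg_hom SZ Inv \<xi>"
  by (simp add: max_spec_iff)

lemma varQ_simps: "pts (varQ m) = Sm" "fns (varQ m) = fun_alg Sm (dual Sm)"
  by (simp_all add: varQ_def)

lemma mult_map_apply: "X \<in> E \<Longrightarrow> \<phi> x X = fst x (prS X) ^ d * snd x X"
  by (simp add: mult_map_def split_beta bar_apply)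

lemma mult_map_outside: "x \<in> SZ \<Longrightarrow> X \<notin> E \<Longrightarrow> \<phi> x X = 0"
  using Z_sub sym_power_dualD(3)[of "snd x" n E X] by (auto simp: mult_map_def split_beta)

lemma mult_map_mon: "x \<in> SZ \<Longrightarrow> \<phi> x X = mon (replicate d (prS X)) [X] x"
proof (cases "X \<in> E")
  case False
  moreover assume "x \<in> SZ"
  moreover have "snd x X = 0"
    using \<open>x \<in> SZ\<close> Z_sub sym_power_dualD(3)[of "snd x" n E X] False by auto
  ultimately show ?thesis by (simp add: mult_map_outside mon_def)
qed (simp add: mult_map_apply mon_def)

lemma bar_dual: "l \<in> dual S \<Longrightarrow> bar m n l \<in> dual E"
  unfolding bar_def
  by (rule dualI) (auto simp: ext0_add ext0_scale dual_add[OF subspaces(2) _ prS_in prS_in]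
      dual_scale[OF subspaces(2) _ prS_in] lin_subspace_add[OF subspaces(1)] lin_subspace_scale[OF subspaces(1)])

lemma mult_map_in: "x \<in> SZ \<Longrightarrow> \<phi> x \<in> Sm"
proof -
  assume x: "x \<in> SZ"
  then have "(\<lambda>X. bar m n (fst x) X ^ d * snd x X) \<in> sym_power_dual (d + n) E"
    using Z_sub by (intro power_dual_mult_in_sym_power_dual[OF subspaces(1) bar_dual]) auto
  then show ?thesis using dn by (simp add: mult_map_def split_beta)
qed

lemma mult_map_coord: "ext0 SZ (\<lambda>x. \<phi> x X) \<in> Inv"
proof -
  have "ext0 SZ (\<lambda>x. \<phi> x X) = ext0 SZ (mon (replicate d (prS X)) [X])"
    by (rule ext0_cong) (rule mult_map_mon)
  then show ?thesis using mon_in_Inv[of "replicate d (prS X)" "[X]"] by simp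
qed

lemma pull_mult_map: "b \<in> fun_alg Sm (dual Sm) \<Longrightarrow> ext0 SZ (\<lambda>x. b (\<phi> x)) \<in> Inv"
proof -
  obtain P3 e3 where "eval_frame Sm P3 e3" using frame_Sym by blast
  then show "b \<in> fun_alg Sm (dual Sm) \<Longrightarrow> ext0 SZ (\<lambda>x. b (\<phi> x)) \<in> Inv"
    by (rule pullback_in_subalg[OF subalg_Inv lin_Sym _ order_refl mult_map_in mult_map_coord])
qed

lemma alpha_unique:
  assumes y: "y \<in> Sm" "\<forall>b\<in>fun_alg Sm (dual Sm). b y = \<xi> (ext0 SZ (\<lambda>x. b (\<phi> x)))"
  shows "alpha m n \<xi> = y"
  unfolding alpha_def git_induced_def varQ_simps pts_SZ
proof (rule the_equality)
  show "y \<in> Sm \<and> (\<forall>b\<in>fun_alg Sm (dual Sm). b y = \<xi> (ext0 SZ (\<lambda>x. b (\<phi> x))))" using y by blast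
  fix y' assume y': "y' \<in> Sm \<and> (\<forall>b\<in>fun_alg Sm (dual Sm). b y' = \<xi> (ext0 SZ (\<lambda>x. b (\<phi> x))))"
  show "y' = y"
    by (rule fun_alg_dual_separates[OF lin_Sym order_refl]) (use y y' in auto)
qed

text \<open>The point described in \<open>git_induced\<close> exists: it is the image of the
  character \<open>\<xi>\<close> under the product map.\<close>

lemma alpha_spec:
  assumes \<xi>: "\<xi> \<in> P"
  shows "alpha m n \<xi> \<in> Sm" "b \<in> fun_alg Sm (dual Sm) \<Longrightarrow> b (alpha m n \<xi>) = \<xi> (ext0 SZ (\<lambda>x. b (\<phi> x)))"
proof -
  obtain P3 e3 where e3: "eval_frame Sm P3 e3" using frame_Sym by blast
  obtain y where y: "y \<in> Sm" "\<forall>b\<in>fun_alg Sm (dual Sm). b y = \<xi> (ext0 SZ (\<lambda>x. b (\<phi> x)))"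
    using alg_hom_pullback_point[OF subalg_Inv lin_Sym e3 mult_map_in mult_map_coord hom_P[OF \<xi>]] by blast
  note alpha_unique[OF y]
  then show "alpha m n \<xi> \<in> Sm" "b \<in> fun_alg Sm (dual Sm) \<Longrightarrow> b (alpha m n \<xi>) = \<xi> (ext0 SZ (\<lambda>x. b (\<phi> x)))"
    using y by simp_all
qed

lemma projSZ_apply: "a \<in> Inv \<Longrightarrow> projSZ m n x a = a x"
  by (simp add: projSZ_def git_proj_def)

lemma projSZ_in: "x \<in> SZ \<Longrightarrow> projSZ m n x \<in> P"
  unfolding max_spec_iff alg_hom_def
  by (auto simp: projSZ_apply fun_subalg_const[OF subalg_Inv] fun_subalg_add[OF subalg_Inv]
      fun_subalg_mult[OF subalg_Inv]) (simp add: projSZ_def git_proj_def)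

lemma alpha_projSZ: "x \<in> SZ \<Longrightarrow> alpha m n (projSZ m n x) = \<phi> x"
  by (rule alpha_unique) (auto simp: mult_map_in projSZ_apply pull_mult_map)

lemma projSZ_torus:
  assumes "z \<noteq> 0" "x \<in> SZ" shows "projSZ m n (torus_act m n z x) = projSZ m n x"
proof
  fix a show "projSZ m n (torus_act m n z x) a = projSZ m n x a"
    using assms by (cases "a \<in> Inv") (auto simp: projSZ_def git_proj_def invariants_def pts_SZ)
qed

end

context permanent_spaces
begin

section \<open>Density of the open stratum\<close>

lemma SZ_fix_fst:
  assumes a: "a \<in> fns (varSZ m n)" and l: "l \<in> dual S"
  shows "\<exists>b\<in>fun_alg Sn (dual Sn). \<forall>f\<in>Z m n. a (l, f) = b f"
  using a unfolding fns_SZ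
proof (induction rule: fun_alg.induct)
  case (const c)
  show ?case using l Z_sub by (intro bexI[of _ "ext0 Sn (\<lambda>_. c)"] fun_alg.const) (auto simp: subset_iff)
next
  case (gen f)
  then show ?case
  proof
    assume "f \<in> (\<lambda>f. f \<circ> fst) ` fun_alg (dual S) (dual (dual S))"
    then obtain h where "f = h \<circ> fst" by blast
    then show ?thesis
      using l Z_sub by (intro bexI[of _ "ext0 Sn (\<lambda>_. h l)"] fun_alg.const) (auto simp: subset_iff)
  next
    assume "f \<in> (\<lambda>g. g \<circ> snd) ` fun_alg (Z m n) (dual Sn)"
    then obtain h where h: "h \<in> fun_alg (Z m n) (dual Sn)" "f = h \<circ> snd" by blast
    obtain h' where h': "h' \<in> fun_alg Sn (dual Sn)" "h = ext0 (Z m n) h'"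
      using fun_alg_extend[OF Z_sub h(1)] by blast
    then show ?thesis using l h(2) by (intro bexI[of _ h']) auto
  qed
next
  case (add f g)
  then obtain b c where "b \<in> fun_alg Sn (dual Sn)" "\<forall>f'\<in>Z m n. f (l, f') = b f'"
    "c \<in> fun_alg Sn (dual Sn)" "\<forall>f'\<in>Z m n. g (l, f') = c f'" by blast
  then show ?case by (intro bexI[of _ "\<lambda>x. b x + c x"] fun_alg.add) simp_all
next
  case (mult f g)
  then obtain b c where "b \<in> fun_alg Sn (dual Sn)" "\<forall>f'\<in>Z m n. f (l, f') = b f'"
    "c \<in> fun_alg Sn (dual Sn)" "\<forall>f'\<in>Z m n. g (l, f') = c f'" by blast
  then show ?case by (intro bexI[of _ "\<lambda>x. b x * c x"] fun_alg.mult) simp_all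
qed

lemma SZ_fix_snd:
  assumes a: "a \<in> fns (varSZ m n)" and l: "l \<in> dual S" "l1 \<in> dual S" and f: "f \<in> Z m n"
  shows "\<exists>p. \<forall>t. a (\<lambda>v. l v + t * l1 v, f) = poly p t"
proof -
  have in_dual: "(\<lambda>v. l v + t * l1 v) \<in> dual S" for t
    using l by (intro lin_subspace_add[OF lin_dual_S] lin_subspace_scale[OF lin_dual_S])
  show ?thesis
    using a unfolding fns_SZ
  proof (induction rule: fun_alg.induct)
    case (const c)
    then show ?case using in_dual f by (intro exI[of _ "[:c:]"]) simp
  next
    case (gen h)
    then show ?case
    proof
      assume "h \<in> (\<lambda>f. f \<circ> fst) ` fun_alg (dual S) (dual (dual S))"
      then obtain k where k: "k \<in> fun_alg (dual S) (dual (dual S))" "h = k \<circ> fst" by blast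
      obtain p where "\<forall>t. k (\<lambda>v. l v + t * l1 v) = poly p t"
        using fun_alg_dual_line[OF lin_dual_S k(1) l] by blast
      then show ?thesis using in_dual f k(2) by (intro exI[of _ p]) simp
    next
      assume "h \<in> (\<lambda>g. g \<circ> snd) ` fun_alg (Z m n) (dual Sn)"
      then obtain k where k: "h = k \<circ> snd" by blast
      then show ?thesis using in_dual f by (intro exI[of _ "[:k f:]"]) simp
    qed
  next
    case (add h k)
    then obtain p q where "\<forall>t. h (\<lambda>v. l v + t * l1 v, f) = poly p t" "\<forall>t. k (\<lambda>v. l v + t * l1 v, f) = poly q t"
      by blast
    then show ?case by (intro exI[of _ "p + q"]) simp
  next
    case (mult h k)
    then obtain p q where "\<forall>t. h (\<lambda>v. l v + t * l1 v, f) = poly p t" "\<forall>t. k (\<lambda>v. l v + t * l1 v, f) = poly q t"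
      by blast
    then show ?case by (intro exI[of _ "p * q"]) simp
  qed
qed

text \<open>Density is shown one factor at a time. With \<lambda> fixed, f moves from
  \<open>Zo\<close> to \<open>Z\<close> by the definition of the closure; then \<lambda> reaches the
  hyperplane \<open>dualS1\<close> along a line in the direction of the coordinate x11.\<close>

lemma SZ_density:
  assumes a: "a \<in> fns (varSZ m n)"
    and 0: "\<And>x. x \<in> (dual S - dualS1 m n) \<times> Zo m n \<Longrightarrow> a x = 0"
    and x: "x \<in> SZ"
  shows "a x = 0"
proof -
  obtain l f where lf: "x = (l, f)" "l \<in> dual S" "f \<in> Z m n" using x by auto
  have first: "a (l', f) = 0" if l': "l' \<in> dual S" "l' e11 \<noteq> 0" for l'
  proof -
    obtain b where b: "b \<in> fun_alg Sn (dual Sn)" "\<forall>f\<in>Z m n. a (l', f) = b f"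
      using SZ_fix_fst[OF a l'(1)] by blast
    have "b f = 0"
    proof (rule Z_vanish[OF lf(3) b(1)])
      fix g assume g: "g \<in> Zo m n"
      then show "b g = 0" using b(2) 0[of "(l', g)"] l' Zo_sub_Z by (auto simp: dualS1_iff)
    qed
    then show ?thesis using b(2) lf(3) by simp
  qed
  show ?thesis
  proof (cases "l e11 = 0")
    case True
    define l1 where "l1 = ext0 S (\<lambda>X. X (1, 1))"
    have l1: "l1 \<in> dual S" unfolding l1_def by (rule evaluation_in_dual[OF subspaces(2)])
    have "l1 e11 = 1" using e11_in by (simp add: l1_def unit_vec_def)
    obtain p where p: "\<forall>t. a (\<lambda>v. l v + t * l1 v, f) = poly p t"
      using SZ_fix_snd[OF a lf(2) l1 lf(3)] by blast
    have "poly p t = 0" if "t \<noteq> 0" for t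
    proof -
      have "(\<lambda>v. l v + t * l1 v) \<in> dual S"
        using lf(2) l1 by (intro lin_subspace_add[OF lin_dual_S] lin_subspace_scale[OF lin_dual_S])
      then show ?thesis using p first[of "\<lambda>v. l v + t * l1 v"] True \<open>l1 e11 = 1\<close> that by simp
    qed
    then have "p = 0" by (rule poly_eq_0_punctured)
    then show ?thesis using p[rule_format, of 0] lf(1) by simp
  qed (use first[of l] lf in simp)
qed

section \<open>Points of the quotient\<close>

lemma hom_mon_mult:
  assumes \<xi>: "\<xi> \<in> P" and "length us = d * length ys" "length us' = d * length ys'"
  shows "\<xi> (ext0 SZ (mon (us @ us') (ys @ ys'))) = \<xi> (ext0 SZ (mon us ys)) * \<xi> (ext0 SZ (mon us' ys'))"
proof -
  have "ext0 SZ (mon (us @ us') (ys @ ys')) = (\<lambda>x. ext0 SZ (mon us ys) x * ext0 SZ (mon us' ys') x)"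
    by (rule ext) (simp add: ext0_def mon_append)
  then show ?thesis
    using alg_hom_mult[OF subalg_Inv hom_P[OF \<xi>]] mon_in_Inv assms(2,3) by simp
qed

text \<open>Products of d values of \<lambda> with a single value of f generate the invariants: a
  longer monomial is cut into blocks, one for each f-factor.\<close>

lemma P_eqI:
  assumes \<xi>: "\<xi> \<in> P" "\<xi>' \<in> P" and e: "eval_frame Sn P2 e2"
    and eq: "\<And>us y. set us \<subseteq> unit_vec ` idxS m n \<Longrightarrow> length us = d \<Longrightarrow>
      \<xi> (ext0 SZ (mon us [y])) = \<xi>' (ext0 SZ (mon us [y]))"
  shows "\<xi> = \<xi>'"
proof
  fix a
  have mons: "\<xi> (ext0 SZ (mon us ys)) = \<xi>' (ext0 SZ (mon us ys))"
    if "set us \<subseteq> unit_vec ` idxS m n" "length us = d * length ys" for us ys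
    using that
  proof (induction ys arbitrary: us)
    case Nil
    then have "ext0 SZ (mon us []) = ext0 SZ (\<lambda>_. 1)" by (intro ext0_cong) (simp add: mon_def)
    then show ?case
      using alg_hom_const[OF subalg_Inv hom_P[OF \<xi>(1)]] alg_hom_const[OF subalg_Inv hom_P[OF \<xi>(2)]] by simp
  next
    case (Cons y ys)
    have s: "set (take d us) \<subseteq> unit_vec ` idxS m n" "set (drop d us) \<subseteq> unit_vec ` idxS m n"
      using Cons.prems(1) set_take_subset set_drop_subset by fast+
    have len: "length (take d us) = d" "length (drop d us) = d * length ys" using Cons.prems(2) by auto
    have split: "\<xi>'' (ext0 SZ (mon us (y # ys))) = \<xi>'' (ext0 SZ (mon (take d us) [y])) * \<xi>'' (ext0 SZ (mon (drop d us) ys))"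
      if "\<xi>'' \<in> P" for \<xi>''
      using hom_mon_mult[OF that, of "take d us" "[y]" "drop d us" ys] len by simp
    show ?case unfolding split[OF \<xi>(1)] split[OF \<xi>(2)] eq[OF s(1) len(1)] Cons.IH[OF s(2) len(2)] ..
  qed
  show "\<xi> a = \<xi>' a"
  proof (cases "a \<in> Inv")
    case True
    obtain ts where ts: "\<forall>t\<in>set ts. set (fst (snd t)) \<subseteq> unit_vec ` idxS m n \<and> set (snd (snd t)) \<subseteq> P2 \<and>
        length (fst (snd t)) = d * length (snd (snd t))"
      "\<forall>x\<in>SZ. a x = (\<Sum>t\<leftarrow>ts. fst t * mon (fst (snd t)) (snd (snd t)) x)"
      using Inv_expand[OF e True] by blast
    have "a = ext0 SZ (\<lambda>x. \<Sum>t\<leftarrow>ts. fst t * mon (fst (snd t)) (snd (snd t)) x)"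
    proof
      fix x show "a x = ext0 SZ (\<lambda>x. \<Sum>t\<leftarrow>ts. fst t * mon (fst (snd t)) (snd (snd t)) x) x"
        using bspec[OF ts(2), of x] fun_subalg_outside[OF subalg_Inv True, of x] by (cases "x \<in> SZ") simp_all
    qed
    moreover have "ext0 SZ (\<lambda>x. \<Sum>t\<leftarrow>ts. fst t * mon (fst (snd t)) (snd (snd t)) x) \<in> Inv \<and>
        \<xi>'' (ext0 SZ (\<lambda>x. \<Sum>t\<leftarrow>ts. fst t * mon (fst (snd t)) (snd (snd t)) x)) =
        (\<Sum>t\<leftarrow>ts. fst t * \<xi>'' (ext0 SZ (mon (fst (snd t)) (snd (snd t)))))" if "\<xi>'' \<in> P" for \<xi>''
      using ts(1)
    proof (induction ts)
      case Nil
      then show ?case using fun_subalg_const[OF subalg_Inv, of 0] alg_hom_const[OF subalg_Inv hom_P[OF that], of 0] by simp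
    next
      case (Cons t ts)
      let ?m = "ext0 SZ (mon (fst (snd t)) (snd (snd t)))"
      let ?r = "ext0 SZ (\<lambda>x. \<Sum>t\<leftarrow>ts. fst t * mon (fst (snd t)) (snd (snd t)) x)"
      have eq: "ext0 SZ (\<lambda>x. \<Sum>t\<leftarrow>t # ts. fst t * mon (fst (snd t)) (snd (snd t)) x) = (\<lambda>x. fst t * ?m x + ?r x)"
        by (rule ext) (simp add: ext0_def)
      have m: "?m \<in> Inv" using Cons.prems by (intro mon_in_Inv) simp
      have r: "?r \<in> Inv" "\<xi>'' ?r = (\<Sum>t\<leftarrow>ts. fst t * \<xi>'' (ext0 SZ (mon (fst (snd t)) (snd (snd t)))))"
        using Cons by auto
      note sm = fun_subalg_scale[OF subalg_Inv m, of "fst t"]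
      show ?case
        unfolding eq using fun_subalg_add[OF subalg_Inv sm r(1)] alg_hom_add[OF subalg_Inv hom_P[OF that] sm r(1)]
          alg_hom_scale[OF subalg_Inv hom_P[OF that] m] r(2) by simp
    qed
    moreover have "(\<Sum>t\<leftarrow>ts. fst t * \<xi> (ext0 SZ (mon (fst (snd t)) (snd (snd t))))) =
        (\<Sum>t\<leftarrow>ts. fst t * \<xi>' (ext0 SZ (mon (fst (snd t)) (snd (snd t)))))"
      using mons ts(1) by (intro arg_cong[of _ _ sum_list] map_cong refl) simp
    ultimately show ?thesis using \<xi> by simp
  next
    case False
    then show ?thesis using \<xi> by (simp add: max_spec_iff)
  qed
qed

lemma projSZ_mon: "x \<in> SZ \<Longrightarrow> length us = d * length ys \<Longrightarrow> projSZ m n x (ext0 SZ (mon us ys)) = mon us ys x"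
  using projSZ_apply[OF mon_in_Inv] by simp

(* A point at which all generators vanish is the image of (0, f). Otherwise some
   w = xi(l(u)^d f(y)) is nonzero; normalising l(u) = 1 determines l and f. *)
lemma projSZ_surj:
  assumes \<xi>: "\<xi> \<in> P" shows "\<exists>x\<in>SZ. \<xi> = projSZ m n x"
proof -
  obtain P2 e2 where e: "eval_frame Sn P2 e2" using frame_Sym by blast
  note hom = hom_P[OF \<xi>]
  show ?thesis
  proof (cases "\<exists>u y. \<xi> (ext0 SZ (mon (replicate d u) [y])) \<noteq> 0")
    case False
    \<comment> \<open>The d-th power of a mixed monomial is a product of pure ones, with one factor
      for each entry of \<open>us\<close>; so the vanishing of the pure monomials passes to all
      generators.\<close>
    have zero: "\<xi> (ext0 SZ (mon us [y])) = 0" if us: "length us = d" for us y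
    proof -
      have "\<xi> (ext0 SZ (\<lambda>x. \<Prod>u\<leftarrow>us. ext0 SZ (mon (replicate d u) [y]) x)) =
          (\<Prod>u\<leftarrow>us. \<xi> (ext0 SZ (ext0 SZ (mon (replicate d u) [y]))))"
        using alg_hom_prod_list[OF subalg_Inv hom, of us "\<lambda>u. ext0 SZ (mon (replicate d u) [y])"] mon_in_Inv
        by (simp add: ext0_ext0)
      also have "\<dots> = 0" using False us d_pos by (cases us) (simp_all add: ext0_ext0)
      finally have 1: "\<xi> (ext0 SZ (\<lambda>x. \<Prod>u\<leftarrow>us. ext0 SZ (mon (replicate d u) [y]) x)) = 0" .
      have 2: "(\<Prod>u\<leftarrow>us. mon (replicate d u) [y] x) = (\<Prod>u\<leftarrow>us. fst x u) ^ d * snd x y ^ length us" for x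
        by (induction us) (simp_all add: mon_def power_mult_distrib mult_ac)
      have "ext0 SZ (\<lambda>x. \<Prod>u\<leftarrow>us. ext0 SZ (mon (replicate d u) [y]) x) = ext0 SZ (\<lambda>x. poly (monom 1 d) (ext0 SZ (mon us [y]) x))"
      proof (rule ext0_cong)
        fix x assume x: "x \<in> SZ"
        then have "(\<Prod>u\<leftarrow>us. ext0 SZ (mon (replicate d u) [y]) x) = (\<Prod>u\<leftarrow>us. mon (replicate d u) [y] x)" by simp
        also have "\<dots> = mon us [y] x ^ d" unfolding 2 us by (simp add: mon_def power_mult_distrib)
        finally show "(\<Prod>u\<leftarrow>us. ext0 SZ (mon (replicate d u) [y]) x) = poly (monom 1 d) (ext0 SZ (mon us [y]) x)"
          using x by (simp add: poly_monom)
      qed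
      then have "\<xi> (ext0 SZ (mon us [y])) ^ d = 0"
        using 1 alg_hom_poly[OF subalg_Inv hom mon_in_Inv[of us "[y]"], of "monom 1 d"] us by (simp add: poly_monom)
      then show ?thesis by simp
    qed
    obtain f where f: "f \<in> Zo m n" using Zo_nonempty by blast
    have x: "(\<lambda>_. 0, f) \<in> SZ" using f Zo_sub_Z lin_subspace_zero[OF lin_dual_S] by auto
    have "\<xi> = projSZ m n (\<lambda>_. 0, f)"
    proof (rule P_eqI[OF \<xi> projSZ_in[OF x] e])
      fix us :: "cmat list" and y assume us: "length us = d"
      have "mon us [y] (\<lambda>_. 0, f) = 0" using us d_pos by (cases us) (simp_all add: mon_def)
      then show "\<xi> (ext0 SZ (mon us [y])) = projSZ m n (\<lambda>_. 0, f) (ext0 SZ (mon us [y]))"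
        using zero[OF us] projSZ_mon[OF x, of us "[y]"] us by simp
    qed
    then show ?thesis using x by blast
  next
    case True
    then obtain u y where w0: "\<xi> (ext0 SZ (mon (replicate d u) [y])) \<noteq> 0" by blast
    define w where "w = \<xi> (ext0 SZ (mon (replicate d u) [y]))"
    have w: "w \<noteq> 0" using w0 by (simp add: w_def)
    \<comment> \<open>When \<lambda>(u) is normalised to 1, the form is the invariant \<lambda>(u)^d
      f, and it stays in the cone \<open>Z\<close>.\<close>
    define \<tau> where "\<tau> = (\<lambda>x::poly_fun \<times> poly_fun. \<lambda>X. fst x u ^ d * snd x X)"
    have \<tau>Z: "\<tau> x \<in> Z m n" if "x \<in> SZ" for x using that Z_scale by (auto simp: \<tau>_def)
    then have \<tau>: "\<tau> x \<in> Sn" if "x \<in> SZ" for x using that Z_sub by blast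
    have \<tau>c: "ext0 SZ (\<lambda>x. \<tau> x p) = ext0 SZ (mon (replicate d u) [p])" for p
      by (rule ext0_cong) (simp add: \<tau>_def mon_def)
    have \<tau>I: "ext0 SZ (\<lambda>x. \<tau> x p) \<in> Inv" for p unfolding \<tau>c by (rule mon_in_Inv) simp
    obtain f where f: "f \<in> Sn" "\<forall>b\<in>fun_alg Sn (dual Sn). b f = \<xi> (ext0 SZ (\<lambda>x. b (\<tau> x)))"
      using alg_hom_pullback_point[OF subalg_Inv lin_Sym e \<tau> \<tau>I hom] by blast
    have fp: "f p = \<xi> (ext0 SZ (mon (replicate d u) [p]))" for p
    proof -
      have "f p = \<xi> (ext0 SZ (\<lambda>x. ext0 Sn (\<lambda>g. g p) (\<tau> x)))"
        using f(1) bspec[OF f(2) evaluation_in_fun_alg[OF lin_Sym[of n] order_refl, of p]] by simp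
      also have "ext0 SZ (\<lambda>x. ext0 Sn (\<lambda>g. g p) (\<tau> x)) = ext0 SZ (\<lambda>x. \<tau> x p)"
        using \<tau> by (intro ext0_cong) simp
      finally show ?thesis unfolding \<tau>c .
    qed
    have fZ: "f \<in> Z m n"
      unfolding Z_iff
    proof (intro conjI ballI impI f(1))
      fix b assume b: "b \<in> fun_alg Sn (dual Sn)" "\<forall>g\<in>Zo m n. b g = 0"
      have "b (\<tau> x) = 0" if "x \<in> SZ" for x
        by (rule Z_vanish[OF \<tau>Z[OF that] b(1)]) (use b(2) in simp)
      then have "ext0 SZ (\<lambda>x. b (\<tau> x)) = ext0 SZ (\<lambda>_. 0)" by (rule ext0_cong)
      then show "b f = 0" using bspec[OF f(2) b(1)] alg_hom_const[OF subalg_Inv hom, of 0] by simp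
    qed
    \<comment> \<open>Under the same normalisation f(y) is \<open>w\<close>, so the invariant
      \<lambda>(u)^(d - 1) f(y) \<lambda> is \<open>w\<close> times the functional sought.\<close>
    define \<sigma> where "\<sigma> = (\<lambda>x::poly_fun \<times> poly_fun. \<lambda>v. (fst x u ^ (d - 1) * snd x y) * fst x v)"
    have \<sigma>: "\<sigma> x \<in> dual S" if "x \<in> SZ" for x
      using that lin_subspace_scale[OF lin_dual_S] unfolding \<sigma>_def by auto
    have \<sigma>c: "ext0 SZ (\<lambda>x. \<sigma> x v) = ext0 SZ (mon (v # replicate (d - 1) u) [y])" for v
      by (rule ext0_cong) (simp add: \<sigma>_def mon_def)
    have \<sigma>I: "ext0 SZ (\<lambda>x. \<sigma> x v) \<in> Inv" for v unfolding \<sigma>c using d_pos by (intro mon_in_Inv) simp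
    obtain e1 where e1: "eval_frame (dual S) (unit_vec ` idxS m n) e1" using frame_dual_S by blast
    obtain l0 where l0: "l0 \<in> dual S" "\<forall>b\<in>fun_alg (dual S) (dual (dual S)). b l0 = \<xi> (ext0 SZ (\<lambda>x. b (\<sigma> x)))"
      using alg_hom_pullback_point[OF subalg_Inv lin_dual_S e1 \<sigma> \<sigma>I hom] by blast
    have l0v: "l0 v = \<xi> (ext0 SZ (\<lambda>x. \<sigma> x v))" for v
    proof -
      have "l0 v = \<xi> (ext0 SZ (\<lambda>x. ext0 (dual S) (\<lambda>g. g v) (\<sigma> x)))"
        using l0(1) bspec[OF l0(2) evaluation_in_fun_alg[OF lin_dual_S order_refl, of v]] by simp
      also have "ext0 SZ (\<lambda>x. ext0 (dual S) (\<lambda>g. g v) (\<sigma> x)) = ext0 SZ (\<lambda>x. \<sigma> x v)"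
        using \<sigma> by (intro ext0_cong) simp
      finally show ?thesis .
    qed
    define l where "l = (\<lambda>v. inverse w * l0 v)"
    have x: "(l, f) \<in> SZ" using fZ lin_subspace_scale[OF lin_dual_S l0(1)] by (simp add: l_def)
    have "\<xi> = projSZ m n (l, f)"
    proof (rule P_eqI[OF \<xi> projSZ_in[OF x] e])
      fix us :: "cmat list" and p assume us: "length us = d"
      let ?A = "ext0 SZ (\<lambda>x. \<Prod>v\<leftarrow>us. \<sigma> x v)" and ?B = "ext0 SZ (mon (replicate d u) [p])"
      let ?C = "ext0 SZ (\<lambda>x. poly (monom 1 d) (ext0 SZ (mon (replicate d u) [y]) x))"
      have A: "?A \<in> Inv" using fun_subalg_prod_list[OF subalg_Inv, of us "\<lambda>v x. \<sigma> x v"] \<sigma>I by simp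
      have B: "?B \<in> Inv" by (rule mon_in_Inv) simp
      have C: "?C \<in> Inv" by (rule fun_subalg_poly[OF subalg_Inv mon_in_Inv]) simp
      have M: "ext0 SZ (mon us [p]) \<in> Inv" using us by (intro mon_in_Inv) simp
      \<comment> \<open>The powers of \<lambda>(u) match because (d - 1) d + d is the square of d.
        Under \<open>\<xi>\<close> the identity becomes, after division by w^d, agreement with the
        pair on a generator.\<close>
      have "(\<lambda>x. ?A x * ?B x) = (\<lambda>x. ext0 SZ (mon us [p]) x * ?C x)"
      proof
        fix x show "?A x * ?B x = ext0 SZ (mon us [p]) x * ?C x"
        proof (cases "x \<in> SZ")
          case True
          have "(\<Prod>v\<leftarrow>us. \<sigma> x v) = (fst x u ^ (d - 1) * snd x y) ^ length us * (\<Prod>v\<leftarrow>us. fst x v)"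
            by (induction us) (simp_all add: \<sigma>_def)
          then have *: "(\<Prod>v\<leftarrow>us. \<sigma> x v) = (fst x u ^ (d - 1) * snd x y) ^ d * (\<Prod>v\<leftarrow>us. fst x v)" by (simp add: us)
          have "(fst x u ^ (d - 1)) ^ d * fst x u ^ d = (fst x u ^ d) ^ d"
          proof -
            have "(d - 1) * d + d = d * d" using d_pos by (metis Suc_diff_1 add.commute mult_Suc)
            then show ?thesis by (simp add: power_mult[symmetric] power_add[symmetric])
          qed
          then have "(fst x u ^ (d - 1) * snd x y) ^ d * fst x u ^ d = (fst x u ^ d * snd x y) ^ d"
            by (simp add: power_mult_distrib mult_ac)
          then have "(\<Prod>v\<leftarrow>us. \<sigma> x v) * (fst x u ^ d * snd x p) = (\<Prod>v\<leftarrow>us. fst x v) * snd x p * (fst x u ^ d * snd x y) ^ d"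
            unfolding * by (simp add: mult_ac)
          then show ?thesis using True by (simp add: mon_def poly_monom)
        qed simp
      qed
      then have AB: "\<xi> ?A * \<xi> ?B = \<xi> (ext0 SZ (mon us [p])) * \<xi> ?C"
        using alg_hom_mult[OF subalg_Inv hom A B] alg_hom_mult[OF subalg_Inv hom M C] by simp
      have Cw: "\<xi> ?C = w ^ d"
        using alg_hom_poly[OF subalg_Inv hom mon_in_Inv[of "replicate d u" "[y]"], of "monom 1 d"]
        by (simp add: poly_monom w_def)
      have Al: "\<xi> ?A = (\<Prod>v\<leftarrow>us. l0 v)"
        using alg_hom_prod_list[OF subalg_Inv hom, of us "\<lambda>v x. \<sigma> x v"] \<sigma>I by (simp add: l0v)
      have "(\<Prod>v\<leftarrow>us. l v) = inverse w ^ length us * (\<Prod>v\<leftarrow>us. l0 v)"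
        by (induction us) (simp_all add: l_def)
      then have "(\<Prod>v\<leftarrow>us. l0 v) = w ^ d * (\<Prod>v\<leftarrow>us. l v)" using w us by (simp add: power_inverse)
      with AB have "w ^ d * (\<Prod>v\<leftarrow>us. l v) * f p = \<xi> (ext0 SZ (mon us [p])) * w ^ d"
        unfolding Cw Al fp by (simp only:)
      then have "w ^ d * \<xi> (ext0 SZ (mon us [p])) = w ^ d * ((\<Prod>v\<leftarrow>us. l v) * f p)"
        by (simp only: mult_ac)
      then have "\<xi> (ext0 SZ (mon us [p])) = (\<Prod>v\<leftarrow>us. l v) * f p" using w by simp
      then show "\<xi> (ext0 SZ (mon us [p])) = projSZ m n (l, f) (ext0 SZ (mon us [p]))"
        using projSZ_mon[OF x, of us "[p]"] us by (simp add: mon_def)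
    qed
    then show ?thesis using x by blast
  qed
qed

section \<open>Finiteness\<close>

lemma pigeonhole_list:
  assumes "finite U" "set us \<subseteq> U" "length us > card U * K"
  shows "\<exists>u\<in>U. count_list us u > K"
proof (rule ccontr)
  assume "\<not> ?thesis"
  then have "(\<Sum>u\<in>U. count_list us u) \<le> (\<Sum>u\<in>U. K)" by (intro sum_mono) auto
  moreover have "(\<Sum>u\<in>U. count_list us u) = length us" using sum_count_set[OF assms(2,1)] .
  ultimately show False using assms(3) by simp
qed

lemma extract_from_list:
  assumes "count_list us u \<ge> K"
  shows "\<exists>vs. (\<forall>h::_ \<Rightarrow> complex. (\<Prod>v\<leftarrow>us. h v) = h u ^ K * (\<Prod>v\<leftarrow>vs. h v)) \<and> length us = K + length vs \<and> set vs \<subseteq> set us"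
  using assms
proof (induction K arbitrary: us)
  case 0
  then show ?case by (intro exI[of _ us]) simp
next
  case (Suc K)
  then have "u \<in> set us" by (metis count_notin not_less_eq_eq zero_le)
  then obtain as bs where ab: "us = as @ u # bs" by (meson split_list)
  then have "count_list (as @ bs) u \<ge> K" using Suc.prems by simp
  then obtain vs where vs: "\<forall>h::_ \<Rightarrow> complex. (\<Prod>v\<leftarrow>as @ bs. h v) = h u ^ K * (\<Prod>v\<leftarrow>vs. h v)"
    "length (as @ bs) = K + length vs" "set vs \<subseteq> set (as @ bs)" using Suc.IH by blast
  have "(\<Prod>v\<leftarrow>us. h v) = h u ^ Suc K * (\<Prod>v\<leftarrow>vs. h v)" for h :: "_ \<Rightarrow> complex"
    using vs(1)[rule_format, of h] by (simp add: ab mult_ac)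
  then show ?case using vs(2,3) ab by (intro exI[of _ vs]) auto
qed

lemma dual_expand:
  assumes "l \<in> dual S" "v \<in> S" shows "l v = (\<Sum>i\<in>idxS m n. v i * l (unit_vec i))"
  using dual_coord_space[OF finite_idx(2), of l v] assms by (simp add: spaceS_def)

(* If f enters with high multiplicity, some coordinate a = l(u) occurs in the monomial to the power m;
   by dedekind_mertens, a^m f(y) is a combination of values of l^d f with coefficients of degree n in l. *)
lemma finite_generation:
  assumes e: "eval_frame Sn P2 e2"
  shows "\<exists>M. finite M \<and> M \<subseteq> Inv \<and> (\<forall>a\<in>Inv. \<exists>c. (\<forall>b\<in>M. c b \<in> fun_alg Sm (dual Sm)) \<and>
    (\<forall>x\<in>SZ. a x = (\<Sum>b\<in>M. c b (\<phi> x) * b x)))"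
proof -
  let ?P1 = "unit_vec ` idxS m n :: cmat set"
  have P1S: "?P1 \<subseteq> S" by (rule image_subsetI) (simp add: spaceS_def unit_vec_in_coord_space)
  have P2: "finite P2" using e by (simp add: eval_frame_def)
  \<comment> \<open>With more than \<open>K\<close> f-factors there are more than
    \<open>card ?P1 * m\<close> factors \<lambda>, so one coordinate occurs more than m
    times.\<close>
  define K where "K = card ?P1 * m"
  define T where "T = {(us, ys). set us \<subseteq> ?P1 \<and> set ys \<subseteq> P2 \<and> length us = d * length ys \<and> length ys \<le> K}"
  define M where "M = (\<lambda>(us, ys). ext0 SZ (mon us ys)) ` T"
  have "T \<subseteq> {us. set us \<subseteq> ?P1 \<and> length us \<le> d * K} \<times> {ys. set ys \<subseteq> P2 \<and> length ys \<le> K}"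
    by (auto simp: T_def)
  then have "finite T"
    by (rule finite_subset) (intro finite_cartesian_product finite_lists_length_le finite_imageI finite_idx P2)
  then have M: "finite M" "M \<subseteq> Inv" using mon_in_Inv by (auto simp: M_def T_def)
  note A = fun_subalg_fun_alg[of Sm "dual Sm"]
  \<comment> \<open>Membership in the module generated by \<open>M\<close> over the polynomials in
    the product form; values off \<open>SZ\<close> are ignored.\<close>
  define inN where "inN = (\<lambda>a. \<exists>c. (\<forall>b\<in>M. c b \<in> fun_alg Sm (dual Sm)) \<and> (\<forall>x\<in>SZ. a x = (\<Sum>b\<in>M. c b (\<phi> x) * b x)))"
  have N_cong: "inN a'" if "inN a" "\<And>x. x \<in> SZ \<Longrightarrow> a' x = a x" for a a'
    using that unfolding inN_def by simp
  have N_0: "inN (\<lambda>_. 0)"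
    unfolding inN_def using fun_subalg_zero[OF A] by (intro exI[of _ "\<lambda>_ _. 0"]) simp
  have N_add: "inN (\<lambda>x. a x + a' x)" if "inN a" "inN a'" for a a'
  proof -
    from that(1) obtain c where c: "\<forall>b\<in>M. c b \<in> fun_alg Sm (dual Sm)" "\<forall>x\<in>SZ. a x = (\<Sum>b\<in>M. c b (\<phi> x) * b x)"
      unfolding inN_def by blast
    from that(2) obtain c' where c': "\<forall>b\<in>M. c' b \<in> fun_alg Sm (dual Sm)" "\<forall>x\<in>SZ. a' x = (\<Sum>b\<in>M. c' b (\<phi> x) * b x)"
      unfolding inN_def by blast
    show ?thesis unfolding inN_def
      using c c' by (intro exI[of _ "\<lambda>b y. c b y + c' b y"]) (simp add: fun_subalg_add[OF A] distrib_right sum.distrib)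
  qed
  have N_mult: "inN (\<lambda>x. q (\<phi> x) * a x)" if "inN a" "q \<in> fun_alg Sm (dual Sm)" for a q
  proof -
    from that(1) obtain c where c: "\<forall>b\<in>M. c b \<in> fun_alg Sm (dual Sm)" "\<forall>x\<in>SZ. a x = (\<Sum>b\<in>M. c b (\<phi> x) * b x)"
      unfolding inN_def by blast
    show ?thesis unfolding inN_def
      using c that(2) by (intro exI[of _ "\<lambda>b y. q y * c b y"]) (simp add: fun_subalg_mult[OF A] sum_distrib_left mult.assoc)
  qed
  have N_scale: "inN (\<lambda>x. k * a x)" if "inN a" for a k
    by (rule N_cong[OF N_mult[OF that fun_subalg_const[OF A, of k]]]) (simp add: mult_map_in)
  have N_sum: "inN (\<lambda>x. \<Sum>i\<in>I. a i x)" if "\<And>i. i \<in> I \<Longrightarrow> inN (a i)" for a and I :: "nat set"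
    using that by (induction I rule: infinite_finite_induct) (auto intro: N_0 N_add)
  have N_sum': "inN (\<lambda>x. \<Sum>i\<in>I. a i x)" if "\<And>i. i \<in> I \<Longrightarrow> inN (a i)" for a and I :: "(nat \<times> nat) set"
    using that by (induction I rule: infinite_finite_induct) (auto intro: N_0 N_add)
  have N_M: "inN (mon us ys)" if "(us, ys) \<in> T" for us ys
  proof -
    have "ext0 SZ (mon us ys) \<in> M" unfolding M_def by (rule image_eqI[OF _ that]) simp
    define q where "q = (\<lambda>b. if b = ext0 SZ (mon us ys) then ext0 Sm (\<lambda>_. 1) else (\<lambda>_. 0))"
    have "(\<Sum>b\<in>M. q b (\<phi> x) * b x) = mon us ys x" if x: "x \<in> SZ" for x
    proof -
      have "(\<Sum>b\<in>M. q b (\<phi> x) * b x) = (\<Sum>b\<in>M. if b = ext0 SZ (mon us ys) then mon us ys x else 0)"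
        using x mult_map_in[OF x] by (intro sum.cong) (auto simp: q_def)
      then show ?thesis using M(1) \<open>ext0 SZ (mon us ys) \<in> M\<close> by simp
    qed
    moreover have "q b \<in> fun_alg Sm (dual Sm)" for b
      using fun_subalg_zero[OF A] fun_subalg_const[OF A] by (simp add: q_def)
    ultimately show ?thesis unfolding inN_def by (intro exI[of _ q]) simp
  qed
  \<comment> \<open>By multilinearity arguments in \<open>S\<close> can be replaced by basis
    vectors. This is needed because the reduction introduces the argument
    \<open>prS y\<close>.\<close>
  have N_expand: "inN (\<lambda>x. h x * (\<Prod>v\<leftarrow>vs. fst x v))"
    if "\<forall>us. set us \<subseteq> ?P1 \<longrightarrow> length us = r \<longrightarrow> inN (\<lambda>x. h x * (\<Prod>u\<leftarrow>us. fst x u))" "set vs \<subseteq> S" "length vs = r" for h vs r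
    using that
  proof (induction vs arbitrary: h r)
    case Nil
    then show ?case using Nil.prems(1)[rule_format, of "[]"] by simp
  next
    case (Cons v vs)
    have "inN (\<lambda>x. \<Sum>i\<in>idxS m n. v i * ((h x * fst x (unit_vec i)) * (\<Prod>v\<leftarrow>vs. fst x v)))"
    proof (intro N_sum' N_scale)
      fix i assume i: "i \<in> idxS m n"
      show "inN (\<lambda>x. (h x * fst x (unit_vec i)) * (\<Prod>v\<leftarrow>vs. fst x v))"
      proof (rule Cons.IH[where r = "r - 1"])
        show "\<forall>us. set us \<subseteq> ?P1 \<longrightarrow> length us = r - 1 \<longrightarrow> inN (\<lambda>x. h x * fst x (unit_vec i) * (\<Prod>u\<leftarrow>us. fst x u))"
        proof (intro allI impI)
          fix us assume "set us \<subseteq> ?P1" "length us = r - 1"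
          then show "inN (\<lambda>x. h x * fst x (unit_vec i) * (\<Prod>u\<leftarrow>us. fst x u))"
            using Cons.prems(1)[rule_format, of "unit_vec i # us"] Cons.prems(3) i by (simp add: mult.assoc)
        qed
      qed (use Cons.prems in auto)
    qed
    then show ?case
    proof (rule N_cong)
      fix x assume "x \<in> SZ"
      then have "fst x v = (\<Sum>i\<in>idxS m n. v i * fst x (unit_vec i))" using Cons.prems(2) by (intro dual_expand) auto
      then show "h x * (\<Prod>v\<leftarrow>v # vs. fst x v) = (\<Sum>i\<in>idxS m n. v i * ((h x * fst x (unit_vec i)) * (\<Prod>v\<leftarrow>vs. fst x v)))"
        by (simp add: sum_distrib_left sum_distrib_right mult_ac)
    qed
  qed
  have N_mon: "inN (mon us ys)" if "set us \<subseteq> S" "set ys \<subseteq> P2" "length us = d * length ys" for us ys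
    using that
  proof (induction ys arbitrary: us)
    case Nil
    then show ?case by (intro N_M) (simp add: T_def)
  next
    case (Cons y ys)
    have main: "inN (mon us (y # ys))" if us: "set us \<subseteq> ?P1" "length us = d * Suc (length ys)" for us
    proof (cases "Suc (length ys) \<le> K")
      case True
      then show ?thesis using us Cons.prems(2) by (intro N_M) (simp add: T_def)
    next
      case False
      have "K < 1 * Suc (length ys)" using False by simp
      also have "1 * Suc (length ys) \<le> d * Suc (length ys)"
        by (rule mult_le_mono1) (use d_pos in linarith)
      finally have "card ?P1 * m < length us" using us(2) by (simp only: K_def)
      then obtain u where u: "u \<in> ?P1" "count_list us u > m"
        using pigeonhole_list[of ?P1 us m] us(1) finite_idx(2) by blast
      obtain vs where vs: "\<forall>h::_ \<Rightarrow> complex. (\<Prod>v\<leftarrow>us. h v) = h u ^ m * (\<Prod>v\<leftarrow>vs. h v)"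
        "length us = m + length vs" "set vs \<subseteq> set us" using extract_from_list[of m us u] u(2) by auto
      have vsS: "set vs \<subseteq> S" using vs(3) us(1) P1S by blast
      have uS: "u \<in> S" "u \<in> E" using u(1) P1S space_subset by blast+
      show ?thesis
      proof (cases "y \<in> E")
        \<comment> \<open>Frame points are not known to lie in \<open>E\<close>; outside
          \<open>E\<close> every form is 0.\<close>
        case False
        show ?thesis
        proof (rule N_cong[OF N_0])
          fix x assume "x \<in> SZ"
          then have "snd x y = 0" using False Z_sub sym_power_dualD(3)[of "snd x" n E y] by auto
          then show "mon us (y # ys) x = 0" by (simp add: mon_def)
        qed
      next
        case True
        obtain \<kappa> where \<kappa>: "\<forall>a b (G :: complex poly). degree G \<le> n \<longrightarrow> a ^ (n + d) * poly G 0 =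
            (\<Sum>i\<le>n. \<Sum>l\<le>n + d. \<kappa> i l * a ^ (n - i) * b ^ i * ((b + of_nat l * a) ^ d * poly G (of_nat l)))"
          using dedekind_mertens[OF d_pos, of n] by blast
        define pt where "pt = (\<lambda>l::nat. \<lambda>i. y i + of_nat l * u i)"
        define ws where "ws = (\<lambda>i. replicate (n - i) u @ replicate i (prS y) @ vs)"
        have pt: "pt l \<in> E" for l
          unfolding pt_def using True uS by (intro lin_subspace_add[OF subspaces(1)] lin_subspace_scale[OF subspaces(1)])
        have lenws: "length (ws i) = d * length ys" if "i \<le> n" for i
          using that us(2) vs(2) dn by (simp add: ws_def)
        have "inN (\<lambda>x. \<Sum>i\<le>n. \<Sum>l\<le>n + d. \<kappa> i l * (ext0 Sm (\<lambda>q. q (pt l)) (\<phi> x) * mon (ws i) ys x))"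
        proof (intro N_sum N_scale N_mult)
          fix i l assume i: "i \<in> {..n}"
          have "set (ws i) \<subseteq> S" using uS vsS prS_in by (simp add: ws_def set_replicate_conv_if)
          then show "inN (mon (ws i) ys)"
            using Cons.IH[of "ws i"] Cons.prems(2) lenws[of i] i by simp
          show "ext0 Sm (\<lambda>q. q (pt l)) \<in> fun_alg Sm (dual Sm)"
            by (rule evaluation_in_fun_alg[OF lin_Sym order_refl])
        qed
        then show ?thesis
        proof (rule N_cong)
          fix x assume x: "x \<in> SZ"
          then have x1: "fst x \<in> dual S" and x2: "snd x \<in> Sn" using Z_sub by auto
          obtain G where G: "degree G \<le> n" "\<forall>t. snd x (\<lambda>i. y i + t * u i) = poly G t"
            using sym_power_dual_line[OF finite_idx(1), of "snd x" n u y] x2 uS True by (auto simp: spaceE_def)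
          let ?a = "fst x u" and ?b = "fst x (prS y)"
          have "fst x (prS (pt l)) = ?b + of_nat l * ?a" for l
            unfolding pt_def ext0_add ext0_scale prS_id[OF uS(1)]
            using dual_add[OF subspaces(2) x1 prS_in lin_subspace_scale[OF subspaces(2) uS(1)]]
              dual_scale[OF subspaces(2) x1 uS(1)] by simp
          then have \<phi>pt: "\<phi> x (pt l) = (?b + of_nat l * ?a) ^ d * poly G (of_nat l)" for l
            using mult_map_apply[OF pt] G(2) by (simp add: pt_def)
          have "mon us (y # ys) x = (?a ^ (n + d) * poly G 0) * ((\<Prod>v\<leftarrow>vs. fst x v) * (\<Prod>y\<leftarrow>ys. snd x y))"
            using vs(1)[rule_format, of "fst x"] G(2)[rule_format, of 0] dn by (simp add: mon_def add.commute mult_ac)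
          also have "?a ^ (n + d) * poly G 0 = (\<Sum>i\<le>n. \<Sum>l\<le>n + d. \<kappa> i l * ?a ^ (n - i) * ?b ^ i * \<phi> x (pt l))"
            unfolding \<phi>pt using \<kappa> G(1) by blast
          also have "\<dots> * ((\<Prod>v\<leftarrow>vs. fst x v) * (\<Prod>y\<leftarrow>ys. snd x y)) =
              (\<Sum>i\<le>n. \<Sum>l\<le>n + d. \<kappa> i l * (\<phi> x (pt l) * mon (ws i) ys x))"
            unfolding sum_distrib_right by (intro sum.cong refl) (simp add: mon_def ws_def mult_ac)
          finally show "mon us (y # ys) x =
              (\<Sum>i\<le>n. \<Sum>l\<le>n + d. \<kappa> i l * (ext0 Sm (\<lambda>q. q (pt l)) (\<phi> x) * mon (ws i) ys x))"
            using mult_map_in[OF x] by simp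
        qed
      qed
    qed
    have "inN (\<lambda>x. (\<Prod>y\<leftarrow>y # ys. snd x y) * (\<Prod>v\<leftarrow>us. fst x v))"
    proof (rule N_expand[where r = "d * Suc (length ys)"])
      show "\<forall>us. set us \<subseteq> ?P1 \<longrightarrow> length us = d * Suc (length ys) \<longrightarrow> inN (\<lambda>x. (\<Prod>y\<leftarrow>y # ys. snd x y) * (\<Prod>u\<leftarrow>us. fst x u))"
        using main by (simp add: mon_def[abs_def] mult.commute)
    qed (use Cons.prems in auto)
    then show ?case by (rule N_cong) (simp add: mon_def mult.commute)
  qed
  have "inN a" if a: "a \<in> Inv" for a
  proof -
    obtain ts where ts: "\<forall>t\<in>set ts. set (fst (snd t)) \<subseteq> ?P1 \<and> set (snd (snd t)) \<subseteq> P2 \<and>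
        length (fst (snd t)) = d * length (snd (snd t))"
      "\<forall>x\<in>SZ. a x = (\<Sum>t\<leftarrow>ts. fst t * mon (fst (snd t)) (snd (snd t)) x)"
      using Inv_expand[OF e a] by blast
    have "inN (\<lambda>x. \<Sum>t\<leftarrow>ts. fst t * mon (fst (snd t)) (snd (snd t)) x)"
      using ts(1)
    proof (induction ts)
      case (Cons t ts)
      have "inN (mon (fst (snd t)) (snd (snd t)))"
        using Cons.prems P1S by (intro N_mon) auto
      then show ?case using N_add[OF N_scale Cons.IH] Cons.prems by simp
    qed (simp add: N_0)
    then show ?thesis by (rule N_cong) (use ts(2) in blast)
  qed
  then show ?thesis using M unfolding inN_def by blast
qed

end

lemma regular_on_poly_expr:
  assumes A: "fun_variety A" and U: "U \<subseteq> pts A"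
    and reg: "\<And>p. p \<in> P \<Longrightarrow> regular_on A U (\<lambda>y. g p (r y))" and ts: "expr_over P ts"
  shows "regular_on A U (\<lambda>y. poly_expr g ts (r y))"
proof -
  have prod: "regular_on A U (\<lambda>y. \<Prod>p\<leftarrow>ps. g p (r y))" if "set ps \<subseteq> P" for ps
    using that
  proof (induction ps)
    case Nil
    then show ?case using regular_on_const[OF A U, of 1] by simp
  next
    case (Cons p ps)
    then show ?case using regular_on_mult[OF A U reg, of p] by simp
  qed
  show ?thesis
    using ts unfolding poly_expr_def expr_over_def
  proof (induction ts)
    case Nil
    then show ?case using regular_on_const[OF A U, of 0] by simp
  next
    case (Cons t ts)
    then have "regular_on A U (\<lambda>y. fst t * (\<Prod>p\<leftarrow>snd t. g p (r y)) + (\<Sum>t\<leftarrow>ts. fst t * (\<Prod>p\<leftarrow>snd t. g p (r y))))"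
      using prod[of "snd t"] by (intro regular_on_add[OF A U] regular_on_mult[OF A U] regular_on_const[OF A U]) auto
    then show ?case by simp
  qed
qed

context permanent_spaces
begin

section \<open>Recovering a factorisation from its product\<close>

definition interp :: "nat \<Rightarrow> nat \<Rightarrow> complex" where
  "interp k = (SOME \<gamma>. \<forall>p::complex poly. degree p \<le> d \<longrightarrow> coeff p k = (\<Sum>i\<le>d. \<gamma> i * poly p (of_nat i)))"

lemma interp: "degree p \<le> d \<Longrightarrow> coeff p k = (\<Sum>i\<le>d. interp k i * poly p (of_nat i))"
  using someI_ex[OF coeff_interpolation[of d k]] unfolding interp_def by blast

(* The coefficient of x_11^k at the projection of X to S_1. *)
definition coeff11 :: "nat \<Rightarrow> poly_fun \<Rightarrow> cmat \<Rightarrow> complex" where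
  "coeff11 k q X = (\<Sum>i\<le>d. interp k i * q (\<lambda>p. pr1 X p + of_nat i * e11 p))"

text \<open>On the line through \<open>pr1 X\<close> in direction \<open>e11\<close> the form f is
  constant and \<lambda> is affine. The product is thus a polynomial of degree at most d in the
  parameter, and interpolation reads off its coefficients.\<close>

lemma coeff11_mult_map:
  assumes x: "x \<in> SZ"
  shows "coeff11 k (\<phi> x) X = coeff ([:fst x (pr1 X), fst x e11:] ^ d) k * snd x (pr1 X)"
proof -
  have l: "fst x \<in> dual S" and f: "snd x \<in> Z m n" using x by auto
  let ?p = "[:fst x (pr1 X), fst x e11:] ^ d"
  have "\<phi> x (\<lambda>p. pr1 X p + of_nat i * e11 p) = poly ?p (of_nat i) * snd x (pr1 X)" for i
  proof -
    let ?W = "\<lambda>p. pr1 X p + of_nat i * e11 p"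
    have pS: "pr1 X \<in> S" using pr1_in space_subset by blast
    have W: "?W \<in> S"
      by (intro lin_subspace_add[OF subspaces(2)] lin_subspace_scale[OF subspaces(2)] pS e11_in)
    then have WE: "?W \<in> E" using space_subset by blast
    have "pr1 ?W = pr1 X" unfolding ext0_add ext0_scale pr1_e11 pr1_id[OF pr1_in] by simp
    then have "snd x ?W = snd x (pr1 X)" using Z_pr1[OF f WE] by simp
    moreover have "fst x ?W = fst x (pr1 X) + of_nat i * fst x e11"
      using dual_add[OF subspaces(2) l pS lin_subspace_scale[OF subspaces(2) e11_in(1)]]
        dual_scale[OF subspaces(2) l e11_in(1)] by simp
    ultimately show ?thesis using mult_map_apply[OF WE, of x] prS_id[OF W] by simp
  qed
  then have "coeff11 k (\<phi> x) X = (\<Sum>i\<le>d. interp k i * poly ?p (of_nat i)) * snd x (pr1 X)"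
    by (simp add: coeff11_def sum_distrib_right mult.assoc)
  moreover have "degree ?p \<le> d"
    using degree_power_le[of "[:fst x (pr1 X), fst x e11:]" d] by (simp split: if_splits)
  ultimately show ?thesis using interp by simp
qed

lemma coeff11_top: "x \<in> SZ \<Longrightarrow> coeff11 d (\<phi> x) X = fst x e11 ^ d * snd x (pr1 X)"
  unfolding coeff11_mult_map by (subst coeff_linear_poly_power) auto

text \<open>The factor d is the binomial coefficient d over d - 1, and the powers of \<lambda>(e11)
  are 1.\<close>

lemma coeff11_subtop:
  assumes "x \<in> SZ" "fst x e11 = 1"
  shows "coeff11 (d - 1) (\<phi> x) X = of_nat d * fst x (pr1 X) * snd x (pr1 X)"
proof -
  obtain k where k: "d = Suc k" using d_pos gr0_implies_Suc by blast
  have "d choose (d - 1) = d" unfolding k by simp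
  moreover have "d - (d - 1) = 1" using d_pos by simp
  ultimately show ?thesis
    unfolding coeff11_mult_map[OF assms(1)] by (subst coeff_linear_poly_power) (auto simp: assms(2))
qed

lemma coeff11_in_fns:
  assumes "Y \<subseteq> Sm" shows "ext0 Y (\<lambda>q. coeff11 k q X) \<in> fun_alg Y (dual Sm)"
proof -
  note A = fun_subalg_fun_alg[of Y "dual Sm"]
  have "ext0 Y (\<lambda>q. coeff11 k q X) =
      (\<lambda>q. \<Sum>i\<le>d. interp k i * ext0 Y (\<lambda>q. q (\<lambda>p. pr1 X p + of_nat i * e11 p)) q)"
    by (rule ext) (simp add: ext0_def coeff11_def)
  moreover have "\<dots> \<in> fun_alg Y (dual Sm)"
    by (intro fun_subalg_sum[OF A] fun_subalg_scale[OF A] evaluation_in_fun_alg[OF lin_Sym assms])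
  ultimately show ?thesis by simp
qed

lemma Z_outside: "f \<in> Z m n \<Longrightarrow> X \<notin> E \<Longrightarrow> f X = 0"
  using Z_sub sym_power_dualD(3)[of f n E X] by blast

text \<open>Only f nonzero on \<open>S1\<close> is asked, not membership in \<open>Zo\<close>: this
  condition can be seen in the top coefficient of \<open>y\<close>, hence is open, and it suffices
  for recovering the pair.\<close>

definition normal_rep :: "poly_fun \<Rightarrow> poly_fun \<times> poly_fun \<Rightarrow> bool" where
  "normal_rep y x \<longleftrightarrow> x \<in> SZ \<and> fst x e11 = 1 \<and> (\<exists>X\<in>S1. snd x X \<noteq> 0) \<and> y = \<phi> x"

lemma normal_rep_snd:
  assumes "normal_rep y x" shows "snd x X = (if X \<in> E then coeff11 d y X else 0)"
proof -
  have x: "x \<in> SZ" "fst x e11 = 1" "y = \<phi> x" using assms by (auto simp: normal_rep_def)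
  show ?thesis
  proof (cases "X \<in> E")
    case True
    then show ?thesis using x coeff11_top[OF x(1)] Z_pr1[of "snd x" X] by auto
  next
    case False
    then show ?thesis using x(1) Z_sub sym_power_dualD(3)[of "snd x" n E X] by auto
  qed
qed

text \<open>The two highest coefficients are f and d times the product of \<lambda> and f, so their
  ratio gives \<lambda> wherever f does not vanish.\<close>

lemma normal_rep_fst:
  assumes x: "normal_rep y x" and X: "X \<in> S1" "coeff11 d y X \<noteq> 0"
  shows "fst x X = coeff11 (d - 1) y X / (of_nat d * coeff11 d y X)"
proof -
  have x': "x \<in> SZ" "fst x e11 = 1" "y = \<phi> x" using x by (auto simp: normal_rep_def)
  have XE: "X \<in> E" using X space_subset by blast
  have "coeff11 (d - 1) y X = of_nat d * fst x X * coeff11 d y X"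
    using coeff11_subtop[OF x'(1,2), of X] normal_rep_snd[OF x, of X] XE by (simp add: x'(3) pr1_id[OF X(1)])
  then show ?thesis using X(2) d_pos by simp
qed

lemma nonzero_nearby:
  assumes f: "f \<in> Sn" and X: "X \<in> E" "Y \<in> E" "f X \<noteq> 0"
  shows "\<exists>s. s \<noteq> 0 \<and> f (\<lambda>i. X i + s * Y i) \<noteq> 0"
proof (rule ccontr)
  assume *: "\<not> ?thesis"
  obtain p where p: "\<forall>t. f (\<lambda>i. X i + t * Y i) = poly p t"
    using sym_power_dual_line[OF finite_idx(1), of f n Y X] f X by (auto simp: spaceE_def)
  have "poly p t = 0" if "t \<noteq> 0" for t using * p that by metis
  then have "p = 0" by (rule poly_eq_0_punctured)
  then show False using p[rule_format, of 0] X(3) by simp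
qed

text \<open>At a matrix \<open>Y\<close> where f vanishes, \<open>normal_rep_fst\<close> gives
  nothing. By linearity \<lambda>(Y) is the difference quotient of \<lambda> between two points
  where f is nonzero; the right-hand side is that quotient over a common denominator.\<close>

lemma normal_rep_fst_nearby:
  assumes x: "normal_rep y x" and X: "X \<in> S1" "Y \<in> S1" and s: "s \<noteq> 0"
    and nz: "coeff11 d y X \<noteq> 0" "coeff11 d y (\<lambda>i. X i + s * Y i) \<noteq> 0"
  shows "fst x Y = (coeff11 (d - 1) y (\<lambda>i. X i + s * Y i) * coeff11 d y X -
      coeff11 (d - 1) y X * coeff11 d y (\<lambda>i. X i + s * Y i)) /
    (of_nat d * s * coeff11 d y (\<lambda>i. X i + s * Y i) * coeff11 d y X)"
proof -
  let ?W = "\<lambda>i. X i + s * Y i"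
  have l: "fst x \<in> dual S" using x by (auto simp: normal_rep_def)
  have XS: "X \<in> S" "Y \<in> S" using X space_subset by auto
  have W: "?W \<in> S1" using X by (intro lin_subspace_add[OF subspaces(3)] lin_subspace_scale[OF subspaces(3)])
  have "fst x ?W = fst x X + s * fst x Y"
    using dual_add[OF subspaces(2) l XS(1) lin_subspace_scale[OF subspaces(2) XS(2)]]
      dual_scale[OF subspaces(2) l XS(2)] by simp
  then have 1: "fst x Y = (fst x ?W - fst x X) / s" using s by simp
  have 2: "(p / (c * p') - q / (c * q')) / s = (p * q' - q * p') / (c * s * p' * q')"
    if "c \<noteq> 0" "p' \<noteq> 0" "q' \<noteq> 0" for p p' q q' c :: complex
    using that s by (simp add: field_simps)
  have 3: "of_nat d \<noteq> (0 :: complex)" using d_pos by simp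
  show ?thesis
    unfolding 1 normal_rep_fst[OF x W nz(2)] normal_rep_fst[OF x X(1) nz(1)] by (rule 2[OF 3 nz(2,1)])
qed

lemma normal_rep_nearby:
  assumes x: "normal_rep y x" and Y: "Y \<in> S1"
  obtains X s where "X \<in> S1" "s \<noteq> 0" "coeff11 d y X \<noteq> 0" "coeff11 d y (\<lambda>i. X i + s * Y i) \<noteq> 0"
proof -
  obtain X where X: "X \<in> S1" "snd x X \<noteq> 0" using x by (auto simp: normal_rep_def)
  have E: "X \<in> E" "Y \<in> E" using X Y space_subset by auto
  have "snd x \<in> Sn" using x Z_sub by (auto simp: normal_rep_def)
  then obtain s where s: "s \<noteq> 0" "snd x (\<lambda>i. X i + s * Y i) \<noteq> 0" using nonzero_nearby E X(2) by blast
  have "(\<lambda>i. X i + s * Y i) \<in> E"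
    using E by (intro lin_subspace_add[OF subspaces(1)] lin_subspace_scale[OF subspaces(1)])
  then show ?thesis
    using that[OF X(1) s(1)] X(2) s(2) E unfolding normal_rep_snd[OF x] by simp
qed

text \<open>The preceding formulas express both components through \<open>y\<close> alone; the same
  auxiliary \<open>X\<close> and \<open>s\<close> serve for both pairs.\<close>

lemma normal_rep_unique:
  assumes x: "normal_rep y x" "normal_rep y x'" shows "x = x'"
proof -
  have "snd x = snd x'" by (rule ext) (simp add: normal_rep_snd[OF x(1)] normal_rep_snd[OF x(2)])
  moreover have l: "fst x \<in> dual S" "fst x' \<in> dual S" using x by (auto simp: normal_rep_def)
  have S1: "fst x Y = fst x' Y" if Y: "Y \<in> S1" for Y
  proof -
    obtain X s where "X \<in> S1" "s \<noteq> 0" "coeff11 d y X \<noteq> 0" "coeff11 d y (\<lambda>i. X i + s * Y i) \<noteq> 0"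
      using normal_rep_nearby[OF x(1) Y] by blast
    note * = this
    show ?thesis
      unfolding normal_rep_fst_nearby[OF x(1) *(1) Y *(2-)] normal_rep_fst_nearby[OF x(2) *(1) Y *(2-)] ..
  qed
  have "fst x v = fst x' v" for v
  proof (cases "v \<in> S")
    case True
    have "fst x (prS v) = fst x' (prS v)"
      unfolding dual_S_decomp[OF l(1)] dual_S_decomp[OF l(2)] S1[OF pr1_in] using x by (simp add: normal_rep_def)
    then show ?thesis using prS_id[OF True] by simp
  next
    case False
    then show ?thesis using dual_outside[OF subspaces(2) l(1)] dual_outside[OF subspaces(2) l(2)] by simp
  qed
  then have "fst x = fst x'" by (rule ext)
  ultimately show ?thesis by (simp add: prod_eq_iff)
qed

definition rep :: "poly_fun \<Rightarrow> poly_fun \<times> poly_fun" where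
  "rep y = (SOME x. normal_rep y x)"

lemma rep_eq: "normal_rep y x \<Longrightarrow> rep y = x"
  unfolding rep_def using normal_rep_unique by (metis someI)

text \<open>The form is a coefficient of \<open>y\<close>, the functional is on basis vectors a
  quotient of coefficients, and \<open>SZ_expand\<close> extends regularity from these coordinates
  to all functions on pairs.\<close>

lemma rep_regular:
  assumes Y: "Y \<subseteq> Sm" and W: "W \<subseteq> Y" "\<And>y. y \<in> W \<Longrightarrow> \<exists>x. normal_rep y x"
    and a: "a \<in> fns (varSZ m n)"
  shows "regular_on (closed_subvariety Sm Y) W (\<lambda>y. a (rep y))"
proof -
  let ?B = "closed_subvariety Sm Y"
  have B: "fun_variety ?B" by (rule fun_variety_closed_subvariety)
  have WB: "W \<subseteq> pts ?B" using W by simp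
  have nr: "normal_rep y (rep y)" if "y \<in> W" for y
    using W(2)[OF that] rep_eq by auto
  have c: "ext0 Y (\<lambda>q. coeff11 k q X) \<in> fns ?B" for k X using coeff11_in_fns[OF Y] by simp
  have snd_reg: "regular_on ?B W (\<lambda>y. snd (rep y) p)" for p
  proof (cases "p \<in> E")
    case True
    show ?thesis
      by (rule regular_on_cong[OF B WB _ regular_on_fns[OF B WB c[of d p]]])
        (use True normal_rep_snd[OF nr, of _ p] subsetD[OF W(1)] in simp)
  next
    case False
    show ?thesis
      by (rule regular_on_cong[OF B WB _ regular_on_const[OF B WB, of 0]])
        (use False normal_rep_snd[OF nr, of _ p] in simp)
  qed
  have fst_reg: "regular_on ?B W (\<lambda>y. fst (rep y) (unit_vec i))" if i: "i \<in> idxS m n" for i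
  proof (cases "i = (1, 1)")
    case True
    show ?thesis
      by (rule regular_on_cong[OF B WB _ regular_on_const[OF B WB, of 1]])
        (use True nr in \<open>auto simp: normal_rep_def\<close>)
  next
    case False
    then have u: "unit_vec i \<in> S1" using i by (auto simp: idxS_def spaceS1_def unit_vec_in_coord_space)
    show ?thesis
    proof (rule regular_onI[OF B WB])
      fix y assume y: "y \<in> W"
      \<comment> \<open>\<open>X\<close> and \<open>s\<close> are chosen for this \<open>y\<close>,
        but the resulting formula holds wherever its denominator is nonzero, which is a
        neighbourhood of \<open>y\<close>.\<close>
      obtain X s where Xs: "X \<in> S1" "s \<noteq> 0" "coeff11 d y X \<noteq> 0" "coeff11 d y (\<lambda>j. X j + s * unit_vec i j) \<noteq> 0"
        using normal_rep_nearby[OF nr[OF y] u] by blast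
      let ?W = "\<lambda>j. X j + s * unit_vec i j"
      let ?c = "\<lambda>k X. ext0 Y (\<lambda>q. coeff11 k q X)"
      have sub: "fun_subalg (pts ?B) (fns ?B)" using B by (simp add: fun_variety_def)
      show "\<exists>g\<in>fns ?B. \<exists>h\<in>fns ?B. h y \<noteq> 0 \<and> (\<forall>y\<in>W. h y \<noteq> 0 \<longrightarrow> fst (rep y) (unit_vec i) = g y / h y)"
      proof (rule bexI[of _ "\<lambda>y. ?c (d - 1) ?W y * ?c d X y - ?c (d - 1) X y * ?c d ?W y"],
          rule bexI[of _ "\<lambda>y. (of_nat d * s) * (?c d ?W y * ?c d X y)"], intro conjI ballI impI)
        show "of_nat d * s * (?c d ?W y * ?c d X y) \<noteq> 0" using Xs d_pos y W by auto
        fix y' assume y': "y' \<in> W" "of_nat d * s * (?c d ?W y' * ?c d X y') \<noteq> 0"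
        then have "coeff11 d y' X \<noteq> 0" "coeff11 d y' ?W \<noteq> 0" using W by auto
        from normal_rep_fst_nearby[OF nr[OF y'(1)] Xs(1) u Xs(2) this]
        show "fst (rep y') (unit_vec i) = (?c (d - 1) ?W y' * ?c d X y' - ?c (d - 1) X y' * ?c d ?W y') /
            (of_nat d * s * (?c d ?W y' * ?c d X y'))"
          using W y'(1) by (simp add: subset_iff mult.assoc)
      next
        show "(\<lambda>y. (of_nat d * s) * (?c d ?W y * ?c d X y)) \<in> fns ?B"
          by (intro fun_subalg_scale[OF sub] fun_subalg_mult[OF sub] c)
        show "(\<lambda>y. ?c (d - 1) ?W y * ?c d X y - ?c (d - 1) X y * ?c d ?W y) \<in> fns ?B"
          by (intro fun_subalg_diff[OF sub] fun_subalg_mult[OF sub] c)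
      qed
    qed
  qed
  obtain P2 e2 where e: "eval_frame Sn P2 e2" using frame_Sym by blast
  obtain ts where ts: "expr_over (unit_vec ` idxS m n <+> P2) ts" "\<forall>x\<in>SZ. a x = poly_expr coordinate ts x"
    using SZ_expand[OF e a] by blast
  have "regular_on ?B W (\<lambda>y. poly_expr coordinate ts (rep y))"
    by (rule regular_on_poly_expr[OF B WB _ ts(1)]) (auto simp: coordinate_def snd_reg fst_reg)
  then show ?thesis
  proof (rule regular_on_cong[OF B WB, rotated])
    fix y assume "y \<in> W"
    then have "rep y \<in> SZ" using nr by (simp add: normal_rep_def)
    then show "poly_expr coordinate ts (rep y) = a (rep y)" using bspec[OF ts(2)] by simp
  qed
qed

section \<open>The stratum where the factorisation is unique\<close>

text \<open>The images of the pairs with nonzero \<lambda>(e11) and nonzero f, described through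
  \<open>alpha\<close> so that openness and the image can be read off.\<close>

definition strat :: "((poly_fun \<times> poly_fun \<Rightarrow> complex) \<Rightarrow> complex) set" where
  "strat = {\<xi> \<in> P. \<exists>X\<in>S1. coeff11 d (alpha m n \<xi>) X \<noteq> 0}"

text \<open>The torus element inverse to \<lambda>(e11) normalises a pair without changing its image
  in the quotient.\<close>

lemma strat_rep:
  assumes "\<xi> \<in> strat"
  shows "\<exists>x. normal_rep (alpha m n \<xi>) x \<and> \<xi> = projSZ m n x"
proof -
  obtain X where \<xi>: "\<xi> \<in> P" and X: "X \<in> S1" "coeff11 d (alpha m n \<xi>) X \<noteq> 0" using assms by (auto simp: strat_def)
  obtain x where x: "x \<in> SZ" "\<xi> = projSZ m n x" using projSZ_surj[OF \<xi>] by blast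
  have "fst x e11 \<noteq> 0" using X(2) coeff11_top[OF x(1), of X] alpha_projSZ[OF x(1)] x(2) d_pos by auto
  define z where "z = inverse (fst x e11)"
  define x' where "x' = torus_act m n z x"
  have z: "z \<noteq> 0" using \<open>fst x e11 \<noteq> 0\<close> by (simp add: z_def)
  have x': "x' \<in> SZ" "\<xi> = projSZ m n x'"
    using torus_in_SZ[OF x(1)] projSZ_torus[OF z x(1)] x(2) by (simp_all add: x'_def)
  have e: "fst x' e11 = 1"
    using \<open>fst x e11 \<noteq> 0\<close> by (simp add: x'_def torus_act_def split_beta z_def)
  have \<phi>: "alpha m n \<xi> = \<phi> x'" using alpha_projSZ[OF x'(1)] x'(2) by simp
  have "snd x' X \<noteq> 0" using X(2) coeff11_top[OF x'(1), of X] e pr1_id[OF X(1)] by (simp add: \<phi>)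
  then show ?thesis using x' e \<phi> X(1) unfolding normal_rep_def by blast
qed

text \<open>The target \<open>Y\<close> is a parameter so that the same statements serve for the
  whole space of forms and for the closure of the orbit.\<close>

lemma alpha_regular:
  assumes Y: "Y \<subseteq> Sm" and b: "b \<in> fun_alg Y (dual Sm)"
  shows "\<exists>b'\<in>fns (quotSZ m n). \<forall>\<xi>\<in>P. alpha m n \<xi> \<in> Y \<longrightarrow> b (alpha m n \<xi>) = b' \<xi>"
proof -
  obtain b0 where b0: "b0 \<in> fun_alg Sm (dual Sm)" "b = ext0 Y b0" using fun_alg_extend[OF Y b] by blast
  have "ext0 P (\<lambda>\<xi>. \<xi> (ext0 SZ (\<lambda>x. b0 (\<phi> x)))) \<in> fns (quotSZ m n)"
    unfolding fns_quot using pull_mult_map[OF b0(1)] by blast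
  then show ?thesis using alpha_spec(2)[OF _ b0(1)] b0(2) by (intro bexI) auto
qed

lemma alpha_morphism:
  assumes Y: "Y \<subseteq> Sm" and U: "U \<subseteq> P" and W: "W \<subseteq> Y" "\<And>\<xi>. \<xi> \<in> U \<Longrightarrow> alpha m n \<xi> \<in> W"
  shows "morphism_on (quotSZ m n) U (closed_subvariety Sm Y) W (alpha m n)"
proof (rule morphism_onI[OF fun_variety_quot fun_variety_closed_subvariety])
  show UP: "U \<subseteq> pts (quotSZ m n)" using U pts_quot by simp
  show "W \<subseteq> pts (closed_subvariety Sm Y)" using W by simp
  show "alpha m n \<xi> \<in> W" if "\<xi> \<in> U" for \<xi> using W that by blast
  fix b assume "b \<in> fns (closed_subvariety Sm Y)"
  then obtain b' where b': "b' \<in> fns (quotSZ m n)" "\<forall>\<xi>\<in>P. alpha m n \<xi> \<in> Y \<longrightarrow> b (alpha m n \<xi>) = b' \<xi>"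
    using alpha_regular[OF Y] by auto
  show "regular_on (quotSZ m n) U (\<lambda>\<xi>. b (alpha m n \<xi>))"
    by (rule regular_on_cong[OF fun_variety_quot UP _ regular_on_fns[OF fun_variety_quot UP b'(1)]])
      (use b'(2) subsetD[OF U] subsetD[OF W(1) W(2)] in simp)
qed

text \<open>The inverse is \<open>projSZ\<close> after \<open>rep\<close>. Arbitrary subsets
  \<open>U\<close> of the stratum are allowed, in order to cover both the isomorphism onto the orbit
  and the open set used for birationality.\<close>

lemma alpha_biregular:
  assumes Y: "Y \<subseteq> Sm" and U: "U \<subseteq> strat" and W: "W \<subseteq> Y" "alpha m n ` U = W"
  shows "biregular_on (quotSZ m n) U (closed_subvariety Sm Y) W (alpha m n)"
proof -
  have UP: "U \<subseteq> P" using U by (auto simp: strat_def)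
  have r: "normal_rep (alpha m n \<xi>) (rep (alpha m n \<xi>)) \<and> \<xi> = projSZ m n (rep (alpha m n \<xi>))" if "\<xi> \<in> U" for \<xi>
    using strat_rep[of \<xi>] that U rep_eq by fastforce
  have inj: "inj_on (alpha m n) U" by (rule inj_onI) (metis r)
  then have bij: "bij_betw (alpha m n) U W" using W(2) by (simp add: bij_betw_def)
  have inv: "inv_into U (alpha m n) y = projSZ m n (rep y)" if "y \<in> W" for y
  proof -
    from that W(2) obtain \<xi> where "\<xi> \<in> U" "y = alpha m n \<xi>" by blast
    then show ?thesis using inj r by simp
  qed
  have nr: "normal_rep y (rep y)" if "y \<in> W" for y
    using that W(2) r by blast
  have "morphism_on (closed_subvariety Sm Y) W (quotSZ m n) U (inv_into U (alpha m n))"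
  proof (rule morphism_onI[OF fun_variety_closed_subvariety fun_variety_quot])
    show WB: "W \<subseteq> pts (closed_subvariety Sm Y)" using W by simp
    show "U \<subseteq> pts (quotSZ m n)" using UP pts_quot by simp
    show "inv_into U (alpha m n) y \<in> U" if "y \<in> W" for y using that W(2) inv_into_into by metis
    fix b assume "b \<in> fns (quotSZ m n)"
    then obtain a where a: "a \<in> Inv" "b = ext0 P (\<lambda>\<xi>. \<xi> a)" unfolding fns_quot by blast
    have "a \<in> fns (varSZ m n)" using a(1) by (simp add: invariants_def)
    then have "regular_on (closed_subvariety Sm Y) W (\<lambda>y. a (rep y))"
      by (intro rep_regular[OF Y W(1)] exI) (rule nr)
    then show "regular_on (closed_subvariety Sm Y) W (\<lambda>y. b (inv_into U (alpha m n) y))"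
    proof (rule regular_on_cong[OF fun_variety_closed_subvariety WB, rotated])
      fix y assume y: "y \<in> W"
      have "rep y \<in> SZ" using nr[OF y] by (simp add: normal_rep_def)
      then show "a (rep y) = b (inv_into U (alpha m n) y)"
        using inv[OF y] projSZ_in a by (simp add: projSZ_apply)
    qed
  qed
  moreover have "morphism_on (quotSZ m n) U (closed_subvariety Sm Y) W (alpha m n)"
    using W by (intro alpha_morphism[OF Y UP]) auto
  ultimately show ?thesis using bij by (simp add: biregular_on_def)
qed

section \<open>The orbit of the padded permanent inside the quotient\<close>

lemma mult_map_orbit: "x \<in> (dual S - dualS1 m n) \<times> Zo m n \<Longrightarrow> \<phi> x \<in> orbitRp m n"
  unfolding orbitRp_eq by (auto simp: mult_map_def)

lemma orbit_subset_Sm: "orbitRp m n \<subseteq> Sm"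
proof
  fix q assume "q \<in> orbitRp m n"
  then obtain l f where q: "q = \<phi> (l, f)" "l \<in> dual S" "f \<in> Zo m n"
    unfolding orbitRp_eq by (auto simp: mult_map_def)
  then show "q \<in> Sm" using mult_map_in[of "(l, f)"] Zo_sub_Z by auto
qed

lemma quot_open_subset: "quot_open m n \<subseteq> strat"
proof
  fix \<xi> assume "\<xi> \<in> quot_open m n"
  then obtain l f where lf: "\<xi> = projSZ m n (l, f)" "l \<in> dual S" "l e11 \<noteq> 0" "f \<in> Zo m n"
    by (auto simp: quot_open_def dualS1_iff)
  have x: "(l, f) \<in> SZ" using lf Zo_sub_Z by auto
  obtain X where X: "X \<in> S1" "f X \<noteq> 0" using Zo_nonzero[OF lf(4)] by blast
  have "coeff11 d (\<phi> (l, f)) X \<noteq> 0" using coeff11_top[OF x, of X] X lf(3) by (simp add: pr1_id)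
  then show "\<xi> \<in> strat"
    using X(1) projSZ_in[OF x] alpha_projSZ[OF x] lf(1) by (auto simp: strat_def)
qed

text \<open>For a point over the orbit, comparing the top coefficients of two factorisations shows
  that its form is a nonzero multiple of an element of \<open>Zo\<close>, and \<open>Zo\<close> is
  stable under such multiples.\<close>

lemma alpha_preimage_orbit: "{\<xi> \<in> P. alpha m n \<xi> \<in> orbitRp m n} = quot_open m n"
proof (intro equalityI subsetI)
  fix \<xi> assume "\<xi> \<in> quot_open m n"
  then obtain x where x: "\<xi> = projSZ m n x" "x \<in> (dual S - dualS1 m n) \<times> Zo m n"
    by (auto simp: quot_open_def)
  then have "x \<in> SZ" using Zo_sub_Z by auto
  then show "\<xi> \<in> {\<xi> \<in> P. alpha m n \<xi> \<in> orbitRp m n}"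
    using projSZ_in alpha_projSZ mult_map_orbit[OF x(2)] x(1) by simp
next
  fix \<xi> assume "\<xi> \<in> {\<xi> \<in> P. alpha m n \<xi> \<in> orbitRp m n}"
  then have \<xi>: "\<xi> \<in> P" "alpha m n \<xi> \<in> orbitRp m n" by auto
  obtain x where x: "x \<in> SZ" "\<xi> = projSZ m n x" using projSZ_surj[OF \<xi>(1)] by blast
  obtain l0 f0 where lf: "alpha m n \<xi> = \<phi> (l0, f0)" "l0 \<in> dual S" "l0 e11 \<noteq> 0" "f0 \<in> Zo m n"
    using \<xi>(2) unfolding orbitRp_eq by (auto simp: mult_map_def dualS1_iff)
  have x0: "(l0, f0) \<in> SZ" using lf Zo_sub_Z by auto
  have eq: "fst x e11 ^ d * snd x X = l0 e11 ^ d * f0 X" for X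
  proof (cases "X \<in> E")
    case True
    have "coeff11 d (\<phi> x) X = coeff11 d (\<phi> (l0, f0)) X"
      using alpha_projSZ[OF x(1)] x(2) lf(1) by simp
    then show ?thesis
      unfolding coeff11_top[OF x(1)] coeff11_top[OF x0]
      using Z_pr1[of "snd x" X] Z_pr1[of f0 X] x(1) x0 True by auto
  next
    case False
    then have "snd x X = 0" "f0 X = 0" using x(1) x0 Z_outside by auto
    then show ?thesis by simp
  qed
  obtain X where X: "X \<in> S1" "f0 X \<noteq> 0" using Zo_nonzero[OF lf(4)] by blast
  have l: "fst x e11 \<noteq> 0" using eq[of X] X(2) lf(3) d_pos by (auto simp: zero_power)
  have "snd x = (\<lambda>X. (l0 e11 ^ d / fst x e11 ^ d) * f0 X)"
    using eq l by (intro ext) (simp add: field_simps)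
  then have "snd x \<in> Zo m n" using Zo_scale[OF lf(4), of "l0 e11 ^ d / fst x e11 ^ d"] l lf(3) by simp
  then have "x \<in> (dual S - dualS1 m n) \<times> Zo m n" using x(1) l by (auto simp: dualS1_iff mem_Times_iff)
  then show "\<xi> \<in> quot_open m n" using x(2) by (auto simp: quot_open_def)
qed

lemma alpha_quot_open: "alpha m n ` quot_open m n = orbitRp m n"
proof
  show "alpha m n ` quot_open m n \<subseteq> orbitRp m n" using alpha_preimage_orbit by blast
  show "orbitRp m n \<subseteq> alpha m n ` quot_open m n"
  proof
    fix q assume "q \<in> orbitRp m n"
    then obtain l f where q: "q = \<phi> (l, f)" "l \<in> dual S - dualS1 m n" "f \<in> Zo m n"
      unfolding orbitRp_eq by (auto simp: mult_map_def)
    then have "q = alpha m n (projSZ m n (l, f))" using alpha_projSZ[of "(l, f)"] Zo_sub_Z by auto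
    then show "q \<in> alpha m n ` quot_open m n" using q by (auto simp: quot_open_def)
  qed
qed

text \<open>\<open>SZ_density\<close> carried over to characters: an invariant that vanishes on the
  dense set of pairs is 0, so every character kills it.\<close>

lemma Inv_vanish:
  assumes a: "a \<in> Inv" "\<And>x. x \<in> (dual S - dualS1 m n) \<times> Zo m n \<Longrightarrow> a x = 0" and \<xi>: "\<xi> \<in> P"
  shows "\<xi> a = 0"
proof -
  have "a \<in> fns (varSZ m n)" using a(1) by (simp add: invariants_def)
  from SZ_density[OF this a(2)] have "a x = 0" for x
    using fun_subalg_outside[OF subalg_Inv a(1)] by (cases "x \<in> SZ") auto
  then have "a = (\<lambda>_. 0)" by (rule ext)
  then show ?thesis using alg_hom_zero[OF subalg_Inv hom_P[OF \<xi>]] by simp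
qed

section \<open>The closure of the orbit as the image of a finite morphism\<close>

lemma closureRp_eq: "closureRp m n = {y \<in> Sm. \<forall>b\<in>fun_alg Sm (dual Sm). (\<forall>x\<in>orbitRp m n. b x = 0) \<longrightarrow> b y = 0}"
  unfolding closureRp_def varQ_def
  using zariski_closure_of[OF fun_variety_closed_subvariety[of Sm Sm], of "orbitRp m n"] orbit_subset_Sm by simp

text \<open>A polynomial that vanishes on the orbit pulls back to an invariant that vanishes on the
  dense set of pairs.\<close>

lemma alpha_in_closure: "\<xi> \<in> P \<Longrightarrow> alpha m n \<xi> \<in> closureRp m n"
proof -
  assume \<xi>: "\<xi> \<in> P"
  have "b (alpha m n \<xi>) = 0" if b: "b \<in> fun_alg Sm (dual Sm)" "\<forall>x\<in>orbitRp m n. b x = 0" for b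
    unfolding alpha_spec(2)[OF \<xi> b(1)]
  proof (rule Inv_vanish[OF pull_mult_map[OF b(1)] _ \<xi>])
    fix x assume x: "x \<in> (dual S - dualS1 m n) \<times> Zo m n"
    then have "x \<in> SZ" using Zo_sub_Z by auto
    then show "ext0 SZ (\<lambda>x. b (\<phi> x)) x = 0" using b(2) mult_map_orbit[OF x] by simp
  qed
  then show ?thesis unfolding closureRp_eq using alpha_spec(1)[OF \<xi>] by blast
qed

text \<open>Transfers \<open>finite_generation\<close> from functions on pairs to functions on
  characters: a character applied to the expansion turns the pulled-back coefficients into their
  values at \<open>alpha\<close>.\<close>

lemma alpha_finite:
  assumes Y: "Y \<subseteq> Sm" "\<And>\<xi>. \<xi> \<in> P \<Longrightarrow> alpha m n \<xi> \<in> Y"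
  shows "finite_morphism (quotSZ m n) (closed_subvariety Sm Y) (alpha m n)"
  unfolding finite_morphism_def
proof (intro conjI)
  show "morphism (quotSZ m n) (closed_subvariety Sm Y) (alpha m n)"
    unfolding pts_quot closed_subvariety_simps by (rule alpha_morphism[OF Y(1)]) (use Y in auto)
  obtain P2 e2 where e: "eval_frame Sn P2 e2" using frame_Sym by blast
  obtain M where M: "finite M" "M \<subseteq> Inv" and gen: "\<forall>a\<in>Inv. \<exists>c. (\<forall>b\<in>M. c b \<in> fun_alg Sm (dual Sm)) \<and>
      (\<forall>x\<in>SZ. a x = (\<Sum>b\<in>M. c b (\<phi> x) * b x))"
    using finite_generation[OF e] by blast
  let ?ev = "\<lambda>a. ext0 P (\<lambda>\<xi>. \<xi> a)"
  \<comment> \<open>Invariants are recovered from their values at the points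
    \<open>projSZ m n x\<close>, so distinct generators stay distinct on the quotient and sums over
    \<open>M\<close> can be reindexed.\<close>
  have inj: "inj_on ?ev M"
  proof (rule inj_onI)
    fix a b assume ab: "a \<in> M" "b \<in> M" "?ev a = ?ev b"
    show "a = b"
    proof
      fix x show "a x = b x"
      proof (cases "x \<in> SZ")
        case True
        have "?ev a (projSZ m n x) = ?ev b (projSZ m n x)" by (rule fun_cong[OF ab(3)])
        then show ?thesis
          using projSZ_in[OF True] subsetD[OF M(2) ab(1)] subsetD[OF M(2) ab(2)] by (simp add: projSZ_apply)
      next
        case False
        then show ?thesis
          using fun_subalg_outside[OF subalg_Inv subsetD[OF M(2) ab(1)]]
            fun_subalg_outside[OF subalg_Inv subsetD[OF M(2) ab(2)]] by simp
      qed
    qed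
  qed
  show "\<exists>M. finite M \<and> M \<subseteq> fns (quotSZ m n) \<and> (\<forall>a\<in>fns (quotSZ m n). \<exists>c.
      (\<forall>b\<in>M. c b \<in> fns (closed_subvariety Sm Y)) \<and>
      (\<forall>\<xi>\<in>pts (quotSZ m n). a \<xi> = (\<Sum>b\<in>M. c b (alpha m n \<xi>) * b \<xi>)))"
  proof (intro exI[of _ "?ev ` M"] conjI ballI)
    show "finite (?ev ` M)" using M by simp
    show "?ev ` M \<subseteq> fns (quotSZ m n)" using M unfolding fns_quot by blast
    fix a assume "a \<in> fns (quotSZ m n)"
    then obtain a0 where a0: "a0 \<in> Inv" "a = ?ev a0" unfolding fns_quot by blast
    obtain c where c: "\<forall>b\<in>M. c b \<in> fun_alg Sm (dual Sm)" "\<forall>x\<in>SZ. a0 x = (\<Sum>b\<in>M. c b (\<phi> x) * b x)"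
      using gen a0(1) by blast
    let ?c = "\<lambda>b. ext0 Y (c (inv_into M ?ev b))"
    show "\<exists>c. (\<forall>b\<in>?ev ` M. c b \<in> fns (closed_subvariety Sm Y)) \<and>
        (\<forall>\<xi>\<in>pts (quotSZ m n). a \<xi> = (\<Sum>b\<in>?ev ` M. c b (alpha m n \<xi>) * b \<xi>))"
    proof (intro exI[of _ ?c] conjI ballI)
      fix b assume "b \<in> ?ev ` M"
      then have "inv_into M ?ev b \<in> M" by (rule inv_into_into)
      then show "?c b \<in> fns (closed_subvariety Sm Y)"
        using fun_alg_restrict[OF Y(1)] c(1) by simp
    next
      fix \<xi> assume "\<xi> \<in> pts (quotSZ m n)"
      then have \<xi>: "\<xi> \<in> P" by (simp add: pts_quot)
      have a0_eq: "a0 = (\<lambda>x. \<Sum>b\<in>M. ext0 SZ (\<lambda>x. c b (\<phi> x)) x * b x)"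
      proof
        fix x show "a0 x = (\<Sum>b\<in>M. ext0 SZ (\<lambda>x. c b (\<phi> x)) x * b x)"
          using bspec[OF c(2), of x] fun_subalg_outside[OF subalg_Inv a0(1), of x] by (cases "x \<in> SZ") simp_all
      qed
      have "a \<xi> = \<xi> a0" using \<xi> a0(2) by simp
      also have "\<dots> = \<xi> (\<lambda>x. \<Sum>b\<in>M. ext0 SZ (\<lambda>x. c b (\<phi> x)) x * b x)" by (subst a0_eq) simp
      also have "\<dots> = (\<Sum>b\<in>M. \<xi> (\<lambda>x. ext0 SZ (\<lambda>x. c b (\<phi> x)) x * b x))"
        using c(1) M pull_mult_map
        by (intro alg_hom_sum[OF subalg_Inv hom_P[OF \<xi>]] fun_subalg_mult[OF subalg_Inv]) auto
      also have "\<dots> = (\<Sum>b\<in>M. c b (alpha m n \<xi>) * \<xi> b)"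
      proof (rule sum.cong[OF refl])
        fix b assume b: "b \<in> M"
        then have "\<xi> (\<lambda>x. ext0 SZ (\<lambda>x. c b (\<phi> x)) x * b x) = \<xi> (ext0 SZ (\<lambda>x. c b (\<phi> x))) * \<xi> b"
          using c(1) M pull_mult_map by (intro alg_hom_mult[OF subalg_Inv hom_P[OF \<xi>]]) auto
        then show "\<xi> (\<lambda>x. ext0 SZ (\<lambda>x. c b (\<phi> x)) x * b x) = c b (alpha m n \<xi>) * \<xi> b"
          using alpha_spec(2)[OF \<xi>] c(1) b by simp
      qed
      also have "\<dots> = (\<Sum>b\<in>M. ?c (?ev b) (alpha m n \<xi>) * ?ev b \<xi>)"
      proof (rule sum.cong[OF refl])
        fix b assume "b \<in> M"
        then have "inv_into M ?ev (?ev b) = b" by (rule inv_into_f_f[OF inj])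
        then show "c b (alpha m n \<xi>) * \<xi> b = ?c (?ev b) (alpha m n \<xi>) * ?ev b \<xi>"
          using \<xi> Y(2)[OF \<xi>] by simp
      qed
      also have "\<dots> = (\<Sum>b\<in>?ev ` M. ?c b (alpha m n \<xi>) * b \<xi>)"
        using sum.reindex[OF inj, of "\<lambda>b. ?c b (alpha m n \<xi>) * b \<xi>"] by (simp add: comp_def)
      finally show "a \<xi> = (\<Sum>b\<in>?ev ` M. ?c b (alpha m n \<xi>) * b \<xi>)" .
    qed
  qed
qed

lemma closure_subset_Sm: "closureRp m n \<subseteq> Sm"
  unfolding closureRp_eq by blast

lemma orbit_subset_closure: "orbitRp m n \<subseteq> closureRp m n"
  unfolding closureRp_eq using orbit_subset_Sm by blast

lemma alpha_pull:
  assumes Y: "Y \<subseteq> Sm" "\<And>\<xi>. \<xi> \<in> P \<Longrightarrow> alpha m n \<xi> \<in> Y" and b: "b \<in> fun_alg Y (dual Sm)"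
  shows "ext0 P (\<lambda>\<xi>. b (alpha m n \<xi>)) \<in> fns (quotSZ m n)"
proof -
  obtain b' where b': "b' \<in> fns (quotSZ m n)" "\<forall>\<xi>\<in>P. alpha m n \<xi> \<in> Y \<longrightarrow> b (alpha m n \<xi>) = b' \<xi>"
    using alpha_regular[OF Y(1) b] by blast
  have "ext0 P (\<lambda>\<xi>. b (alpha m n \<xi>)) = ext0 P b'" using b'(2) Y(2) by (intro ext0_cong) blast
  also have "\<dots> = b'" using b'(1) fun_variety_quot fun_subalg_ext0 unfolding fun_variety_def pts_quot by blast
  finally show ?thesis using b'(1) by simp
qed

text \<open>The image contains the orbit and is closed in the whole space of forms by
  \<open>finite_image_closed\<close>, so it contains the closure of the orbit.\<close>

lemma alpha_image: "alpha m n ` P = closureRp m n"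
proof
  show "alpha m n ` P \<subseteq> closureRp m n" using alpha_in_closure by blast
  let ?B = "closed_subvariety Sm Sm"
  have B: "fun_variety ?B" by (rule fun_variety_closed_subvariety)
  have "zariski ?B closure_of (alpha m n ` pts (quotSZ m n)) \<subseteq> alpha m n ` pts (quotSZ m n)"
  proof (rule finite_image_closed[OF subalg_Inv quotSZ_spec B])
    show "finite_morphism (quotSZ m n) ?B (alpha m n)" using alpha_spec(1) by (intro alpha_finite) auto
    show "y = z" if "y \<in> pts ?B" "z \<in> pts ?B" "\<forall>b\<in>fns ?B. b y = b z" for y z
      using fun_alg_dual_separates[OF lin_Sym order_refl] that by auto
    show "alpha m n x \<in> pts ?B" if "x \<in> pts (quotSZ m n)" for x
      using that alpha_spec(1) by (simp add: pts_quot)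
    show "ext0 (pts (quotSZ m n)) (\<lambda>x. b (alpha m n x)) \<in> fns (quotSZ m n)" if "b \<in> fns ?B" for b
      unfolding pts_quot using that alpha_spec(1) by (intro alpha_pull[of Sm]) auto
  qed
  moreover have "orbitRp m n \<subseteq> alpha m n ` pts (quotSZ m n)"
  proof -
    have "quot_open m n \<subseteq> pts (quotSZ m n)" unfolding pts_quot using alpha_preimage_orbit by blast
    then show ?thesis unfolding alpha_quot_open[symmetric] by blast
  qed
  ultimately show "closureRp m n \<subseteq> alpha m n ` P"
    unfolding closureRp_def varQ_def pts_quot using closure_of_mono by blast
qed

lemma alpha_proper:
  "proper_morphism (quotSZ m n) (closed_subvariety Sm (closureRp m n)) (alpha m n)"
proof (rule finite_imp_proper[OF subalg_Inv quotSZ_spec fun_variety_closed_subvariety])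
  let ?B = "closed_subvariety Sm (closureRp m n)"
  show "finite_morphism (quotSZ m n) ?B (alpha m n)"
    by (rule alpha_finite[OF closure_subset_Sm alpha_in_closure])
  show "y = z" if "y \<in> pts ?B" "z \<in> pts ?B" "\<forall>b\<in>fns ?B. b y = b z" for y z
    using fun_alg_dual_separates[OF lin_Sym closure_subset_Sm] that by auto
  show "ext0 (pts (quotSZ m n)) (\<lambda>x. b (alpha m n x)) \<in> fns (quotSZ m n)" if "b \<in> fns ?B" for b
    unfolding pts_quot using that by (intro alpha_pull[OF closure_subset_Sm alpha_in_closure]) auto
qed

(* The orbit is open in its closure as well, but the larger open set where the coefficient of x_11^(m-n)
   is nonzero suffices and is visibly open. *)
lemma alpha_birational:
  "birational_morphism (quotSZ m n) (closed_subvariety Sm (closureRp m n)) (alpha m n)"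
proof -
  let ?B = "closed_subvariety Sm (closureRp m n)"
  define W where "W = {y \<in> closureRp m n. \<exists>X\<in>S1. coeff11 d y X \<noteq> 0}"
  have B: "fun_variety ?B" by (rule fun_variety_closed_subvariety)
  have c: "ext0 (closureRp m n) (\<lambda>q. coeff11 d q X) \<in> fns ?B" for X
    using coeff11_in_fns[OF closure_subset_Sm] by simp
  \<comment> \<open>Both sets are cut out by the same condition on the value of
    \<open>alpha\<close>, and \<open>alpha\<close> maps onto the closure.\<close>
  have UW: "alpha m n ` strat = W"
    unfolding strat_def W_def alpha_image[symmetric] by blast
  have stratP: "strat \<subseteq> pts (quotSZ m n)" by (auto simp: strat_def pts_quot)
  have "dense_open (quotSZ m n) strat"
    unfolding dense_open_def
  proof
    show "openin (zariski (quotSZ m n)) strat"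
      unfolding openin_zariski[OF fun_variety_quot]
    proof (intro conjI ballI stratP)
      fix \<xi> assume "\<xi> \<in> strat"
      then obtain X where X: "\<xi> \<in> P" "X \<in> S1" "coeff11 d (alpha m n \<xi>) X \<noteq> 0" by (auto simp: strat_def)
      let ?f = "ext0 P (\<lambda>\<xi>. ext0 (closureRp m n) (\<lambda>q. coeff11 d q X) (alpha m n \<xi>))"
      have f: "?f \<xi>' = coeff11 d (alpha m n \<xi>') X" if "\<xi>' \<in> P" for \<xi>' using alpha_in_closure that by simp
      have "?f \<in> fns (quotSZ m n)"
        by (rule alpha_pull[OF closure_subset_Sm alpha_in_closure]) (use c in simp_all)
      then show "\<exists>f\<in>fns (quotSZ m n). f \<xi> \<noteq> 0 \<and> (\<forall>y\<in>pts (quotSZ m n). f y \<noteq> 0 \<longrightarrow> y \<in> strat)"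
        using f X by (intro bexI[of _ ?f]) (auto simp: strat_def pts_quot)
    qed
    \<comment> \<open>The points over the orbit lie in \<open>strat\<close> and are already
      dense.\<close>
    have "f y = 0" if y: "y \<in> P" and f: "f \<in> fns (quotSZ m n)" "\<forall>x\<in>strat. f x = 0" for y f
    proof -
      obtain a where a: "a \<in> Inv" "f = ext0 P (\<lambda>\<xi>. \<xi> a)" using f(1) unfolding fns_quot by blast
      have "y a = 0"
      proof (rule Inv_vanish[OF a(1) _ y])
        fix x assume x: "x \<in> (dual S - dualS1 m n) \<times> Zo m n"
        then have "projSZ m n x \<in> strat" using quot_open_subset by (auto simp: quot_open_def)
        then have "f (projSZ m n x) = 0" using f(2) by blast
        moreover have "x \<in> SZ" using x Zo_sub_Z by auto
        ultimately show "a x = 0" using a projSZ_in projSZ_apply by simp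
      qed
      then show ?thesis using a(2) y by simp
    qed
    then show "zariski (quotSZ m n) closure_of strat = pts (quotSZ m n)"
      unfolding zariski_closure_of[OF fun_variety_quot stratP] pts_quot by blast
  qed
  moreover have "dense_open ?B W"
    unfolding dense_open_def
  proof
    have WB: "W \<subseteq> pts ?B" by (auto simp: W_def)
    show "openin (zariski ?B) W"
      unfolding openin_zariski[OF B]
    proof (intro conjI ballI WB)
      fix y assume "y \<in> W"
      then obtain X where X: "y \<in> closureRp m n" "X \<in> S1" "coeff11 d y X \<noteq> 0" by (auto simp: W_def)
      then show "\<exists>f\<in>fns ?B. f y \<noteq> 0 \<and> (\<forall>y\<in>pts ?B. f y \<noteq> 0 \<longrightarrow> y \<in> W)"
        using c[of X] by (intro bexI[of _ "ext0 (closureRp m n) (\<lambda>q. coeff11 d q X)"]) (auto simp: W_def)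
    qed
    have "f y = 0" if y: "y \<in> closureRp m n" and f: "f \<in> fns ?B" "\<forall>x\<in>W. f x = 0" for y f
    proof -
      obtain f' where f': "f' \<in> fun_alg Sm (dual Sm)" "f = ext0 (closureRp m n) f'"
        using fun_alg_extend[OF closure_subset_Sm] f(1) by auto
      have "orbitRp m n \<subseteq> W" unfolding UW[symmetric] alpha_quot_open[symmetric] using quot_open_subset by blast
      then have "f' x = 0" if "x \<in> orbitRp m n" for x
        using f(2) f'(2) that orbit_subset_closure by (metis ext0_in subsetD)
      then have "f' y = 0" using y f'(1) unfolding closureRp_eq by blast
      then show ?thesis using f'(2) y by simp
    qed
    then show "zariski ?B closure_of W = pts ?B"
      unfolding zariski_closure_of[OF B WB] closed_subvariety_simps(1) by blast
  qed
  moreover have "biregular_on (quotSZ m n) strat ?B W (alpha m n)"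
    by (rule alpha_biregular[OF closure_subset_Sm order_refl _ UW]) (auto simp: W_def)
  moreover have "morphism (quotSZ m n) ?B (alpha m n)"
    unfolding pts_quot closed_subvariety_simps
    by (rule alpha_morphism[OF closure_subset_Sm]) (use alpha_in_closure in auto)
  ultimately show ?thesis unfolding birational_morphism_def by blast
qed

end

theorem proposition6p3:
  fixes m n :: nat
  assumes "3 \<le> n" and "n < m"
  shows "morphism (quotSZ m n) (varQ m) (alpha m n) \<and>
    (\<forall>l\<in>dual (spaceS m n). \<forall>f\<in>Z m n.
       alpha m n (projSZ m n (l, f)) = (\<lambda>X. bar m n l X ^ (m - n) * f X)) \<and>
    finite_morphism (quotSZ m n) (varQ m) (alpha m n) \<and>
    alpha m n ` pts (quotSZ m n) = closureRp m n \<and>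
    {\<xi> \<in> pts (quotSZ m n). alpha m n \<xi> \<in> orbitRp m n} = quot_open m n \<and>
    biregular_on (quotSZ m n) (quot_open m n) (varQ m) (orbitRp m n) (alpha m n) \<and>
    (let Y = closed_subvariety (sym_power_dual m (spaceE m)) (closureRp m n) in
       proper_morphism (quotSZ m n) Y (alpha m n) \<and>
       birational_morphism (quotSZ m n) Y (alpha m n))"
proof -
  interpret permanent_spaces m n using assms by unfold_locales auto
  have fin: "finite_morphism (quotSZ m n) (varQ m) (alpha m n)"
    unfolding varQ_def by (rule alpha_finite) (use alpha_spec(1) in auto)
  moreover from fin have "morphism (quotSZ m n) (varQ m) (alpha m n)"
    unfolding finite_morphism_def by blast
  moreover have "\<forall>l\<in>dual (spaceS m n). \<forall>f\<in>Z m n.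
      alpha m n (projSZ m n (l, f)) = (\<lambda>X. bar m n l X ^ (m - n) * f X)"
    using alpha_projSZ by (simp add: mult_map_def)
  moreover have "biregular_on (quotSZ m n) (quot_open m n) (varQ m) (orbitRp m n) (alpha m n)"
    unfolding varQ_def
    by (rule alpha_biregular[OF order_refl quot_open_subset orbit_subset_Sm alpha_quot_open])
  ultimately show ?thesis
    using alpha_image alpha_preimage_orbit alpha_proper alpha_birational by (simp add: pts_quot)
qed

end
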